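(* Let $d\geq 2$ and $n\in[1,2d+2]$ be integers and let $\Sigma$ be a finite set of prime numbers. Let $\mathcal{V}_\Sigma$ be the set of rational maps $\phi\in\mathbb{Q}(z)$ of degree $d$ such that $\operatorname{Res}(\phi)$ is not divisible by $p^{d}$ for any prime $p$ (i.e. $d$-power free) and $\phi$ has good reduction at every prime $p\in\Sigma$. Then: (1) every $\phi\in\mathcal{V}_\Sigma$ has globally minimal resultant; (2) the $n$-th weak box density $\mu_n(\mathcal{V}_\Sigma)$ exists and is positive. Consequently, with respect to $\mu_n$, a positive proportion of rational maps of degree $d$ over $\mathbb{Q}$ have good reduction at all primes of $\Sigma$ and globally minimal resultant.
   Context: Identify $\mathbb{P}^{2d+1}(\mathbb{Q})$ with the set of integer vectors $(C_1,\dots,C_{2d+2})\in\mathbb{Z}^{2d+2}$ with $\gcd=1$ whose first nonzero coordinate is positive; write coordinates as $(A_0,\dots,A_d,B_0,\dots,B_d)$. A rational map $\phi\in\mathbb{Q}(z)$ of degree $d$ is written uniquely as $\phi(X/Y)=F/G$ with $F=\sum_{i=0}^d A_iX^iY^{d-i}$, $G=\sum_{j=0}^d B_jX^jY^{d-j}$ coprime and $(A_0,\dots,B_d)$ such a normalized vector; this identifies degree-$d$ rational maps with a subset of $\mathbb{P}^{2d+1}(\mathbb{Q})$. $\operatorname{Res}(\phi):=\operatorname{Res}(F,G)$; $\phi$ has good reduction at $p$ if $p\nmid\operatorname{Res}(\phi)$. For $A\in\mathrm{PGL}_2(\mathbb{Q})$, $\phi^A=A^{-1}\circ\phi\circ A$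 and $\epsilon_p(\phi)=\min_A\operatorname{ord}_p\operatorname{Res}(\phi^A)$; $\phi$ is globally minimal if $\operatorname{ord}_p\operatorname{Res}(\phi)=\epsilon_p(\phi)$ for all $p$. For $\vec r=(r_1,\dots,r_{2d+2})$ positive reals and $\mathcal{S}\subseteq\mathbb{P}^{2d+1}(\mathbb{Q})$, let $\mathcal{S}(\vec r)$ be the set of normalized vectors $(C_1,\dots,C_{2d+2})\in\mathcal{S}$ with $|C_i|\le r_i$ for all $i$. The lower (resp. upper) $n$-th weak box density is $\underline{\mu_n}(\mathcal{S})=\liminf_{r_i\to\infty, i\ne n}\big(\liminf_{r_n\to\infty}\#\mathcal{S}(\vec r)/\#\mathbb{P}^{2d+1}(\mathbb{Q})(\vec r)\big)$ (resp. the same with $\limsup$ twice); if they agree, $\mu_n(\mathcal{S})$ is the common value. *)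

theory Defs
  imports
    "HOL-Computational_Algebra.Normalized_Fraction"
    "HOL-Computational_Algebra.Polynomial_Factorial"
    "HOL-Computational_Algebra.Field_as_Ring"
    "HOL-Library.Extended_Real"
    "HOL-Library.Liminf_Limsup"
    "Subresultants.Resultant_Prelim"
begin

text \<open>
  Points of \<open>\<bbbP>\<^sup>N(\<rat>)\<close>, as primitive integer vectors with \<open>N + 1\<close> coordinates whose first
  nonzero coordinate is positive. The mathematical coordinate \<open>C\<^sub>i\<close>, with \<open>1 \<le> i \<le> N + 1\<close>,
  is \<open>C $ (i - 1)\<close>.
\<close>

definition proj_points :: "nat \<Rightarrow> int vec set" where
  "proj_points N =
     {C \<in> carrier_vec (N + 1). Gcd (set\<^sub>v C) = 1 \<and> (\<exists>i\<le>N. C $ i > 0 \<and> (\<forall>j<i. C $ j = 0))}"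

text \<open>
  A vector \<open>C = (A\<^sub>0, \<dots>, A\<^sub>d, B\<^sub>0, \<dots>, B\<^sub>d)\<close> gives \<open>F = \<Sum> A\<^sub>i X\<^sup>i Y\<^bsup>d-i\<^esup>\<close> and
  \<open>G = \<Sum> B\<^sub>i X\<^sup>i Y\<^bsup>d-i\<^esup>\<close>. The polynomials \<open>num_poly d C\<close> and \<open>den_poly d C\<close> are \<open>F(z, 1)\<close> and
  \<open>G(z, 1)\<close>; the forms themselves are elements of \<open>\<rat>[Y][X]\<close>, so the outer variable is \<open>X\<close>.
\<close>

definition num_poly :: "nat \<Rightarrow> int vec \<Rightarrow> int poly" where
  "num_poly d C = (\<Sum>i\<le>d. monom (C $ i) i)"

definition den_poly :: "nat \<Rightarrow> int vec \<Rightarrow> int poly" where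
  "den_poly d C = (\<Sum>i\<le>d. monom (C $ (d + 1 + i)) i)"

definition num_form :: "nat \<Rightarrow> int vec \<Rightarrow> rat poly poly" where
  "num_form d C = (\<Sum>i\<le>d. monom (monom (of_int (C $ i)) (d - i)) i)"

definition den_form :: "nat \<Rightarrow> int vec \<Rightarrow> rat poly poly" where
  "den_form d C = (\<Sum>i\<le>d. monom (monom (of_int (C $ (d + 1 + i))) (d - i)) i)"

text \<open>
  The resultant of the pair of binary forms of degree \<open>d\<close>: the Sylvester determinant is taken
  with formal degrees \<open>d\<close> and \<open>d\<close>, since \<open>F(z, 1)\<close> or \<open>G(z, 1)\<close> may have smaller degree.
\<close>

definition form_resultant :: "nat \<Rightarrow> int vec \<Rightarrow> int" where
  "form_resultant d C = resultant_sub d d (num_poly d C) (den_poly d C)"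

type_synonym ratfun = "rat poly fract"

definition rat_degree :: "ratfun \<Rightarrow> nat" where
  "rat_degree \<phi> = (case quot_of_fract \<phi> of (P, Q) \<Rightarrow> max (degree P) (degree Q))"

text \<open>
  The denominator is required to be nonzero because \<open>Fract a 0 = 0\<close>.
\<close>

definition is_coeff_vec :: "nat \<Rightarrow> ratfun \<Rightarrow> int vec \<Rightarrow> bool" where
  "is_coeff_vec d \<phi> C \<longleftrightarrow>
     C \<in> proj_points (2 * d + 1) \<and>
     coprime (num_form d C) (den_form d C) \<and>
     den_poly d C \<noteq> 0 \<and>
     \<phi> = Fract (map_poly of_int (num_poly d C)) (map_poly of_int (den_poly d C))"

text \<open>
  The lemma \<open>coeff_vec_unique_existence\<close> below shows that exactly one such vector exists.
\<close>

definition coeff_vec :: "ratfun \<Rightarrow> int vec" where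
  "coeff_vec \<phi> = (THE C. is_coeff_vec (rat_degree \<phi>) \<phi> C)"

definition rat_resultant :: "ratfun \<Rightarrow> int" where
  "rat_resultant \<phi> = form_resultant (rat_degree \<phi>) (coeff_vec \<phi>)"

definition good_reduction_at :: "nat \<Rightarrow> ratfun \<Rightarrow> bool" where
  "good_reduction_at p \<phi> \<longleftrightarrow> \<not> int p dvd rat_resultant \<phi>"

text \<open>
  Composition in \<open>\<rat>(z)\<close>. If \<open>\<psi>\<close> is nonconstant, then the denominator below is nonzero; this is
  the only case that is used.
\<close>

definition rat_compose :: "ratfun \<Rightarrow> ratfun \<Rightarrow> ratfun" where
  "rat_compose \<phi> \<psi> = (case quot_of_fract \<phi> of (P, Q) \<Rightarrow>
     poly (map_poly (\<lambda>c. to_fract [:c:]) P) \<psi> / poly (map_poly (\<lambda>c. to_fract [:c:]) Q) \<psi>)"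

definition moebius_map :: "rat \<Rightarrow> rat \<Rightarrow> rat \<Rightarrow> rat \<Rightarrow> ratfun" where
  "moebius_map a b c e = Fract [:b, a:] [:e, c:]"

text \<open>
  Elements of \<open>PGL\<^sub>2(\<rat>)\<close> are represented by invertible matrices with rows \<open>(a, b)\<close> and \<open>(c, e)\<close>;
  the adjugate, with rows \<open>(e, -b)\<close> and \<open>(-c, a)\<close>, represents the inverse.
\<close>

definition GL2 :: "(rat \<times> rat \<times> rat \<times> rat) set" where
  "GL2 = {(a, b, c, e). a * e - b * c \<noteq> 0}"

definition moebius_conj :: "rat \<times> rat \<times> rat \<times> rat \<Rightarrow> ratfun \<Rightarrow> ratfun" where
  "moebius_conj A \<phi> = (case A of (a, b, c, e) \<Rightarrow>
     rat_compose (moebius_map e (- b) (- c) a) (rat_compose \<phi> (moebius_map a b c e)))"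

definition min_ord_res :: "nat \<Rightarrow> ratfun \<Rightarrow> nat" where
  "min_ord_res p \<phi> = (INF A\<in>GL2. multiplicity (int p) (rat_resultant (moebius_conj A \<phi>)))"

definition globally_minimal :: "ratfun \<Rightarrow> bool" where
  "globally_minimal \<phi> \<longleftrightarrow>
     (\<forall>p. prime p \<longrightarrow> multiplicity (int p) (rat_resultant \<phi>) = min_ord_res p \<phi>)"

definition box_points :: "nat \<Rightarrow> int vec set \<Rightarrow> (nat \<Rightarrow> real) \<Rightarrow> int vec set" where
  "box_points d S r = {C \<in> S. \<forall>i\<in>{1..2 * d + 2}. \<bar>real_of_int (C $ (i - 1))\<bar> \<le> r i}"

definition box_ratio :: "nat \<Rightarrow> int vec set \<Rightarrow> (nat \<Rightarrow> real) \<Rightarrow> real" where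
  "box_ratio d S r =
     real (card (box_points d S r)) / real (card (box_points d (proj_points (2 * d + 1)) r))"

text \<open>
  The filter for \<open>r\<^sub>i \<rightarrow> \<infinity>\<close> jointly for all \<open>i \<noteq> n\<close> in \<open>{1..2d+2}\<close>. The value of \<open>r\<close> at \<open>n\<close> is
  overwritten by the inner variable \<open>t\<close> in the densities below.
\<close>

definition others_at_top :: "nat \<Rightarrow> nat \<Rightarrow> (nat \<Rightarrow> real) filter" where
  "others_at_top d n = (INF i\<in>{1..2 * d + 2} - {n}. filtercomap (\<lambda>r. r i) at_top)"

definition lower_weak_box_density :: "nat \<Rightarrow> nat \<Rightarrow> int vec set \<Rightarrow> ereal" where
  "lower_weak_box_density d n S =
     Liminf (others_at_top d n) (\<lambda>r. Liminf at_top (\<lambda>t. ereal (box_ratio d S (r(n := t)))))"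

definition upper_weak_box_density :: "nat \<Rightarrow> nat \<Rightarrow> int vec set \<Rightarrow> ereal" where
  "upper_weak_box_density d n S =
     Limsup (others_at_top d n) (\<lambda>r. Limsup at_top (\<lambda>t. ereal (box_ratio d S (r(n := t)))))"

definition has_weak_box_density :: "nat \<Rightarrow> nat \<Rightarrow> int vec set \<Rightarrow> real \<Rightarrow> bool" where
  "has_weak_box_density d n S \<mu> \<longleftrightarrow>
     lower_weak_box_density d n S = ereal \<mu> \<and> upper_weak_box_density d n S = ereal \<mu>"

definition power_free_res_maps :: "nat \<Rightarrow> nat set \<Rightarrow> ratfun set" where
  "power_free_res_maps d \<Sigma> =
     {\<phi>. rat_degree \<phi> = d \<and> (\<forall>p. prime p \<longrightarrow> \<not> int p ^ d dvd rat_resultant \<phi>) \<and>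
         (\<forall>p\<in>\<Sigma>. good_reduction_at p \<phi>)}"

definition good_minimal_maps :: "nat \<Rightarrow> nat set \<Rightarrow> ratfun set" where
  "good_minimal_maps d \<Sigma> =
     {\<phi>. rat_degree \<phi> = d \<and> (\<forall>p\<in>\<Sigma>. good_reduction_at p \<phi>) \<and> globally_minimal \<phi>}"


lemma coeff_num_poly: "coeff (num_poly d C) i = (if i \<le> d then C $ i else 0)"
  by (auto simp: num_poly_def coeff_sum if_distrib cong: if_cong)

lemma coeff_den_poly: "coeff (den_poly d C) i = (if i \<le> d then C $ (d + 1 + i) else 0)"
  by (auto simp: den_poly_def coeff_sum if_distrib cong: if_cong)

lemma coeff_num_form:
  "coeff (num_form d C) i = (if i \<le> d then monom (of_int (C $ i)) (d - i) else 0)"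
  by (auto simp: num_form_def coeff_sum if_distrib cong: if_cong)

lemma coeff_den_form:
  "coeff (den_form d C) i = (if i \<le> d then monom (of_int (C $ (d + 1 + i))) (d - i) else 0)"
  by (auto simp: den_form_def coeff_sum if_distrib cong: if_cong)

lemma proj_point_scale_exists:
  fixes f :: "nat \<Rightarrow> rat"
  assumes "\<exists>i\<le>N. f i \<noteq> 0"
  shows "\<exists>C\<in>proj_points N. \<exists>h. h \<noteq> 0 \<and> (\<forall>i\<le>N. of_int (C $ i) = h * f i)"
proof -
  define D where "D = (\<Prod>i\<le>N. snd (quotient_of (f i)))"
  have D: "D > 0"
    unfolding D_def by (intro prod_pos) (auto simp: quotient_of_denom_pos')
  have "\<exists>g. of_int g = of_int D * f i" if "i \<le> N" for i
  proof -
    obtain a b where ab: "quotient_of (f i) = (a, b)"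
      by (cases "quotient_of (f i)")
    then have fi: "f i = of_int a / of_int b" and b: "b > 0"
      by (auto simp: quotient_of_div quotient_of_denom_pos)
    have "b dvd D"
      unfolding D_def using dvd_prodI[of "{..N}" i "\<lambda>i. snd (quotient_of (f i))"] that ab by simp
    then obtain k where "D = b * k" ..
    then show ?thesis
      using fi b by (intro exI[of _ "a * k"]) simp
  qed
  then obtain g where g: "\<And>i. i \<le> N \<Longrightarrow> of_int (g i) = of_int D * f i"
    by metis
  obtain i0 where i0: "i0 \<le> N" "f i0 \<noteq> 0"
    using assms by blast
  have g_0_iff: "g i = 0 \<longleftrightarrow> f i = 0" if "i \<le> N" for i
    using g[OF that] D by (metis mult_eq_0_iff of_int_eq_0_iff order_less_irrefl)
  define k where "k = (LEAST i. g i \<noteq> 0)"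
  have gi0: "g i0 \<noteq> 0"
    using i0 g_0_iff by blast
  have k: "g k \<noteq> 0" "k \<le> N" "\<And>j. j < k \<Longrightarrow> g j = 0"
    unfolding k_def using LeastI[of "\<lambda>i. g i \<noteq> 0", OF gi0]
      Least_le[of "\<lambda>i. g i \<noteq> 0", OF gi0] i0 not_less_Least by force+
  define G where "G = Gcd (g ` {..N})"
  have G: "G > 0"
  proof -
    have "G \<noteq> 0"
      unfolding G_def using k by (auto simp: Gcd_0_iff)
    moreover have "G \<ge> 0"
      unfolding G_def by simp
    ultimately show ?thesis by simp
  qed
  have Gdvd: "G dvd g i" if "i \<le> N" for i
    unfolding G_def using that by (intro Gcd_dvd) auto
  define C where "C = vec (N + 1) (\<lambda>i. sgn (g k) * (g i div G))"
  have Ci: "C $ i = sgn (g k) * (g i div G)" if "i \<le> N" for i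
    using that by (simp add: C_def)
  have set_C: "set\<^sub>v C = (\<lambda>i. sgn (g k) * (g i div G)) ` {..N}"
  proof -
    have "set\<^sub>v C = ($) C ` {..N}"
      by (simp add: vec_set_def C_def lessThan_Suc_atMost)
    also have "\<dots> = (\<lambda>i. sgn (g k) * (g i div G)) ` {..N}"
      by (rule image_cong) (simp_all add: Ci)
    finally show ?thesis .
  qed
  have GcdC: "Gcd (set\<^sub>v C) = 1"
  proof -
    define e where "e = Gcd (set\<^sub>v C)"
    have "e * G dvd g i" if "i \<le> N" for i
    proof -
      have "e dvd sgn (g k) * (g i div G)"
        unfolding e_def set_C using that by (intro Gcd_dvd) auto
      then have "e dvd g i div G"
        using k(1) by (auto simp: sgn_if split: if_splits)
      then show ?thesis
        using Gdvd[OF that] G by (metis dvd_div_mult_self mult_dvd_mono dvd_refl)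
    qed
    then have "e * G dvd G"
      unfolding G_def by (intro Gcd_greatest) auto
    then have "e dvd 1"
      using G by (metis dvd_mult_cancel_right mult_1 order_less_irrefl)
    moreover have "e \<ge> 0"
      unfolding e_def by simp
    ultimately show ?thesis
      unfolding e_def[symmetric] by (simp add: zdvd1_eq)
  qed
  have "C \<in> proj_points N"
  proof -
    have "C $ k > 0"
    proof -
      obtain m where m: "g k = G * m"
        using Gdvd[OF k(2)] ..
      have "m \<noteq> 0"
        using m k(1) by auto
      then show ?thesis
        using Ci[OF k(2)] m G by (auto simp: sgn_mult sgn_if mult_less_0_iff zero_less_mult_iff)
    qed
    moreover have "\<forall>j<k. C $ j = 0"
      using k(2,3) Ci by auto
    ultimately show ?thesis
      unfolding proj_points_def using GcdC k(2) by (auto simp: C_def)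
  qed
  moreover have "of_int (C $ i) = (of_int (sgn (g k)) * of_int D / of_int G) * f i" if "i \<le> N" for i
  proof -
    obtain m where m: "g i = G * m"
      using Gdvd[OF \<open>i \<le> N\<close>] ..
    have "of_int G * of_int m = of_int D * f i"
      using g[OF that] unfolding m by simp
    then have "of_int m = of_int D * f i / of_int G"
      using G by (simp add: field_simps)
    then show ?thesis
      using Ci[OF that] m G by simp
  qed
  moreover have "of_int (sgn (g k)) * of_int D / of_int G \<noteq> (0 :: rat)"
    using D G k(1) by (auto simp: sgn_if)
  ultimately show ?thesis
    by blast
qed

lemma proj_points_nonzero: "C \<in> proj_points N \<Longrightarrow> \<exists>i\<le>N. C $ i \<noteq> 0"
  unfolding proj_points_def by force

lemma proj_points_scale_unique:
  fixes h :: rat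
  assumes C: "C \<in> proj_points N" and C': "C' \<in> proj_points N"
    and eq: "\<forall>i\<le>N. of_int (C' $ i) = h * of_int (C $ i)"
  shows "C' = C"
proof -
  obtain a b where ab: "quotient_of h = (a, b)"
    by (cases "quotient_of h")
  have h: "h = of_int a / of_int b" and b: "b > 0"
    using ab by (auto simp: quotient_of_div quotient_of_denom_pos)
  have eq': "b * C' $ i = a * C $ i" if "i \<le> N" for i
  proof -
    have "of_int (b * C' $ i) = (of_int (a * C $ i) :: rat)"
      using eq that h b by (simp add: field_simps)
    then show ?thesis
      by (simp only: of_int_eq_iff)
  qed
  have dims: "dim_vec C = N + 1" "dim_vec C' = N + 1"
    using C C' by (auto simp: proj_points_def)
  have sets: "set\<^sub>v C = (\<lambda>i. C $ i) ` {..N}" "set\<^sub>v C' = (\<lambda>i. C' $ i) ` {..N}"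
    using dims by (auto simp: vec_set_def less_Suc_eq_le)
  have "(\<lambda>i. b * C' $ i) ` {..N} = (\<lambda>i. a * C $ i) ` {..N}"
    using eq' by (intro image_cong) auto
  then have "(*) b ` set\<^sub>v C' = (*) a ` set\<^sub>v C"
    unfolding sets by (simp add: image_image)
  then have "Gcd ((*) b ` set\<^sub>v C') = Gcd ((*) a ` set\<^sub>v C)"
    by simp
  then have "\<bar>b\<bar> = \<bar>a\<bar>"
    using C C' by (simp add: Gcd_mult proj_points_def)
  then consider "a = b" | "a = - b"
    by linarith
  then have ci: "(\<forall>i\<le>N. C' $ i = C $ i) \<or> (\<forall>i\<le>N. C' $ i = - C $ i)"
  proof cases
    case 1
    then show ?thesis using eq' b by simp
  next
    case 2
    have "b * C' $ i = b * (- C $ i)" if "i \<le> N" for i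
      using eq'[OF that] 2 by simp
    then have "C' $ i = - C $ i" if "i \<le> N" for i
      using that b by (metis mult_cancel_left order_less_irrefl)
    then show ?thesis by blast
  qed
  moreover have False if neg: "\<forall>i\<le>N. C' $ i = - C $ i"
  proof -
    obtain i where i: "i \<le> N" "C $ i > 0" "\<forall>j<i. C $ j = 0"
      using C by (auto simp: proj_points_def)
    obtain j where j: "j \<le> N" "C' $ j > 0" "\<forall>i<j. C' $ i = 0"
      using C' by (auto simp: proj_points_def)
    have "C $ j < 0" "C' $ i < 0"
      using i j neg by auto
    then have "\<not> j < i" "\<not> i < j" 
      using i(3) j(3) by auto
    then have "i = j" by simp
    then show False using i(2) \<open>C $ j < 0\<close> by simp
  qed
  ultimately have "\<forall>i\<le>N. C' $ i = C $ i"
    by blast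
  then show ?thesis
    using dims by (intro eq_vecI) (auto simp: less_Suc_eq_le)
qed

text \<open>
  The lowest-terms representation of \<open>\<phi>\<close> differs from any representation with formal degree
  \<open>rat_degree \<phi>\<close> only by a constant.
\<close>

lemma Fract_formal_degree:
  assumes \<phi>: "\<phi> = Fract F G" and G: "G \<noteq> 0"
    and deg: "degree F \<le> rat_degree \<phi>" "degree G \<le> rat_degree \<phi>"
    and PQ: "quot_of_fract \<phi> = (P, Q)"
  shows "\<exists>h. h \<noteq> 0 \<and> F = smult h P \<and> G = smult h Q"
proof -
  have cop: "coprime P Q" and Q: "Q \<noteq> 0"
    using coprime_quot_of_fract[of \<phi>] snd_quot_of_fract_nonzero[of \<phi>] PQ by simp_all
  have "Fract F G = Fract P Q"
    unfolding \<phi>[symmetric] using Fract_quot_of_fract[of \<phi>] unfolding PQ fst_conv snd_conv by (rule sym)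
  then have eq: "F * Q = P * G"
    using G Q by (simp add: eq_fract)
  then have "Q dvd P * G"
    by (metis dvd_triv_right)
  then have "Q dvd G"
    using cop by (simp add: coprime_commute coprime_dvd_mult_right_iff)
  then obtain H where H: "G = Q * H" ..
  have "F * Q = (P * H) * Q"
    using eq H by (simp add: ac_simps)
  then have F: "F = P * H"
    using Q by simp
  have H0: "H \<noteq> 0"
    using G H by auto
  have "degree H = 0"
  proof (cases "degree P \<le> degree Q")
    case True
    then show ?thesis
      using deg(2) PQ H Q H0 by (simp add: rat_degree_def degree_mult_eq)
  next
    case False
    then have "P \<noteq> 0" by auto
    then show ?thesis
      using False deg(1) PQ F H0 by (simp add: rat_degree_def degree_mult_eq)
  qed
  then obtain h where "H = [:h:]"
    by (rule degree_eq_zeroE)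
  then show ?thesis
    using F H H0 by (intro exI[of _ h]) auto
qed

text \<open>
  Consequently coprimality of the forms is automatic once \<open>\<phi>\<close> has degree equal to the formal
  degree.
\<close>

lemma coprime_forms:
  assumes cop: "coprime (map_poly rat_of_int (num_poly d C)) (map_poly rat_of_int (den_poly d C))"
    and lead: "C $ d \<noteq> 0 \<or> C $ (2 * d + 1) \<noteq> 0"
  shows "coprime (num_form d C) (den_form d C)"
proof (rule coprimeI)
  fix H assume Hn: "H dvd num_form d C" and Hd: "H dvd den_form d C"
  have eval: "map_poly (\<lambda>q. poly q y) (num_form d C) =
        smult (y ^ d) (pcompose (map_poly of_int (num_poly d C)) [:0, 1 / y:])"
      "map_poly (\<lambda>q. poly q y) (den_form d C) =
        smult (y ^ d) (pcompose (map_poly of_int (den_poly d C)) [:0, 1 / y:])"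
    if "y \<noteq> 0" for y :: rat
    using that
    by (auto intro!: poly_eqI simp: coeff_map_poly coeff_num_form coeff_den_form coeff_num_poly
        coeff_den_poly poly_monom coeff_pcompose_linear power_diff field_simps)
  have hom: "map_poly (\<lambda>q. poly q y) (p * q) =
      map_poly (\<lambda>q. poly q y) p * map_poly (\<lambda>q. poly q y) q" for y :: rat and p q
    by (rule poly_eqI) (simp add: coeff_map_poly coeff_mult poly_sum)
  obtain u v where uv: "u * map_poly rat_of_int (num_poly d C) +
      v * map_poly rat_of_int (den_poly d C) = 1"
    using bezout_coefficients_fst_snd[of "map_poly rat_of_int (num_poly d C)"
        "map_poly rat_of_int (den_poly d C)"] cop
    by (metis coprime_iff_gcd_eq_1)
  have unit: "map_poly (\<lambda>q. poly q y) H dvd 1" if y: "y \<noteq> 0" for y :: rat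
  proof -
    let ?H = "map_poly (\<lambda>q. poly q y) H"
    let ?s = "\<lambda>p. pcompose p [:0, 1 / y:]"
    have "?H dvd smult (y ^ d) (?s (map_poly of_int (num_poly d C)))"
      using Hn unfolding eval(1)[OF y, symmetric] by (auto simp: dvd_def hom)
    then have n: "?H dvd ?s (map_poly of_int (num_poly d C))"
      using y by (simp add: dvd_smult_iff)
    have "?H dvd smult (y ^ d) (?s (map_poly of_int (den_poly d C)))"
      using Hd unfolding eval(2)[OF y, symmetric] by (auto simp: dvd_def hom)
    then have d: "?H dvd ?s (map_poly of_int (den_poly d C))"
      using y by (simp add: dvd_smult_iff)
    have "?s u * ?s (map_poly of_int (num_poly d C)) +
        ?s v * ?s (map_poly of_int (den_poly d C)) = 1"
      using arg_cong[OF uv, of ?s] by (simp add: pcompose_add pcompose_mult pcompose_1)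
    then show ?thesis
      using n d by (metis dvd_add dvd_mult)
  qed
  have "coeff H i = 0" if "i > 0" for i
  proof (rule ccontr)
    assume "coeff H i \<noteq> 0"
    then have "finite {y. poly (coeff H i) y = 0}"
      by (rule poly_roots_finite)
    then have "finite ({y. poly (coeff H i) y = 0} \<union> {0})"
      by simp
    then obtain y where y: "y \<noteq> 0" "poly (coeff H i) y \<noteq> 0"
      using infinite_UNIV_char_0[where ?'a = rat] ex_new_if_finite by blast
    have "degree (map_poly (\<lambda>q. poly q y) H) = 0"
      using unit[OF y(1)] by (simp add: is_unit_iff_degree poly_dvd_1)
    then have "coeff (map_poly (\<lambda>q. poly q y) H) i = 0"
      using that by (intro coeff_eq_0) simp
    then show False
      using y(2) by (simp add: coeff_map_poly)
  qed
  then have "degree H = 0"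
    by (metis leading_coeff_0_iff degree_0 neq0_conv)
  then obtain h where h: "H = [:h:]"
    by (rule degree_eq_zeroE)
  have "h dvd coeff (num_form d C) d" "h dvd coeff (den_form d C) d"
    using Hn Hd h by (simp_all add: const_poly_dvd_iff)
  then have "h dvd 1"
  proof -
    have const: "h dvd 1" if "h dvd [:c:]" "c \<noteq> 0" for c :: rat
    proof -
      have "[:c:] dvd 1"
        using that(2) by (simp add: is_unit_const_poly_iff)
      then show ?thesis
        using that(1) dvd_trans by blast
    qed
    have "h dvd [:of_int (C $ d):]" "h dvd [:of_int (C $ (2 * d + 1)):]"
      using \<open>h dvd coeff (num_form d C) d\<close> \<open>h dvd coeff (den_form d C) d\<close>
      by (simp_all add: coeff_num_form coeff_den_form monom_0 mult_2)
    then show ?thesis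
      using lead const[of "of_int (C $ d)"] const[of "of_int (C $ (2 * d + 1))"] by auto
  qed
  then show "is_unit H"
    using h by (simp add: const_poly_dvd_1)
qed

lemma coeff_vec_unique_existence:
  assumes "rat_degree \<phi> = d"
  shows "\<exists>!C. is_coeff_vec d \<phi> C"
proof (rule ex_ex1I)
  obtain P Q where PQ: "quot_of_fract \<phi> = (P, Q)"
    by (cases "quot_of_fract \<phi>")
  have cop: "coprime P Q" and Q: "Q \<noteq> 0" and \<phi>: "\<phi> = Fract P Q"
    using coprime_quot_of_fract[of \<phi>] snd_quot_of_fract_nonzero[of \<phi>]
      Fract_quot_of_fract[of \<phi>] PQ by simp_all
  have deg: "max (degree P) (degree Q) = d"
    using assms PQ by (simp add: rat_degree_def)
  define f where "f i = (if i \<le> d then coeff P i else coeff Q (i - (d + 1)))" for i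
  have fQ: "f (d + 1 + i) = coeff Q i" for i
    by (simp add: f_def)
  show "\<exists>C. is_coeff_vec d \<phi> C"
  proof -
    have "\<exists>i\<le>2 * d + 1. f i \<noteq> 0"
      using fQ[of "degree Q"] Q deg by (intro exI[of _ "d + 1 + degree Q"]) auto
    then obtain C h where C: "C \<in> proj_points (2 * d + 1)" and h: "h \<noteq> 0"
      and Cf: "\<And>i. i \<le> 2 * d + 1 \<Longrightarrow> of_int (C $ i) = h * f i"
      using proj_point_scale_exists by blast
    have n: "map_poly of_int (num_poly d C) = smult h P"
      using deg by (intro poly_eqI)
        (auto simp: coeff_map_poly coeff_num_poly Cf f_def intro!: coeff_eq_0)
    have e: "map_poly of_int (den_poly d C) = smult h Q"
      using deg by (intro poly_eqI)
        (auto simp: coeff_map_poly coeff_den_poly Cf fQ[simplified] intro!: coeff_eq_0)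
    have "C $ d \<noteq> 0 \<or> C $ (2 * d + 1) \<noteq> 0"
    proof -
      have "coeff P d \<noteq> 0 \<or> coeff Q d \<noteq> 0"
      proof (cases "degree Q = d")
        case True
        then have "coeff Q d \<noteq> 0"
          using Q leading_coeff_neq_0[of Q] by simp
        then show ?thesis ..
      next
        case False
        then have "degree P = d" "P \<noteq> 0"
          using deg by (auto simp: max_def split: if_splits)
        then have "coeff P d \<noteq> 0"
          using leading_coeff_neq_0[of P] by simp
        then show ?thesis ..
      qed
      moreover have "rat_of_int (C $ d) = h * coeff P d"
        using Cf[of d] by (simp add: f_def)
      moreover have "rat_of_int (C $ (2 * d + 1)) = h * coeff Q d"
        using Cf[of "2 * d + 1"] fQ[of d] by (simp add: mult_2)
      ultimately show ?thesis
        using h by auto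
    qed
    then have "coprime (num_form d C) (den_form d C)"
    proof (intro coprime_forms)
      have "coprime (smult h P) (smult h Q)"
      proof (rule coprimeI)
        fix c assume "c dvd smult h P" "c dvd smult h Q"
        then have "c dvd P" "c dvd Q"
          using h by (simp_all add: dvd_smult_iff)
        then show "is_unit c"
          using cop by (rule coprime_common_divisor[rotated])
      qed
      then show "coprime (map_poly rat_of_int (num_poly d C)) (map_poly rat_of_int (den_poly d C))"
        by (simp only: n e)
    qed
    moreover have "den_poly d C \<noteq> 0"
    proof
      assume "den_poly d C = 0"
      then have "smult h Q = 0"
        using e by simp
      then show False
        using Q h by simp
    qed
    moreover have "\<phi> = Fract (map_poly of_int (num_poly d C)) (map_poly of_int (den_poly d C))"
    proof -
      have "Fract (smult h P) (smult h Q) = Fract P Q"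
        using Q h by (simp add: eq_fract)
      from trans[OF \<phi> this[symmetric]] show ?thesis
        unfolding n e .
    qed
    ultimately show ?thesis
      using C unfolding is_coeff_vec_def by (intro exI[of _ C] conjI)
  qed
  have scale: "\<exists>h. h \<noteq> 0 \<and> (\<forall>i\<le>2 * d + 1. of_int (C $ i) = h * f i)" if "is_coeff_vec d \<phi> C" for C
  proof -
    have "degree (map_poly rat_of_int (num_poly d C)) \<le> d"
      "degree (map_poly rat_of_int (den_poly d C)) \<le> d"
      by (intro degree_le; simp add: coeff_map_poly coeff_num_poly coeff_den_poly)+
    then have deg': "degree (map_poly rat_of_int (num_poly d C)) \<le> rat_degree \<phi>"
      "degree (map_poly rat_of_int (den_poly d C)) \<le> rat_degree \<phi>"
      using assms by simp_all
    have nz: "map_poly rat_of_int (den_poly d C) \<noteq> 0"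
      using that by (simp add: is_coeff_vec_def)
    have rep: "\<phi> = Fract (map_poly of_int (num_poly d C)) (map_poly of_int (den_poly d C))"
      using that by (simp only: is_coeff_vec_def)
    obtain h where h: "h \<noteq> 0" "map_poly of_int (num_poly d C) = smult h P"
      "map_poly of_int (den_poly d C) = smult h Q"
      using Fract_formal_degree[OF rep nz deg' PQ] by auto
    have "of_int (C $ i) = h * f i" if i: "i \<le> 2 * d + 1" for i
    proof (cases "i \<le> d")
      case True
      then show ?thesis
        using arg_cong[OF h(2), of "\<lambda>p. coeff p i"]
        by (simp add: coeff_map_poly coeff_num_poly f_def)
    next
      case False
      define j where "j = i - (d + 1)"
      have j: "i = d + 1 + j" "j \<le> d"
        using False i by (auto simp: j_def)
      then show ?thesis
        using arg_cong[OF h(3), of "\<lambda>p. coeff p j"] fQ[of j]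
        by (simp add: coeff_map_poly coeff_den_poly)
    qed
    then show ?thesis
      using h(1) by blast
  qed
  show "C' = C" if C': "is_coeff_vec d \<phi> C'" and C: "is_coeff_vec d \<phi> C" for C' C
  proof -
    obtain h h' where h: "h \<noteq> 0" "\<forall>i\<le>2 * d + 1. of_int (C $ i) = h * f i"
      and h': "\<forall>i\<le>2 * d + 1. of_int (C' $ i) = h' * f i"
      using scale[OF C] scale[OF C'] by blast
    have "\<forall>i\<le>2 * d + 1. of_int (C' $ i) = (h' / h) * of_int (C $ i)"
      using h h' by simp
    then show ?thesis
      using proj_points_scale_unique C C' unfolding is_coeff_vec_def by blast
  qed
qed

end

theory Submission
  imports Defs
begin

text \<open>
  Conjugating \<open>\<phi>\<close> by a matrix of determinant \<open>\<Delta>\<close> multiplies the resultant of the coefficient forms by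
  \<open>\<plusminus> \<Delta>\<^bsup>d\<^sup>2 + d\<^esup>\<close>, and scaling the forms by \<open>h\<close> multiplies it by \<open>h\<^bsup>2d\<^esup>\<close>. Both are \<open>d\<close>-th powers, so the
  order at \<open>p\<close> is determined modulo \<open>d\<close> by the conjugacy class, and an order below \<open>d\<close> is minimal.

  For the density, fix all coefficients but the \<open>n\<close>-th one, \<open>t\<close>. The resultant is a polynomial of degree
  at most \<open>d\<close> in \<open>t\<close>. If a prime \<open>p\<close> does not divide its discriminant, then \<open>p\<^sup>d\<close> divides at most a
  proportion \<open>d / p\<^sup>d\<close> of its values; the primes up to a multiple of the bound for \<open>t\<close> are too sparse for the
  rounding errors to matter, and larger primes cannot occur at all. Primes dividing the discriminant spoil
  at most a proportion \<open>d / p\<close> of the values, unless they divide the whole polynomial. Averaged over the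
  other coefficients, the first of these events contributes a convergent sum, and the second is of
  codimension two since the leading coefficient in \<open>t\<close> is, up to sign, a monomial in the extreme
  coefficients of the other form. Hence the primes above \<open>z\<close> spoil a proportion \<open>O(1 / z)\<close> of all vectors,
  uniformly in the shape of the box, and the densities of the conditions at the primes up to \<open>z\<close> converge
  to the density sought. The same applies to primitivity. The limit is positive because the conditions at
  different primes are independent and \<open>z\<^sup>d\<close> has resultant \<open>\<plusminus> 1\<close>.
\<close>

section \<open>Primes and roots modulo prime powers\<close>

text \<open>The order of the two limits shapes the proof. Letting \<open>r n\<close> grow first,
  with all other coefficients fixed, leaves a one-variable problem for finitely many fixed
  polynomials. Each of them may have its own threshold for \<open>t\<close>; only the resulting
  proportions are averaged afterwards. The exponent \<open>d\<close> is balanced against the degree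
  \<open>d\<close> in \<open>t\<close>: p^d <= |Res| = O(T^d) leaves only primes p = O(T), the range
  in which density zero of the primes is just enough. The obstacle in the average is that the other
  radii may grow at unrelated rates, so a polynomial in all of them is not bounded by a power of a
  prescribed one. The two counts in the box ratio are never compared directly. A prime p dividing
  all coordinates makes p^(2d) divide the resultant, so vectors with power-free resultant are
  automatically primitive. Both counts are therefore sieves over the same full integer box, each
  with a positive density, and the density sought is the quotient. The sign normalization halves
  both counts.\<close>

lemma sum_inverse_squares_le:
  assumes "finite A" and "A \<subseteq> {z<..}" and "z \<ge> 1"
  shows "(\<Sum>m\<in>A. 1 / (real m)\<^sup>2) \<le> 1 / real z"
proof -
  \<comment> \<open>Telescoping: 1 / (m + 1)^2 is at most 1 / m - 1 / (m + 1).\<close>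
  have interval: "(\<Sum>m\<in>{z<..z + k}. 1 / (real m)\<^sup>2) \<le> 1 / real z - 1 / real (z + k)" for k
  proof (induction k)
    case (Suc k)
    have "1 / (real (z + Suc k))\<^sup>2 \<le> 1 / (real (z + k) * real (z + Suc k))"
      using assms(3) by (intro divide_left_mono) (auto simp: power2_eq_square intro!: mult_mono)
    also have "\<dots> = 1 / real (z + k) - 1 / real (z + Suc k)"
      using assms(3) by (simp add: field_simps)
    finally show ?case
      using Suc by (simp add: atLeastSucAtMost_greaterThanAtMost[symmetric] sum.nat_ivl_Suc')
  qed simp
  have "A \<subseteq> {z<..z + Max (insert 0 A)}"
  proof
    fix m assume "m \<in> A"
    moreover from this have "m \<le> Max (insert 0 A)"
      using assms(1) by (intro Max_ge) auto
    ultimately show "m \<in> {z<..z + Max (insert 0 A)}"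
      using assms(2) by auto
  qed
  then have "(\<Sum>m\<in>A. 1 / (real m)\<^sup>2) \<le> (\<Sum>m\<in>{z<..z + Max (insert 0 A)}. 1 / (real m)\<^sup>2)"
    by (intro sum_mono2) auto
  also have "\<dots> \<le> 1 / real z"
    using interval[of "Max (insert 0 A)"] by (smt (verit) divide_nonneg_nonneg of_nat_0_le_iff)
  finally show ?thesis .
qed

text \<open>Measured from the least element in units of \<open>m\<close>, the elements of
  \<open>S\<close> become distinct numbers up to \<open>2 * T div m\<close>. The summand 1 is the
  rounding error whose sum over primes has to be controlled later.\<close>

lemma card_congruent_le:
  fixes S :: "int set"
  assumes "S \<subseteq> {-int T..int T}" and "m > 0" and "\<And>s t. s \<in> S \<Longrightarrow> t \<in> S \<Longrightarrow> int m dvd s - t"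
  shows "real (card S) \<le> (2 * real T + 1) / real m + 1"
proof (cases "S = {}")
  case False
  have fin: "finite S"
    using assms(1) by (rule finite_subset) simp
  define a where "a = Min S"
  have a: "a \<in> S" "\<And>s. s \<in> S \<Longrightarrow> a \<le> s"
    using False fin by (auto simp: a_def)
  have "inj_on (\<lambda>s. nat ((s - a) div int m)) S"
  proof (rule inj_onI)
    fix s t assume st: "s \<in> S" "t \<in> S" and eq: "nat ((s - a) div int m) = nat ((t - a) div int m)"
    have "(s - a) div int m = (t - a) div int m"
      using eq st a assms(2) by (simp add: eq_nat_nat_iff pos_imp_zdiv_nonneg_iff)
    then have "(s - a) div int m * int m = (t - a) div int m * int m"
      by simp
    then show "s = t"
      using assms(3)[OF st(1) a(1)] assms(3)[OF st(2) a(1)] by simp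
  qed
  moreover have "(\<lambda>s. nat ((s - a) div int m)) ` S \<subseteq> {..2 * T div m}"
  proof clarsimp
    fix s assume "s \<in> S"
    then have "s \<in> {-int T..int T}" "a \<in> {-int T..int T}"
      using a(1) assms(1) by blast+
    then have "s - a \<le> int (2 * T)"
      by simp
    then have "(s - a) div int m \<le> int (2 * T) div int m"
      using assms(2) by (intro zdiv_mono1) auto
    then show "nat ((s - a) div int m) \<le> 2 * T div m"
      by (simp add: zdiv_int nat_le_iff)
  qed
  ultimately have "card S \<le> card {..2 * T div m}"
    by (intro card_inj_on_le) auto
  then have "real (card S) \<le> real (2 * T div m) + 1"
    by simp
  also have "real (2 * T div m) \<le> real (2 * T) / real m"
    by (rule of_nat_div_le_of_nat)
  also have "\<dots> \<le> (2 * real T + 1) / real m"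
    by (intro divide_right_mono) auto
  finally show ?thesis by simp
qed simp

text \<open>Lagrange's bound for roots modulo \<open>p\<close>, by splitting off roots with
  synthetic division. \<open>q\<close> stays over the integers; being nonzero modulo
  \<open>p\<close> is expressed through its coefficients.\<close>

lemma prime_root_residues:
  fixes q :: "int poly"
  assumes p: "prime p" and "\<not> (\<forall>k. int p dvd coeff q k)" and "degree q \<le> d"
  shows "finite {a\<in>{0..<int p}. int p dvd poly q a} \<and> card {a\<in>{0..<int p}. int p dvd poly q a} \<le> d"
  using assms(2,3)
proof (induction d arbitrary: q)
  case 0
  then obtain c where q: "q = [:c:]"
    by (metis degree_eq_zeroE le_zero_eq)
  have "coeff q k = 0" if "k \<noteq> 0" for k
    using that 0(2) by (intro coeff_eq_0) simp
  then have "\<not> int p dvd c"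
    using 0(1) q by (metis coeff_pCons_0 dvd_0_right)
  then show ?case
    using q by simp
next
  case (Suc d)
  show ?case
  proof (cases "\<exists>a\<in>{0..<int p}. int p dvd poly q a")
    case True
    then obtain a where a: "a \<in> {0..<int p}" "int p dvd poly q a"
      by blast
    \<comment> \<open>The remainder \<open>poly q a\<close> is divisible by \<open>p\<close>, so
      \<open>s\<close> is again nonzero modulo \<open>p\<close>, and by primality every other root
      of \<open>q\<close> is a root of \<open>s\<close>.\<close>
    define s where "s = synthetic_div q a"
    have q: "q = [:-a, 1:] * s + [:poly q a:]"
      using synthetic_div_correct'[of a q] by (simp add: s_def)
    have "degree s \<le> d"
      using Suc.prems(2) by (simp add: s_def degree_synthetic_div)
    moreover have "\<not> (\<forall>k. int p dvd coeff s k)"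
    proof
      assume all: "\<forall>k. int p dvd coeff s k"
      have "int p dvd coeff q k" for k
        by (subst q) (use all a(2) in \<open>auto simp: coeff_pCons split: nat.splits\<close>)
      then show False
        using Suc.prems(1) by blast
    qed
    ultimately have IH: "finite {a\<in>{0..<int p}. int p dvd poly s a}"
        "card {a\<in>{0..<int p}. int p dvd poly s a} \<le> d"
      using Suc.IH by blast+
    have sub: "{a\<in>{0..<int p}. int p dvd poly q a} \<subseteq> insert a {a\<in>{0..<int p}. int p dvd poly s a}"
    proof
      fix b assume "b \<in> {a\<in>{0..<int p}. int p dvd poly q a}"
      then have b: "b \<in> {0..<int p}" "int p dvd poly q b"
        by auto
      show "b \<in> insert a {a\<in>{0..<int p}. int p dvd poly s a}"
      proof (cases "b = a")
        case False
      have "poly q b = (b - a) * poly s b + poly q a"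
        by (subst (1) q) (simp add: algebra_simps)
      then have "int p dvd (b - a) * poly s b"
        using a(2) b(2) by (metis add.commute add_diff_cancel_left' dvd_diff)
      moreover have "\<not> int p dvd b - a"
        using a(1) b(1) False by (metis atLeastLessThan_iff mod_eq_dvd_iff mod_pos_pos_trivial)
      ultimately have "int p dvd poly s b"
        using p by (simp add: prime_dvd_mult_iff)
      then show ?thesis
        using b by simp
      qed simp
    qed
    have "card {a\<in>{0..<int p}. int p dvd poly q a} \<le> card (insert a {a\<in>{0..<int p}. int p dvd poly s a})"
      by (rule card_mono[OF _ sub]) (simp add: IH(1) del: atLeastLessThan_iff)
    also have "\<dots> \<le> Suc d"
      using IH card_insert_le_m1 by (metis (no_types, lifting) Suc_le_mono card_insert_if le_SucI)
    finally have "card {a\<in>{0..<int p}. int p dvd poly q a} \<le> Suc d" .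
    moreover have "finite {a\<in>{0..<int p}. int p dvd poly q a}"
      by (rule finite_subset[of _ "{0..<int p}"]) auto
    ultimately show ?thesis
      by blast
  next
    case False
    then have empty: "{a\<in>{0..<int p}. int p dvd poly q a} = {}"
      by blast
    show ?thesis
      unfolding empty by simp
  qed
qed

lemma diff_dvd_poly_diff: "a - b dvd poly q a - poly q (b :: int)"
proof (induction q)
  case (pCons c q)
  have "poly (pCons c q) a - poly (pCons c q) b = a * (poly q a - poly q b) + (a - b) * poly q b"
    by (simp add: algebra_simps)
  then show ?case
    using pCons.IH by simp
qed simp

text \<open>
  The last hypothesis says that \<open>S\<close> meets each residue class modulo \<open>p\<close> in at most one class
  modulo \<open>m\<close>.
\<close>

lemma card_poly_roots_interval_le:
  fixes q :: "int poly"
  assumes p: "prime p" and "\<not> (\<forall>k. int p dvd coeff q k)" and "degree q \<le> d" and m: "m > 0"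
    and S: "S \<subseteq> {-int T..int T}" "\<And>t. t \<in> S \<Longrightarrow> int p dvd poly q t"
    and lift: "\<And>s t. s \<in> S \<Longrightarrow> t \<in> S \<Longrightarrow> int p dvd s - t \<Longrightarrow> int m dvd s - t"
  shows "real (card S) \<le> real d * ((2 * real T + 1) / real m + 1)"
proof -
  let ?R = "{a\<in>{0..<int p}. int p dvd poly q a}"
  have p0: "p > 0"
    using p by (simp add: prime_gt_0_nat)
  have R: "finite ?R" "card ?R \<le> d"
    using prime_root_residues[OF assms(1-3)] by auto
  have fin: "finite S"
    using S(1) by (rule finite_subset) simp
  have img: "t mod int p \<in> ?R" if "t \<in> S" for t
  proof -
    have "int p dvd t - t mod int p"
      by (simp add: minus_mod_eq_mult_div)
    then have "int p dvd poly q t - poly q (t mod int p)"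
      using diff_dvd_poly_diff dvd_trans by blast
    from dvd_diff[OF S(2)[OF that] this] show ?thesis
      using p0 by simp
  qed
  have "S = (\<Union>a\<in>?R. {t\<in>S. t mod int p = a})"
    using img by auto
  then have "card S \<le> (\<Sum>a\<in>?R. card {t\<in>S. t mod int p = a})"
    using card_UN_le[OF R(1), of "\<lambda>a. {t\<in>S. t mod int p = a}"] by simp
  then have "real (card S) \<le> (\<Sum>a\<in>?R. real (card {t\<in>S. t mod int p = a}))"
    unfolding of_nat_sum[symmetric] by (rule of_nat_mono)
  also have "\<dots> \<le> (\<Sum>a\<in>?R. (2 * real T + 1) / real m + 1)"
  proof (intro sum_mono card_congruent_le)
    fix a s t assume "s \<in> {t\<in>S. t mod int p = a}" "t \<in> {t\<in>S. t mod int p = a}"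
    then show "int m dvd s - t"
      by (intro lift) (auto simp flip: mod_eq_dvd_iff)
  qed (use S(1) m in auto)
  also have "\<dots> = real (card ?R) * ((2 * real T + 1) / real m + 1)"
    by simp
  also have "\<dots> \<le> real d * ((2 * real T + 1) / real m + 1)"
    using R(2) by (intro mult_right_mono) auto
  finally show ?thesis .
qed

section \<open>Sparsity of the primes\<close>

lemma prod_primes_dvd:
  assumes "finite A" and "\<And>p. p \<in> A \<Longrightarrow> prime p" and "\<And>p. p \<in> A \<Longrightarrow> p dvd (n :: nat)"
  shows "\<Prod>A dvd n"
  using assms
proof (induction A rule: finite_induct)
  case (insert p A)
  then have "coprime p (\<Prod>A)"
    by (intro prod_coprime_right primes_coprime) auto
  then show ?case
    using insert by (simp add: divides_mult)
qed simp

text \<open>Primes between \<open>m + 1\<close> and \<open>2m + 1\<close> divide the binomial coefficient \<open>2m + 1\<close> over \<open>m\<close>.\<close>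

lemma primorial_le: "(\<Prod>p | prime p \<and> p \<le> n. p) \<le> (8::nat) ^ n"
proof (induction n rule: less_induct)
  case (less n)
  consider "n \<le> 2" | "even n" "n > 2" | m where "n = 2 * m + 1" "m \<ge> 1"
    using oddE by fastforce
  then show ?case
  proof cases
    case 1
    then have "{p. prime p \<and> p \<le> n} \<subseteq> {2}"
      by (auto dest!: prime_ge_2_nat)
    then have "{p. prime p \<and> p \<le> n} = {} \<or> {p. prime p \<and> p \<le> n} = {2} \<and> n = 2"
      using 1 by auto
    then show ?thesis
    proof
      assume empty: "{p. prime p \<and> p \<le> n} = {}"
      show ?thesis
        unfolding empty by simp
    next
      assume single: "{p. prime p \<and> p \<le> n} = {2} \<and> n = 2"
      show ?thesis
        unfolding conjunct1[OF single] using single by simp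
    qed
  next
    case 2
    have "\<not> prime n"
      using 2 primes_dvd_imp_eq[of 2 n] two_is_prime_nat by auto
    then have "p \<le> n \<longleftrightarrow> p \<le> n - 1" if "prime p" for p
      using that by (cases "p = n") auto
    then have "{p. prime p \<and> p \<le> n} = {p. prime p \<and> p \<le> n - 1}"
      by blast
    then have "(\<Prod>p | prime p \<and> p \<le> n. p) \<le> 8 ^ (n - 1)"
      using less.IH[of "n - 1"] 2 by simp
    also have "\<dots> \<le> 8 ^ n"
      by (intro power_increasing) auto
    finally show ?thesis .
  next
    case 3
    let ?A = "{p. prime p \<and> p \<le> m + 1}" and ?B = "{p. prime p \<and> m + 1 < p \<and> p \<le> n}"
    have "(\<Prod>p\<in>?B. p) dvd (n choose m)"
    proof (rule prod_primes_dvd)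
      fix p assume p: "p \<in> ?B"
      have "fact m * fact (n - m) * (n choose m) = (fact n :: nat)"
        using 3 by (intro binomial_fact_lemma) simp
      moreover have "p dvd fact n"
        using p by (simp add: prime_dvd_fact_iff)
      ultimately have "p dvd fact m * fact (n - m) * (n choose m)"
        by simp
      then have "p dvd fact m \<or> p dvd fact (n - m) \<or> p dvd (n choose m)"
        using p by (auto simp only: prime_dvd_mult_iff mem_Collect_eq)
      then show "p dvd n choose m"
        using p 3 prime_dvd_fact_iff[of p m] prime_dvd_fact_iff[of p "n - m"] by auto
    qed auto
    moreover have "n choose m > 0"
      using 3 by (simp add: zero_less_binomial_iff)
    ultimately have "(\<Prod>p\<in>?B. p) \<le> n choose m"
      by (rule dvd_imp_le)
    also have "\<dots> \<le> 2 ^ n"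
      by (rule binomial_le_pow2)
    finally have B: "(\<Prod>p\<in>?B. p) \<le> 2 ^ n" .
    have AB: "{p. prime p \<and> p \<le> n} = ?A \<union> ?B"
      using 3 by auto
    have "(\<Prod>p | prime p \<and> p \<le> n. p) = (\<Prod>p\<in>?A. p) * (\<Prod>p\<in>?B. p)"
      unfolding AB by (rule prod.union_disjoint) auto
    \<comment> \<open>The base 8 leaves room for the crude bound 2^n of the binomial coefficient:
      for n = 2 m + 1, the inequality 3 (m + 1) + n <= 3 n amounts to m >= 1.\<close>
    also have "\<dots> \<le> 8 ^ (m + 1) * 2 ^ n"
      using less.IH[of "m + 1"] 3 B by (intro mult_mono) auto
    also have "\<dots> = (2::nat) ^ (3 * (m + 1) + n)"
      by (simp add: power_add power_mult)
    also have "\<dots> \<le> 2 ^ (3 * n)"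
      using 3 by (intro power_increasing) auto
    finally show ?thesis
      by (simp add: power_mult)
  qed
qed

text \<open>Each prime in (2^j, N] contributes a factor above 2^j to a product of at most 8^N, so
  there are at most 3 N / j of them, and j is arbitrary.\<close>

lemma prime_density_zero:
  assumes "\<epsilon> > 0"
  shows "eventually (\<lambda>N. real (card {p. prime p \<and> p \<le> N}) \<le> \<epsilon> * real N) at_top"
proof -
  \<comment> \<open>This choice lets the large primes use up half of \<epsilon>; the other half
    absorbs the at most 2^j small ones once N is large.\<close>
  obtain j :: nat where j: "real j > 6 / \<epsilon>"
    using reals_Archimedean2 by blast
  then have j0: "j > 0"
    using assms by (cases j) auto
  have bound: "real (card {p. prime p \<and> p \<le> N}) \<le> 2 ^ j + 3 * real N / real j" for N
  proof -
    let ?B = "{p. prime p \<and> 2 ^ j < p \<and> p \<le> N}"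
    have "(2 ^ j) ^ card ?B = (\<Prod>p\<in>?B. 2 ^ j :: nat)"
      by simp
    also have "\<dots> \<le> (\<Prod>p\<in>?B. p)"
      by (intro prod_mono) auto
    also have "\<dots> \<le> (\<Prod>p | prime p \<and> p \<le> N. p)"
      by (intro dvd_imp_le prod_dvd_prod_subset prod_pos) (auto simp: prime_gt_0_nat)
    also have "\<dots> \<le> 8 ^ N"
      by (rule primorial_le)
    finally have "(2::nat) ^ (j * card ?B) \<le> 2 ^ (3 * N)"
      by (simp add: power_mult)
    then have "j * card ?B \<le> 3 * N"
      by simp
    then have "real j * real (card ?B) \<le> 3 * real N"
      by (metis of_nat_le_iff of_nat_mult of_nat_numeral)
    then have B: "real (card ?B) \<le> 3 * real N / real j"
      using j0 by (simp add: field_simps)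
    have "card {p. prime p \<and> p \<le> N} \<le> card ({1..2 ^ j} \<union> ?B)"
      by (intro card_mono) (auto simp: Suc_le_eq prime_gt_0_nat)
    also have "\<dots> \<le> 2 ^ j + card ?B"
      using card_Un_le[of "{1..2 ^ j :: nat}" ?B] by simp
    finally have "real (card {p. prime p \<and> p \<le> N}) \<le> real (2 ^ j + card ?B)"
      by (rule of_nat_mono)
    then show ?thesis
      using B by simp
  qed
  have small: "3 * real N / real j \<le> \<epsilon> / 2 * real N" for N
  proof -
    have "6 \<le> \<epsilon> * real j"
      using j assms by (simp add: field_simps)
    then have "6 * real N \<le> \<epsilon> * real j * real N"
      by (intro mult_right_mono) auto
    then show ?thesis
      using j0 by (simp add: field_simps)
  qed
  have "eventually (\<lambda>N. real N \<ge> 2 ^ j * 2 / \<epsilon>) at_top"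
    using filterlim_real_sequentially by (simp add: filterlim_at_top)
  then show ?thesis
  proof eventually_elim
    case (elim N)
    then have "2 ^ j \<le> \<epsilon> / 2 * real N"
      using assms by (simp add: field_simps)
    then show ?case
      using bound[of N] small[of N] by linarith
  qed
qed

section \<open>Averages of polynomial functions over boxes\<close>

text \<open>
  Polynomial functions over \<open>\<int>\<close> in the coordinates from \<open>V\<close>; they stand in for multivariate polynomials.
\<close>

inductive polyfun :: "nat set \<Rightarrow> ((nat \<Rightarrow> int) \<Rightarrow> int) \<Rightarrow> bool" for V where
  polyfun_const: "polyfun V (\<lambda>x. c)"
| polyfun_var: "i \<in> V \<Longrightarrow> polyfun V (\<lambda>x. x i)"
| polyfun_add: "polyfun V f \<Longrightarrow> polyfun V g \<Longrightarrow> polyfun V (\<lambda>x. f x + g x)"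
| polyfun_mult: "polyfun V f \<Longrightarrow> polyfun V g \<Longrightarrow> polyfun V (\<lambda>x. f x * g x)"

lemma polyfun_sum: "(\<And>a. a \<in> A \<Longrightarrow> polyfun V (f a)) \<Longrightarrow> polyfun V (\<lambda>x. \<Sum>a\<in>A. f a x)"
  by (induction A rule: infinite_finite_induct) (auto intro: polyfun.intros)

lemma polyfun_prod: "(\<And>a. a \<in> A \<Longrightarrow> polyfun V (f a)) \<Longrightarrow> polyfun V (\<lambda>x. \<Prod>a\<in>A. f a x)"
  by (induction A rule: infinite_finite_induct) (auto intro: polyfun.intros)

lemma polyfun_eq_on: "polyfun V g \<Longrightarrow> (\<And>i. i \<in> V \<Longrightarrow> x i = y i) \<Longrightarrow> g x = g y"
  by (induction rule: polyfun.induct) auto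

lemma polyfun_cong_mod:
  assumes "polyfun V g" and "\<And>i. i \<in> V \<Longrightarrow> m dvd x i - y i"
  shows "m dvd g x - g y"
  using assms
proof (induction rule: polyfun.induct)
  case (polyfun_add f g)
  then have "m dvd (f x - f y) + (g x - g y)"
    by (intro dvd_add) auto
  then show ?case
    by (simp add: algebra_simps)
next
  case (polyfun_mult f g)
  then have "m dvd (f x - f y) * g x + f y * (g x - g y)"
    by (intro dvd_add dvd_mult dvd_mult2) auto
  then show ?case
    by (simp add: algebra_simps)
qed auto

text \<open>One number \<open>B\<close> bounds all coordinates, so in a box the estimate is in terms
  of the largest radius. A single \<open>L\<close> serves as factor and as exponent.\<close>

lemma polyfun_growth:
  assumes "polyfun V g"
  shows "\<exists>L. \<forall>x B. B \<ge> 1 \<longrightarrow> (\<forall>i\<in>V. \<bar>x i\<bar> \<le> B) \<longrightarrow> \<bar>g x\<bar> \<le> int L * B ^ L"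
  using assms
proof (induction rule: polyfun.induct)
  case (polyfun_const c)
  show ?case
  proof (intro exI[of _ "nat \<bar>c\<bar>"] allI impI)
    fix x :: "nat \<Rightarrow> int" and B :: int assume "B \<ge> 1"
    then have "\<bar>c\<bar> * 1 \<le> \<bar>c\<bar> * B ^ nat \<bar>c\<bar>"
      by (intro mult_left_mono one_le_power) auto
    then show "\<bar>c\<bar> \<le> int (nat \<bar>c\<bar>) * B ^ nat \<bar>c\<bar>"
      by simp
  qed
next
  case (polyfun_var i)
  then show ?case
    by (intro exI[of _ 1]) auto
next
  case (polyfun_add f g)
  then obtain L M where L: "\<And>x B. B \<ge> 1 \<Longrightarrow> (\<forall>i\<in>V. \<bar>x i\<bar> \<le> B) \<Longrightarrow> \<bar>f x\<bar> \<le> int L * B ^ L"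
    and M: "\<And>x B. B \<ge> 1 \<Longrightarrow> (\<forall>i\<in>V. \<bar>x i\<bar> \<le> B) \<Longrightarrow> \<bar>g x\<bar> \<le> int M * B ^ M"
    by metis
  show ?case
  proof (intro exI[of _ "L + M"] allI impI)
    fix x :: "nat \<Rightarrow> int" and B :: int assume B: "B \<ge> 1" "\<forall>i\<in>V. \<bar>x i\<bar> \<le> B"
    have "\<bar>f x + g x\<bar> \<le> int L * B ^ L + int M * B ^ M"
      using L[OF B] M[OF B] by linarith
    also have "\<dots> \<le> int L * B ^ (L + M) + int M * B ^ (L + M)"
      using B by (intro add_mono mult_left_mono power_increasing) auto
    finally show "\<bar>f x + g x\<bar> \<le> int (L + M) * B ^ (L + M)"
      by (simp add: algebra_simps)
  qed
next
  case (polyfun_mult f g)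
  then obtain L M where L: "\<And>x B. B \<ge> 1 \<Longrightarrow> (\<forall>i\<in>V. \<bar>x i\<bar> \<le> B) \<Longrightarrow> \<bar>f x\<bar> \<le> int L * B ^ L"
    and M: "\<And>x B. B \<ge> 1 \<Longrightarrow> (\<forall>i\<in>V. \<bar>x i\<bar> \<le> B) \<Longrightarrow> \<bar>g x\<bar> \<le> int M * B ^ M"
    by metis
  \<comment> \<open>\<open>L * M + L + M\<close> dominates both the factor \<open>L * M\<close> and
    the exponent \<open>L + M\<close>.\<close>
  show ?case
  proof (intro exI[of _ "L * M + L + M"] allI impI)
    fix x :: "nat \<Rightarrow> int" and B :: int assume B: "B \<ge> 1" "\<forall>i\<in>V. \<bar>x i\<bar> \<le> B"
    have "\<bar>f x * g x\<bar> \<le> (int L * B ^ L) * (int M * B ^ M)"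
      unfolding abs_mult using L[OF B] M[OF B] B by (intro mult_mono) auto
    also have "\<dots> = int (L * M) * B ^ (L + M)"
      by (simp add: power_add)
    also have "\<dots> \<le> int (L * M + L + M) * B ^ (L * M + L + M)"
      using B by (intro mult_mono power_increasing) auto
    finally show "\<bar>f x * g x\<bar> \<le> int (L * M + L + M) * B ^ (L * M + L + M)" .
  qed
qed

text \<open>Allows a coordinate to be removed by induction: the coefficients do not see
  \<open>x j\<close>, and the degree bound \<open>e\<close> is uniform in the other
  coordinates.\<close>

lemma polyfun_expand:
  assumes "polyfun V g"
  shows "\<exists>q e. (\<forall>k. polyfun (V - {j}) (\<lambda>x. coeff (q x) k)) \<and> (\<forall>x. degree (q x) \<le> e) \<and>
    (\<forall>x. g x = poly (q x) (x j))"
  using assms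
proof (induction rule: polyfun.induct)
  case (polyfun_const c)
  show ?case
    by (intro exI[of _ "\<lambda>x. [:c:]"] exI[of _ 0]) (auto intro: polyfun.intros)
next
  case (polyfun_var i)
  show ?case
  proof (cases "i = j")
    case True
    then show ?thesis
      by (intro exI[of _ "\<lambda>x. [:0, 1:]"] exI[of _ 1]) (auto intro: polyfun.intros)
  next
    case False
    have "polyfun (V - {j}) (\<lambda>x. coeff [:x i:] k)" for k
      using False polyfun_var by (cases k) (auto intro: polyfun.intros)
    then show ?thesis
      by (intro exI[of _ "\<lambda>x. [:x i:]"] exI[of _ 0]) auto
  qed
next
  case (polyfun_add f g)
  then obtain q e q' e' where
    "\<forall>k. polyfun (V - {j}) (\<lambda>x. coeff (q x) k)" "\<forall>x. degree (q x) \<le> e" "\<forall>x. f x = poly (q x) (x j)"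
    "\<forall>k. polyfun (V - {j}) (\<lambda>x. coeff (q' x) k)" "\<forall>x. degree (q' x) \<le> e'" "\<forall>x. g x = poly (q' x) (x j)"
    by metis
  then show ?case
    by (intro exI[of _ "\<lambda>x. q x + q' x"] exI[of _ "max e e'"])
      (auto intro!: polyfun.intros degree_add_le intro: le_max_iff_disj[THEN iffD2])
next
  case (polyfun_mult f g)
  then obtain q e q' e' where
    "\<forall>k. polyfun (V - {j}) (\<lambda>x. coeff (q x) k)" "\<forall>x. degree (q x) \<le> e" "\<forall>x. f x = poly (q x) (x j)"
    "\<forall>k. polyfun (V - {j}) (\<lambda>x. coeff (q' x) k)" "\<forall>x. degree (q' x) \<le> e'" "\<forall>x. g x = poly (q' x) (x j)"
    by metis
  moreover from this have "degree (q x * q' x) \<le> e + e'" for x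
    by (intro order_trans[OF degree_mult_le] add_mono) auto
  ultimately show ?case
    by (intro exI[of _ "\<lambda>x. q x * q' x"] exI[of _ "e + e'"])
      (auto simp: coeff_mult intro!: polyfun.intros polyfun_sum)
qed

section \<open>Boxes and the average weight of large prime divisors\<close>

definition int_box :: "nat set \<Rightarrow> (nat \<Rightarrow> nat) \<Rightarrow> (nat \<Rightarrow> int) set" where
  "int_box V R = (\<Pi>\<^sub>E i\<in>V. {-int (R i)..int (R i)})"

lemma finite_int_box: "finite V \<Longrightarrow> finite (int_box V R)"
  by (simp add: int_box_def finite_PiE)

lemma card_int_box: "finite V \<Longrightarrow> card (int_box V R) = (\<Prod>i\<in>V. 2 * R i + 1)"
  by (auto simp: int_box_def card_PiE nat_add_distrib nat_mult_distrib intro!: prod.cong)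

lemma int_box_abs_le: "x \<in> int_box V R \<Longrightarrow> i \<in> V \<Longrightarrow> \<bar>x i\<bar> \<le> int (R i)"
  unfolding int_box_def by (drule (1) PiE_mem) auto

lemma sum_int_box_insert:
  assumes "finite V" and "j \<notin> V"
  shows "(\<Sum>x\<in>int_box (insert j V) R. h x) =
    (\<Sum>x\<in>int_box V R. \<Sum>y\<in>{-int (R j)..int (R j)}. h (x(j := y)))"
proof -
  have "(\<Sum>x\<in>int_box (insert j V) R. h x) =
      (\<Sum>(y, x)\<in>{-int (R j)..int (R j)} \<times> int_box V R. h (x(j := y)))"
    unfolding int_box_def PiE_insert_eq
    by (subst sum.reindex[OF inj_combinator[OF assms(2)]]) (simp add: case_prod_unfold o_def)
  also have "\<dots> = (\<Sum>y\<in>{-int (R j)..int (R j)}. \<Sum>x\<in>int_box V R. h (x(j := y)))"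
    by (rule sum.cartesian_product[symmetric])
  finally show ?thesis
    by (subst sum.swap)
qed

definition large_primes :: "nat \<Rightarrow> int \<Rightarrow> nat set" where
  "large_primes z m = {p. prime p \<and> z < p \<and> int p dvd m}"

text \<open>
  If a nonzero polynomial in one variable has discriminant \<open>m\<close>, then primes above \<open>z\<close> that divide
  \<open>m\<close> can only spoil a proportion of order \<open>\<Sum> 1 / p\<close> of its arguments, and never more than all of them.
\<close>

definition prime_weight :: "nat \<Rightarrow> int \<Rightarrow> real" where
  "prime_weight z m = (if m = 0 then 1 else min 1 (\<Sum>p\<in>large_primes z m. 1 / real p))"

lemma finite_large_primes: "m \<noteq> 0 \<Longrightarrow> finite (large_primes z m)"
proof (rule finite_subset)
  assume m: "m \<noteq> 0"
  show "large_primes z m \<subseteq> {..nat \<bar>m\<bar>}"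
  proof
    fix p assume "p \<in> large_primes z m"
    then have "int p \<le> \<bar>m\<bar>"
      using m dvd_imp_le_int[of m "int p"] by (simp add: large_primes_def)
    then show "p \<in> {..nat \<bar>m\<bar>}"
      by simp
  qed
qed simp

lemma prime_weight_le_1: "prime_weight z m \<le> 1"
  by (simp add: prime_weight_def)

lemma prime_weight_nonneg: "prime_weight z m \<ge> 0"
  by (auto simp: prime_weight_def intro: sum_nonneg)

text \<open>The product of the primes above \<open>B\<close> that divide \<open>m\<close> is at most
  |m|, so growth like a power of \<open>B\<close> leaves boundedly many of them.\<close>

lemma card_large_primes_le:
  assumes "m \<noteq> 0" and "\<bar>m\<bar> \<le> int L * int B ^ L" and "B \<ge> 2"
  shows "card (large_primes B m) \<le> 2 * L"
proof -
  have fin: "finite (large_primes B m)"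
    using assms(1) by (rule finite_large_primes)
  have "B ^ card (large_primes B m) = (\<Prod>p\<in>large_primes B m. B)"
    by simp
  also have "\<dots> \<le> (\<Prod>p\<in>large_primes B m. p)"
    by (intro prod_mono) (auto simp: large_primes_def)
  also have "\<dots> \<le> nat \<bar>m\<bar>"
    using assms(1) fin by (intro dvd_imp_le prod_primes_dvd) (auto simp: large_primes_def nat_abs_dvd_iff)
  also have "nat \<bar>m\<bar> \<le> L * B ^ L"
    using assms(2) by (simp add: nat_le_iff)
  \<comment> \<open>The factor \<open>L\<close> costs only another \<open>B ^ L\<close>, since L <
    2^L and B >= 2; hence the bound \<open>2 * L\<close>.\<close>
  also have "\<dots> \<le> 2 ^ L * B ^ L"
    by (intro mult_right_mono less_imp_le[OF less_exp]) auto
  also have "\<dots> \<le> B ^ L * B ^ L"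
    using assms(3) by (intro mult_right_mono power_mono) auto
  also have "\<dots> = B ^ (2 * L)"
    by (simp add: power_add[symmetric] mult_2)
  finally have "B ^ card (large_primes B m) \<le> B ^ (2 * L)" .
  then show ?thesis
    by (rule power_le_imp_le_exp[rotated]) (use assms(3) in simp)
qed


lemma sum_of_bool_card: "finite A \<Longrightarrow> (\<Sum>a\<in>A. of_bool (Q a)) = real (card {a\<in>A. Q a})"
  by (simp add: of_bool_def sum.If_cases Int_def)

lemma sum_Un_le:
  fixes f :: "'a \<Rightarrow> real"
  assumes "finite A" and "finite B" and "\<And>a. f a \<ge> 0"
  shows "sum f (A \<union> B) \<le> sum f A + sum f B"
  using sum.union_inter[OF assms(1,2), of f] sum_nonneg[of "A \<inter> B" f] assms(3) by simp

text \<open>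
  The average over one coordinate. Up to \<open>T\<close>, a prime divides \<open>poly q y\<close> for a proportion about
  \<open>1 / p\<close> of all \<open>y\<close>, unless it divides the coefficient; beyond \<open>T\<close>, boundedly many primes divide
  \<open>poly q y\<close> at all.
\<close>

lemma fiber_weight_le:
  fixes q :: "int poly"
  assumes e: "degree q \<le> e" and z: "z \<ge> 2" and T: "T \<ge> z"
    and L: "\<And>y. y \<in> {-int T..int T} \<Longrightarrow> \<bar>poly q y\<bar> \<le> int L * int T ^ L"
  shows "(\<Sum>y\<in>{-int T..int T}. prime_weight z (poly q y)) \<le>
    (2 * real T + 1) * (prime_weight z (coeff q k) + real (3 * e + 2 * L) / real z)"
proof (cases "coeff q k = 0")
  case True
  have "(\<Sum>y\<in>{-int T..int T}. prime_weight z (poly q y)) \<le> (\<Sum>y\<in>{-int T..int T}. 1)"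
    by (intro sum_mono prime_weight_le_1)
  also have "\<dots> = (2 * real T + 1) * 1"
    by simp
  also have "\<dots> \<le> (2 * real T + 1) * (prime_weight z (coeff q k) + real (3 * e + 2 * L) / real z)"
    using True by (intro mult_left_mono) (auto simp: prime_weight_def)
  finally show ?thesis .
next
  case False
  define I where "I = {-int T..int T}"
  \<comment> \<open>Modulo these primes \<open>q\<close> is nonzero, so its roots lie in at most
    \<open>e\<close> classes; as the primes do not exceed \<open>T\<close>, their rounding errors
    stay below the main terms.\<close>
  define P where "P = {p. prime p \<and> z < p \<and> p \<le> T \<and> \<not> int p dvd coeff q k}"
  have finP: "finite P"
    by (rule finite_subset[of _ "{..T}"]) (auto simp: P_def)
  have finI: "finite I" and cardI: "real (card I) = 2 * real T + 1"
    by (auto simp: I_def)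
  have q0: "q \<noteq> 0"
    using False by auto
  \<comment> \<open>Four sources: a zero of \<open>q\<close>, primes dividing the chosen
    coefficient, primes of \<open>P\<close>, and the at most \<open>2 * L\<close> primes above
    \<open>T\<close>, each of weight below 1 / z. Averaged, the first, third and fourth give the
    constants \<open>e\<close>, \<open>2 * e\<close> and \<open>2 * L\<close>.\<close>
  have pointwise: "prime_weight z (poly q y) \<le> of_bool (poly q y = 0) + prime_weight z (coeff q k) +
      (\<Sum>p\<in>P. of_bool (int p dvd poly q y) / real p) + 2 * real L / real z" if y: "y \<in> I" for y
  proof (cases "poly q y = 0")
    case True
    have "0 \<le> (\<Sum>p\<in>P. of_bool (int p dvd poly q y) / real p)" "0 \<le> 2 * real L / real z"
      by (simp_all add: sum_nonneg)
    moreover have "prime_weight z (poly q y) \<le> of_bool (poly q y = 0)"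
      using True prime_weight_le_1[of z "poly q y"] by simp
    ultimately show ?thesis
      using prime_weight_nonneg[of z "coeff q k"] by (metis add.right_neutral add_mono)
  next
    case nz: False
    define s :: "nat set \<Rightarrow> real" where "s A = (\<Sum>p\<in>A. 1 / real p)" for A
    let ?B = "{p\<in>P. int p dvd poly q y}" and ?C = "large_primes T (poly q y)"
    have fin: "finite (large_primes z (coeff q k))" "finite ?B" "finite ?C"
      using False nz finP by (auto intro: finite_large_primes)
    have "s (large_primes z (poly q y)) \<le> s (large_primes z (coeff q k) \<union> (?B \<union> ?C))"
      unfolding s_def using fin by (intro sum_mono2) (auto simp: large_primes_def P_def)
    also have "\<dots> \<le> s (large_primes z (coeff q k)) + s (?B \<union> ?C)"
      unfolding s_def using fin by (intro sum_Un_le) auto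
    also have "s (?B \<union> ?C) \<le> s ?B + s ?C"
      unfolding s_def using fin by (intro sum_Un_le) auto
    finally have split: "s (large_primes z (poly q y)) \<le> s (large_primes z (coeff q k)) + s ?B + s ?C"
      by simp
    have B: "s ?B = (\<Sum>p\<in>P. of_bool (int p dvd poly q y) / real p)"
      unfolding s_def using finP by (intro sum.mono_neutral_cong_left) auto
    have "s ?C \<le> (\<Sum>p\<in>?C. 1 / real z)"
      unfolding s_def using z T by (intro sum_mono divide_left_mono) (auto simp: large_primes_def)
    also have "\<dots> = real (card ?C) / real z"
      by simp
    also have "\<dots> \<le> real (2 * L) / real z"
      using nz L y z T unfolding I_def
      by (intro divide_right_mono of_nat_mono card_large_primes_le) auto
    finally have C: "s ?C \<le> 2 * real L / real z"
      by simp
    have "s ?B \<ge> 0" "s ?C \<ge> 0"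
      by (simp_all add: s_def sum_nonneg)
    then show ?thesis
      using split B C False nz by (simp add: prime_weight_def s_def min_def)
  qed
  have "card {y\<in>I. poly q y = 0} \<le> card {y. poly q y = 0}"
    using q0 by (intro card_mono poly_roots_finite) auto
  also have "\<dots> \<le> e"
    using card_poly_roots_bound[OF q0] e by simp
  finally have "(\<Sum>y\<in>I. of_bool (poly q y = 0)) \<le> real e"
    using finI by (simp add: of_bool_def sum.If_cases Int_def)
  also have "real e \<le> (2 * real T + 1) * (real e / real z)"
  proof -
    have "real e * real z \<le> real e * (2 * real T + 1)"
      using T by (intro mult_left_mono) auto
    then show ?thesis
      using z by (simp add: field_simps)
  qed
  finally have zeros: "(\<Sum>y\<in>I. of_bool (poly q y = 0)) \<le> (2 * real T + 1) * (real e / real z)" .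
  have count: "real (card {y\<in>I. int p dvd poly q y}) \<le> real e * (2 * (2 * real T + 1) / real p)"
    if p: "p \<in> P" for p
  proof -
    have "p > 0" "p \<le> T"
      using p by (auto simp: P_def prime_gt_0_nat)
    then have "1 \<le> (2 * real T + 1) / real p"
      by simp
    have "real (card {y\<in>I. int p dvd poly q y}) \<le> real e * ((2 * real T + 1) / real p + 1)"
      using p e \<open>p > 0\<close> by (intro card_poly_roots_interval_le[of p q]) (auto simp: P_def I_def)
    also have "\<dots> \<le> real e * ((2 * real T + 1) / real p + (2 * real T + 1) / real p)"
      using \<open>1 \<le> (2 * real T + 1) / real p\<close> by (intro mult_left_mono add_left_mono) auto
    also have "\<dots> = real e * (2 * (2 * real T + 1) / real p)"
      using \<open>p > 0\<close> by (simp add: field_simps)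
    finally show ?thesis .
  qed
  \<comment> \<open>After exchanging the sums, a prime is charged its weight 1 / p for a proportion
    of order 1 / p of the arguments, and the sum of 1 / p^2 over p > z is at most 1 / z.\<close>
  have "(\<Sum>y\<in>I. \<Sum>p\<in>P. of_bool (int p dvd poly q y) / real p) =
      (\<Sum>p\<in>P. \<Sum>y\<in>I. of_bool (int p dvd poly q y) / real p)"
    by (rule sum.swap)
  also have "\<dots> = (\<Sum>p\<in>P. real (card {y\<in>I. int p dvd poly q y}) / real p)"
    using finI by (intro sum.cong refl) (simp add: sum_divide_distrib[symmetric] of_bool_def sum.If_cases Int_def)
  also have "\<dots> \<le> (\<Sum>p\<in>P. real e * (2 * (2 * real T + 1) / real p) / real p)"
    by (intro sum_mono divide_right_mono count) auto
  also have "\<dots> = 2 * real e * (2 * real T + 1) * (\<Sum>p\<in>P. 1 / (real p)\<^sup>2)"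
    unfolding sum_distrib_left by (intro sum.cong) (auto simp: power2_eq_square)
  also have "\<dots> \<le> 2 * real e * (2 * real T + 1) * (1 / real z)"
    using finP z by (intro mult_left_mono sum_inverse_squares_le) (auto simp: P_def)
  finally have middle: "(\<Sum>y\<in>I. \<Sum>p\<in>P. of_bool (int p dvd poly q y) / real p) \<le>
      (2 * real T + 1) * (2 * real e / real z)"
    by (simp add: ac_simps)
  have "(\<Sum>y\<in>I. prime_weight z (poly q y)) \<le> (\<Sum>y\<in>I. of_bool (poly q y = 0) +
      prime_weight z (coeff q k) + (\<Sum>p\<in>P. of_bool (int p dvd poly q y) / real p) + 2 * real L / real z)"
    by (intro sum_mono pointwise)
  also have "\<dots> = (\<Sum>y\<in>I. of_bool (poly q y = 0)) + (2 * real T + 1) * prime_weight z (coeff q k) +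
      (\<Sum>y\<in>I. \<Sum>p\<in>P. of_bool (int p dvd poly q y) / real p) + (2 * real T + 1) * (2 * real L / real z)"
    by (simp add: sum.distrib cardI)
  also have "\<dots> \<le> (2 * real T + 1) * (real e / real z) + (2 * real T + 1) * prime_weight z (coeff q k) +
      (2 * real T + 1) * (2 * real e / real z) + (2 * real T + 1) * (2 * real L / real z)"
    using zeros middle by (intro add_mono) auto
  also have "\<dots> = (2 * real T + 1) * (prime_weight z (coeff q k) + real (3 * e + 2 * L) / real z)"
    by (simp add: field_simps add_divide_distrib)
  finally show ?thesis
    by (simp add: I_def)
qed

text \<open>
  The radii are unrelated, so the polynomial may be exponentially large in the smaller ones. The
  induction therefore removes the coordinate with the largest radius, in terms of which the
  polynomial grows only polynomially.
\<close>

lemma polyfun_average_weight: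
  assumes "finite V" and "polyfun V g" and "g x0 \<noteq> 0"
  shows "\<exists>K. \<forall>z R. z \<ge> 2 \<longrightarrow> (\<forall>i\<in>V. R i \<ge> z) \<longrightarrow>
    (\<Sum>x\<in>int_box V R. prime_weight z (g x)) \<le> real K / real z * (\<Prod>i\<in>V. 2 * real (R i) + 1)"
  using assms
proof (induction "card V" arbitrary: V g x0)
  case 0
  then have V: "V = {}"
    by simp
  define m where "m = g x0"
  have g: "g x = m" for x
    using polyfun_eq_on[OF 0(3), of x x0] V by (simp add: m_def)
  show ?case
  proof (intro exI[of _ "nat \<bar>m\<bar> + 1"] allI impI)
    fix z :: nat and R :: "nat \<Rightarrow> nat" assume z: "z \<ge> 2"
    have m0: "m \<noteq> 0"
      using 0(4) by (simp add: m_def)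
    have "prime_weight z m \<le> (\<Sum>p\<in>large_primes z m. 1 / real p)"
      using m0 by (simp add: prime_weight_def)
    also have "\<dots> \<le> (\<Sum>p\<in>large_primes z m. 1 / real z)"
      using z by (intro sum_mono divide_left_mono) (auto simp: large_primes_def)
    also have "\<dots> = real (card (large_primes z m)) / real z"
      by simp
    also have "\<dots> \<le> real (card {..nat \<bar>m\<bar>}) / real z"
    proof (intro divide_right_mono of_nat_mono card_mono subsetI)
      fix p assume "p \<in> large_primes z m"
      then have "int p \<le> \<bar>m\<bar>"
        using m0 dvd_imp_le_int[of m "int p"] by (simp add: large_primes_def)
      then show "p \<in> {..nat \<bar>m\<bar>}"
        by simp
    qed auto
    finally show "(\<Sum>x\<in>int_box V R. prime_weight z (g x)) \<le>
        real (nat \<bar>m\<bar> + 1) / real z * (\<Prod>i\<in>V. 2 * real (R i) + 1)"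
      unfolding g by (simp add: V int_box_def)
  qed
next
  case (Suc n)
  obtain L where L: "\<And>x B. B \<ge> 1 \<Longrightarrow> (\<forall>i\<in>V. \<bar>x i\<bar> \<le> B) \<Longrightarrow> \<bar>g x\<bar> \<le> int L * B ^ L"
    using polyfun_growth[OF Suc(4)] by metis
  \<comment> \<open>A constant for the boxes whose largest radius is at \<open>j\<close>; any
    coordinate may be the largest, so the final constant is the sum over all
    \<open>j\<close>.\<close>
  have "\<exists>M. \<forall>z R. z \<ge> 2 \<longrightarrow> (\<forall>i\<in>V. R i \<ge> z) \<longrightarrow> (\<forall>i\<in>V. R i \<le> R j) \<longrightarrow>
      (\<Sum>x\<in>int_box V R. prime_weight z (g x)) \<le> real M / real z * (\<Prod>i\<in>V. 2 * real (R i) + 1)"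
    if j: "j \<in> V" for j
  proof -
    obtain q e where coeffs: "\<And>k. polyfun (V - {j}) (\<lambda>x. coeff (q x) k)"
      and e: "\<And>x. degree (q x) \<le> e" and q: "\<And>x. g x = poly (q x) (x j)"
      using polyfun_expand[OF Suc(4), of j] by metis
    have "q x0 \<noteq> 0"
      using Suc(5) q[of x0] by auto
    \<comment> \<open>Any coefficient that is not identically zero will do; \<open>x0\<close>
      remains the witness for it in the induction.\<close>
    then obtain k where k: "coeff (q x0) k \<noteq> 0"
      by (metis poly_eqI coeff_0)
    have "n = card (V - {j})"
      using Suc(2,3) j by simp
    then obtain K where K: "\<And>z R. z \<ge> 2 \<Longrightarrow> (\<forall>i\<in>V - {j}. R i \<ge> z) \<Longrightarrow>
        (\<Sum>x\<in>int_box (V - {j}) R. prime_weight z (coeff (q x) k)) \<le>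
        real K / real z * (\<Prod>i\<in>V - {j}. 2 * real (R i) + 1)"
      using Suc(1)[OF _ _ coeffs[of k] k] Suc(3) by (metis finite_Diff)
    have upd: "q (x(j := y)) = q x" for x y
      by (intro poly_eqI polyfun_eq_on[OF coeffs]) auto
    have V: "V = insert j (V - {j})"
      using j by auto
    show ?thesis
    proof (intro exI[of _ "K + (3 * e + 2 * L)"] allI impI)
      fix z :: nat and R :: "nat \<Rightarrow> nat" assume z: "z \<ge> 2" and R: "\<forall>i\<in>V. R i \<ge> z" and max: "\<forall>i\<in>V. R i \<le> R j"
      have fiber: "(\<Sum>y\<in>{-int (R j)..int (R j)}. prime_weight z (g (x(j := y)))) \<le>
          (2 * real (R j) + 1) * (prime_weight z (coeff (q x) k) + real (3 * e + 2 * L) / real z)"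
        if x: "x \<in> int_box (V - {j}) R" for x
        unfolding q upd fun_upd_same
      proof (rule fiber_weight_le[OF e z])
        fix y assume y: "y \<in> {-int (R j)..int (R j)}"
        have "\<forall>i\<in>V. \<bar>(x(j := y)) i\<bar> \<le> int (R j)"
        proof
          fix i assume i: "i \<in> V"
          show "\<bar>(x(j := y)) i\<bar> \<le> int (R j)"
          proof (cases "i = j")
            case False
            then have "\<bar>x i\<bar> \<le> int (R i)"
              using int_box_abs_le[OF x] i by simp
            then show ?thesis
              using False max i by force
          qed (use y in auto)
        qed
        moreover have "int (R j) \<ge> 1"
          using z R j by force
        ultimately show "\<bar>poly (q x) y\<bar> \<le> int L * int (R j) ^ L"
          using L[of "int (R j)" "x(j := y)"] unfolding q upd by simp
      qed (use R j in auto)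
      have "(\<Sum>x\<in>int_box V R. prime_weight z (g x)) =
          (\<Sum>x\<in>int_box (V - {j}) R. \<Sum>y\<in>{-int (R j)..int (R j)}. prime_weight z (g (x(j := y))))"
        using sum_int_box_insert[of "V - {j}" j "\<lambda>x. prime_weight z (g x)" R] Suc(3) V by simp
      also have "\<dots> \<le> (\<Sum>x\<in>int_box (V - {j}) R.
          (2 * real (R j) + 1) * (prime_weight z (coeff (q x) k) + real (3 * e + 2 * L) / real z))"
        by (intro sum_mono fiber)
      also have "\<dots> = (2 * real (R j) + 1) * ((\<Sum>x\<in>int_box (V - {j}) R. prime_weight z (coeff (q x) k)) +
          real (card (int_box (V - {j}) R)) * (real (3 * e + 2 * L) / real z))"
        by (simp add: sum_distrib_left[symmetric] sum.distrib)
      also have "\<dots> \<le> (2 * real (R j) + 1) * (real K / real z * (\<Prod>i\<in>V - {j}. 2 * real (R i) + 1) +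
          (\<Prod>i\<in>V - {j}. 2 * real (R i) + 1) * (real (3 * e + 2 * L) / real z))"
        using K[OF z, of R] R Suc(3) by (intro mult_left_mono add_mono) (auto simp: card_int_box add.commute)
      also have "\<dots> = real (K + (3 * e + 2 * L)) / real z *
          ((2 * real (R j) + 1) * (\<Prod>i\<in>V - {j}. 2 * real (R i) + 1))"
        by (simp add: algebra_simps add_divide_distrib)
      also have "(2 * real (R j) + 1) * (\<Prod>i\<in>V - {j}. 2 * real (R i) + 1) = (\<Prod>i\<in>V. 2 * real (R i) + 1)"
        using Suc(3) j by (simp add: prod.remove)
      finally show "(\<Sum>x\<in>int_box V R. prime_weight z (g x)) \<le>
          real (K + (3 * e + 2 * L)) / real z * (\<Prod>i\<in>V. 2 * real (R i) + 1)" .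
    qed
  qed
  then obtain M where M: "\<And>j z R. j \<in> V \<Longrightarrow> z \<ge> 2 \<Longrightarrow> (\<forall>i\<in>V. R i \<ge> z) \<Longrightarrow> (\<forall>i\<in>V. R i \<le> R j) \<Longrightarrow>
      (\<Sum>x\<in>int_box V R. prime_weight z (g x)) \<le> real (M j) / real z * (\<Prod>i\<in>V. 2 * real (R i) + 1)"
    by metis
  show ?case
  proof (intro exI[of _ "\<Sum>j\<in>V. M j"] allI impI)
    fix z :: nat and R :: "nat \<Rightarrow> nat" assume z: "z \<ge> 2" and R: "\<forall>i\<in>V. R i \<ge> z"
    have "V \<noteq> {}"
      using Suc(2) by auto
    then have "Max (R ` V) \<in> R ` V"
      using Suc(3) by (intro Max_in) auto
    then obtain j where j: "j \<in> V" "R j = Max (R ` V)"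
      by auto
    then have "\<forall>i\<in>V. R i \<le> R j"
      using Suc(3) by simp
    then have "(\<Sum>x\<in>int_box V R. prime_weight z (g x)) \<le>
        real (M j) / real z * (\<Prod>i\<in>V. 2 * real (R i) + 1)"
      by (intro M j z R)
    also have "\<dots> \<le> real (\<Sum>j\<in>V. M j) / real z * (\<Prod>i\<in>V. 2 * real (R i) + 1)"
      using Suc(3) j by (intro mult_right_mono divide_right_mono of_nat_mono member_le_sum prod_nonneg) auto
    finally show "(\<Sum>x\<in>int_box V R. prime_weight z (g x)) \<le>
        real (\<Sum>j\<in>V. M j) / real z * (\<Prod>i\<in>V. 2 * real (R i) + 1)" .
  qed
qed

text \<open>For fixed other coordinates, the values of \<open>x j\<close> divisible by some large
  prime divisor of \<open>E x\<close> have proportion about the sum of 1 / p over these divisors.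
  Since \<open>E\<close> does not involve \<open>x j\<close>, this is a prime weight, which is small
  on average.\<close>

lemma polyfun_average_pair:
  assumes fin: "finite V" and j: "j \<in> V" and E: "polyfun (V - {j}) E" and nz: "E x0 \<noteq> 0"
  shows "\<exists>K. \<forall>z R. z \<ge> 2 \<longrightarrow> (\<forall>i\<in>V. R i \<ge> z) \<longrightarrow>
    (\<Sum>x\<in>int_box V R. of_bool (\<exists>p. prime p \<and> z < p \<and> int p dvd x j \<and> int p dvd E x))
      \<le> real K / real z * (\<Prod>i\<in>V. 2 * real (R i) + 1)"
proof -
  obtain K where K: "\<And>z R. z \<ge> 2 \<Longrightarrow> (\<forall>i\<in>V - {j}. R i \<ge> z) \<Longrightarrow>
      (\<Sum>x\<in>int_box (V - {j}) R. prime_weight z (E x)) \<le>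
      real K / real z * (\<Prod>i\<in>V - {j}. 2 * real (R i) + 1)"
    using polyfun_average_weight[OF finite_Diff[OF fin] E nz] by metis
  have V: "V = insert j (V - {j})"
    using j by auto
  show ?thesis
  proof (intro exI[of _ "2 * K + 1"] allI impI)
    fix z :: nat and R :: "nat \<Rightarrow> nat" assume z: "z \<ge> 2" and R: "\<forall>i\<in>V. R i \<ge> z"
    let ?I = "{-int (R j)..int (R j)}"
    let ?N = "2 * real (R j) + 1"
    let ?bad = "\<lambda>x. \<exists>p. prime p \<and> z < p \<and> int p dvd x j \<and> int p dvd E x"
    have fiber: "(\<Sum>y\<in>?I. of_bool (?bad (x(j := y)))) \<le> ?N * (1 / real z + 2 * prime_weight z (E x))" for x
    proof -
      have upd: "E (x(j := y)) = E x" for y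
        by (intro polyfun_eq_on[OF E]) auto
      have trivial: "(\<Sum>y\<in>?I. of_bool (?bad (x(j := y)))) \<le> ?N"
        using sum_mono[of ?I "\<lambda>y. of_bool (?bad (x(j := y)))" "\<lambda>y. 1 :: real"] by simp
      show ?thesis
      proof (cases "E x = 0")
        case True
        have "?N * 1 \<le> ?N * (1 / real z + 2 * prime_weight z (E x))"
          using True by (intro mult_left_mono) (auto simp: prime_weight_def)
        then have "?N \<le> ?N * (1 / real z + 2 * prime_weight z (E x))"
          by simp
        with trivial show ?thesis
          by (rule order_trans)
      next
        case False
        define P where "P = {p\<in>large_primes z (E x). p \<le> R j}"
        have finP: "finite P"
          by (rule finite_subset[of _ "{..R j}"]) (auto simp: P_def)
        have finL: "finite (large_primes z (E x))"
          using False by (rule finite_large_primes)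
        \<comment> \<open>Zero is divisible by every prime and is set apart; it is one value out of
          more than \<open>z\<close>. A nonzero value in the interval admits only primes up to
          \<open>R j\<close>, for which the rounding error at most doubles the main term.\<close>
        have sub: "{y\<in>?I. ?bad (x(j := y))} \<subseteq> {0} \<union> (\<Union>p\<in>P. {y\<in>?I. int p dvd y})"
        proof
          fix y assume "y \<in> {y\<in>?I. ?bad (x(j := y))}"
          then obtain p where y: "y \<in> ?I" and p: "prime p" "z < p" "int p dvd y" "int p dvd E x"
            unfolding upd by auto
          show "y \<in> {0} \<union> (\<Union>p\<in>P. {y\<in>?I. int p dvd y})"
          proof (cases "y = 0")
            case False
            then have "int p \<le> \<bar>y\<bar>"
              using p(3) dvd_imp_le_int[of y "int p"] by simp
            then have "p \<in> P"
              using y p by (auto simp: P_def large_primes_def)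
            then show ?thesis
              using y p by blast
          qed simp
        qed
        have "real (card {y\<in>?I. ?bad (x(j := y))}) \<le>
            real (card ({0} \<union> (\<Union>p\<in>P. {y\<in>?I. int p dvd y})))"
        proof (intro of_nat_mono card_mono sub)
          have "finite {y\<in>?I. int p dvd y}" for p
            by (rule finite_subset[of _ ?I]) auto
          then show "finite ({0} \<union> (\<Union>p\<in>P. {y\<in>?I. int p dvd y}))"
            using finP by blast
        qed
        also have "\<dots> \<le> real (1 + (\<Sum>p\<in>P. card {y\<in>?I. int p dvd y}))"
          using card_Un_le[of "{0::int}" "\<Union>p\<in>P. {y\<in>?I. int p dvd y}"]
            card_UN_le[OF finP, of "\<lambda>p. {y\<in>?I. int p dvd y}"] by (intro of_nat_mono) simp
        also have "\<dots> = 1 + (\<Sum>p\<in>P. real (card {y\<in>?I. int p dvd y}))"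
          by simp
        also have "\<dots> \<le> 1 + (\<Sum>p\<in>P. 2 * ?N * (1 / real p))"
        proof (intro add_left_mono sum_mono)
          fix p assume p: "p \<in> P"
          then have p0: "p > 0" "p \<le> R j"
            by (auto simp: P_def large_primes_def prime_gt_0_nat)
          then have "1 \<le> ?N / real p"
            by simp
          moreover have "real (card {y\<in>?I. int p dvd y}) \<le> ?N / real p + 1"
            using p0 by (intro card_congruent_le) auto
          moreover have "2 * ?N * (1 / real p) = ?N / real p + ?N / real p"
            using p0 by (simp add: field_simps)
          ultimately show "real (card {y\<in>?I. int p dvd y}) \<le> 2 * ?N * (1 / real p)"
            by linarith
        qed
        also have "\<dots> \<le> 1 + (\<Sum>p\<in>large_primes z (E x). 2 * ?N * (1 / real p))"
          using finL by (intro add_left_mono sum_mono2) (auto simp: P_def)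
        also have "\<dots> = 1 + 2 * ?N * (\<Sum>p\<in>large_primes z (E x). 1 / real p)"
          by (simp add: sum_distrib_left)
        finally have "real (card {y\<in>?I. ?bad (x(j := y))}) \<le>
            1 + 2 * ?N * (\<Sum>p\<in>large_primes z (E x). 1 / real p)" .
        then have "(\<Sum>y\<in>?I. of_bool (?bad (x(j := y)))) \<le>
            1 + 2 * ?N * (\<Sum>p\<in>large_primes z (E x). 1 / real p)"
          by (simp only: sum_of_bool_card finite_atLeastAtMost_int)
        moreover define c :: real where "c = (\<Sum>y\<in>?I. of_bool (?bad (x(j := y))))"
        moreover define w where "w = (\<Sum>p\<in>large_primes z (E x). 1 / real p)"
        ultimately have c: "c \<le> 1 + 2 * ?N * w" "c \<le> ?N"
          using trivial by simp_all
        have "z \<le> R j"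
          using R j by blast
        then have "1 \<le> ?N * (1 / real z)"
          using z by (simp add: field_simps)
        \<comment> \<open>The trivial bound for \<open>c\<close> lets the sum \<open>w\<close> be
          truncated at 1, as in the definition of the weight.\<close>
        then have "c \<le> ?N * (1 / real z) + 2 * ?N * min 1 w"
          using c by (cases "w \<le> 1") simp_all
        also have "\<dots> = ?N * (1 / real z + 2 * prime_weight z (E x))"
          using False by (simp add: prime_weight_def w_def[symmetric] algebra_simps)
        finally show ?thesis
          by (simp only: c_def)
      qed
    qed
    have "(\<Sum>x\<in>int_box V R. of_bool (?bad x)) =
        (\<Sum>x\<in>int_box (V - {j}) R. \<Sum>y\<in>?I. of_bool (?bad (x(j := y))) :: real)"
      by (rule sum_int_box_insert[of "V - {j}" j _ R, folded V]) (use fin in auto)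
    also have "\<dots> \<le> (\<Sum>x\<in>int_box (V - {j}) R. ?N * (1 / real z + 2 * prime_weight z (E x)))"
      by (intro sum_mono fiber)
    also have "\<dots> = ?N * (real (card (int_box (V - {j}) R)) * (1 / real z) +
        2 * (\<Sum>x\<in>int_box (V - {j}) R. prime_weight z (E x)))"
      by (simp add: sum_distrib_left[symmetric] sum.distrib)
    also have "\<dots> \<le> ?N * ((\<Prod>i\<in>V - {j}. 2 * real (R i) + 1) * (1 / real z) +
        2 * (real K / real z * (\<Prod>i\<in>V - {j}. 2 * real (R i) + 1)))"
      using K[OF z, of R] R fin by (intro mult_left_mono add_mono) (auto simp: card_int_box add.commute)
    also have "\<dots> = real (2 * K + 1) / real z * (?N * (\<Prod>i\<in>V - {j}. 2 * real (R i) + 1))"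
      by (simp add: algebra_simps add_divide_distrib)
    also have "?N * (\<Prod>i\<in>V - {j}. 2 * real (R i) + 1) = (\<Prod>i\<in>V. 2 * real (R i) + 1)"
      using fin j by (simp add: prod.remove)
    finally show "(\<Sum>x\<in>int_box V R. of_bool (?bad x)) \<le>
        real (2 * K + 1) / real z * (\<Prod>i\<in>V. 2 * real (R i) + 1)" .
  qed
qed

section \<open>The sieve in one variable and its average\<close>

text \<open>First-order Taylor expansion with an integral remainder, so that no factorials have to
  be inverted.\<close>

lemma poly_diff_taylor:
  "\<exists>r. poly q s - poly q t = (s - t) * (poly (pderiv q) t + (s - t) * r)" for s t :: int
proof (induction q)
  case (pCons c q)
  then obtain r where r: "poly q s - poly q t = (s - t) * (poly (pderiv q) t + (s - t) * r)"
    by blast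
  have "poly (pCons c q) s - poly (pCons c q) t = s * (poly q s - poly q t) + (s - t) * poly q t"
    by (simp add: algebra_simps)
  also have "\<dots> = (s - t) * (poly (pderiv (pCons c q)) t + (s - t) * (poly (pderiv q) t + s * r))"
    unfolding r by (simp add: pderiv_pCons algebra_simps)
  finally show ?case
    by blast
qed simp

text \<open>The uniqueness part of Hensel's lemma: the second factor in Taylor's formula is
  congruent to the derivative at \<open>t\<close> modulo \<open>p\<close>, hence prime to
  \<open>p ^ d\<close>.\<close>

lemma simple_root_lift_unique:
  fixes s t :: int
  assumes p: "prime p" and "int p dvd s - t" and "int p ^ d dvd poly q s" and "int p ^ d dvd poly q t"
    and simple: "\<not> int p dvd poly (pderiv q) t"
  shows "int p ^ d dvd s - t"
proof -
  obtain r where r: "poly q s - poly q t = (s - t) * (poly (pderiv q) t + (s - t) * r)"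
    using poly_diff_taylor by blast
  have "\<not> int p dvd poly (pderiv q) t + (s - t) * r"
    using simple assms(2) by (simp add: dvd_add_left_iff)
  then have "coprime (int p ^ d) (poly (pderiv q) t + (s - t) * r)"
    using p by (auto intro: prime_imp_coprime)
  moreover have "int p ^ d dvd (s - t) * (poly (pderiv q) t + (s - t) * r)"
    unfolding r[symmetric] using assms(3,4) by (rule dvd_diff)
  ultimately show ?thesis
    by (simp add: coprime_dvd_mult_left_iff)
qed

text \<open>The bound is written as a \<open>d\<close>-th power so that \<open>p ^ d\<close>
  dividing a nonzero value yields the linear bound \<open>p \<le> K * T\<close>.\<close>

lemma poly_growth:
  fixes q :: "int poly"
  assumes "degree q \<le> d" and "d \<ge> 1"
  shows "\<exists>K\<ge>1. \<forall>T t. T \<ge> 1 \<longrightarrow> t \<in> {-int T..int T} \<longrightarrow> \<bar>poly q t\<bar> \<le> int ((K * T) ^ d)"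
proof -
  define K where "K = (\<Sum>i\<le>d. nat \<bar>coeff q i\<bar>) + 1"
  have "\<bar>poly q t\<bar> \<le> int ((K * T) ^ d)" if T: "T \<ge> 1" and t: "t \<in> {-int T..int T}" for T t
  proof -
    have "poly q t = (\<Sum>i\<le>d. coeff q i * t ^ i)"
      unfolding poly_altdef using assms(1) by (intro sum.mono_neutral_left) (auto simp: coeff_eq_0)
    also have "\<bar>\<dots>\<bar> \<le> (\<Sum>i\<le>d. \<bar>coeff q i * t ^ i\<bar>)"
      by (rule sum_abs)
    also have "\<dots> \<le> (\<Sum>i\<le>d. \<bar>coeff q i\<bar> * int T ^ d)"
    proof (rule sum_mono)
      fix i assume i: "i \<in> {..d}"
      have "\<bar>t\<bar> ^ i \<le> int T ^ i"
        using t by (intro power_mono) auto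
      also have "\<dots> \<le> int T ^ d"
        using i T by (intro power_increasing) auto
      finally show "\<bar>coeff q i * t ^ i\<bar> \<le> \<bar>coeff q i\<bar> * int T ^ d"
        by (simp add: abs_mult power_abs mult_left_mono)
    qed
    also have "\<dots> = (\<Sum>i\<le>d. \<bar>coeff q i\<bar>) * int T ^ d"
      by (simp add: sum_distrib_right)
    also have "\<dots> \<le> int K * int T ^ d"
      by (intro mult_right_mono) (auto simp: K_def)
    also have "\<dots> \<le> int (K ^ d) * int T ^ d"
      using assms(2) by (intro mult_right_mono of_nat_mono self_le_power) (auto simp: K_def)
    finally show ?thesis
      by (simp add: power_mult_distrib)
  qed
  moreover have "K \<ge> 1"
    by (simp add: K_def)
  ultimately show ?thesis
    by blast
qed

text \<open>
  Primes up to a multiple of \<open>T\<close> are counted by their residue classes, and the resulting rounding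
  errors are negligible because the primes have density zero. Larger primes are excluded, since
  \<open>poly q t\<close> is only of order \<open>T ^ d\<close>.
\<close>

lemma one_variable_sieve:
  fixes q :: "int poly" and D :: int
  assumes d: "d \<ge> 2" "degree q \<le> d" and D0: "D \<noteq> 0"
    and D: "\<And>t p. prime p \<Longrightarrow> int p dvd poly q t \<Longrightarrow> int p dvd poly (pderiv q) t \<Longrightarrow> int p dvd D"
    and z: "z \<ge> 2"
  shows "eventually (\<lambda>T. real (card {t\<in>{-int T..int T}. \<exists>p. prime p \<and> z < p \<and> int p ^ d dvd poly q t}) \<le>
    (2 * real T + 1) * (real (d + 1) / real z + real d * prime_weight z D +
      of_bool (\<exists>p. prime p \<and> z < p \<and> (\<forall>k. int p dvd coeff q k)))) at_top"
proof -
  define S where "S T = {t\<in>{-int T..int T}. \<exists>p. prime p \<and> z < p \<and> int p ^ d dvd poly q t}" for T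
  have finI: "finite {t\<in>{-int T..int T}. Q t}" for T Q
    by (rule finite_subset[of _ "{-int T..int T}"]) auto
  have trivial: "real (card (S T)) \<le> (2 * real T + 1) * 1" for T
  proof -
    have "card (S T) \<le> card {-int T..int T}"
      by (intro card_mono) (auto simp: S_def)
    also have "\<dots> = 2 * T + 1"
      by (simp add: nat_add_distrib nat_mult_distrib)
    finally have "real (card (S T)) \<le> real (2 * T + 1)"
      by (rule of_nat_mono)
    then show ?thesis
      by simp
  qed
  show ?thesis
  proof (cases "\<exists>p. prime p \<and> z < p \<and> (\<forall>k. int p dvd coeff q k)")
    case True
    have "real (card (S T)) \<le> (2 * real T + 1) * (real (d + 1) / real z + real d * prime_weight z D + 1)" for T
      using prime_weight_nonneg[of z D] by (intro order_trans[OF trivial] mult_left_mono) auto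
    then show ?thesis
      using True by (simp add: S_def)
  next
    case False
    then have notdvd: "\<not> (\<forall>k. int p dvd coeff q k)" if "prime p" "z < p" for p
      using that by blast
    \<comment> \<open>Otherwise every prime would divide \<open>D\<close>.\<close>
    have q0: "q \<noteq> 0"
    proof
      assume q: "q = 0"
      obtain p where p: "prime p" "p > nat \<bar>D\<bar>"
        using bigger_prime by blast
      then have "int p dvd D"
        using D[OF p(1), of 0] q by simp
      then show False
        using dvd_imp_le_int[OF D0, of "int p"] p(2) by simp
    qed
    \<comment> \<open>Modulo these primes roots may be multiple, so divisibility by
      \<open>p ^ d\<close> is weakened to divisibility by \<open>p\<close>.\<close>
    define LP where "LP = large_primes z D"
    have finLP: "finite LP"
      using D0 by (simp add: LP_def finite_large_primes)
    define s where "s = (\<Sum>p\<in>LP. 1 / real p)"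
    obtain K where K: "K \<ge> 1"
        "\<And>T t. T \<ge> 1 \<Longrightarrow> t \<in> {-int T..int T} \<Longrightarrow> \<bar>poly q t\<bar> \<le> int ((K * T) ^ d)"
      using poly_growth[of q d] d by fastforce
    define Q where "Q T = {p. prime p \<and> p \<le> K * T \<and> z < p \<and> \<not> int p dvd D}" for T
    have finQ: "finite (Q T)" for T
      by (rule finite_subset[of _ "{..K * T}"]) (auto simp: Q_def)
    \<comment> \<open>The zeros of \<open>q\<close>; main term and rounding error for the primes
      dividing \<open>D\<close>; main term and rounding error for the other primes up to
      \<open>K * T\<close>.\<close>
    have count: "real (card (S T)) \<le> real d + real d * (2 * real T + 1) * s + real d * real (card LP) +
        real d * (2 * real T + 1) / real z + real d * real (card {p. prime p \<and> p \<le> K * T})"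
      if T: "T \<ge> 1" for T
    proof -
      let ?I = "{-int T..int T}"
      let ?N = "2 * real T + 1"
      let ?Z = "{t\<in>?I. poly q t = 0}"
      let ?L = "\<Union>p\<in>LP. {t\<in>?I. int p dvd poly q t}"
      let ?Q = "\<Union>p\<in>Q T. {t\<in>?I. int p ^ d dvd poly q t}"
      have "S T \<subseteq> ?Z \<union> (?L \<union> ?Q)"
      proof
        fix t assume "t \<in> S T"
        then obtain p where t: "t \<in> ?I" and p: "prime p" "z < p" "int p ^ d dvd poly q t"
          by (auto simp: S_def)
        show "t \<in> ?Z \<union> (?L \<union> ?Q)"
        proof (cases "poly q t = 0 \<or> int p dvd D")
          case True
          have "int p dvd poly q t"
            using p(3) d(1) by (metis dvd_power dvd_trans gr0I not_numeral_le_zero)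
          then show ?thesis
            using True t p by (auto simp: LP_def large_primes_def)
        next
          case False
          then have "int (p ^ d) \<le> \<bar>poly q t\<bar>"
            using p(3) dvd_imp_le_int[of "poly q t" "int p ^ d"] by simp
          also have "\<dots> \<le> int ((K * T) ^ d)"
            by (rule K(2)[OF T t])
          finally have "p ^ d \<le> (K * T) ^ d"
            by (simp only: of_nat_le_iff)
          then have "p \<le> K * T"
            using d(1) by (simp add: power_mono_iff)
          then show ?thesis
            using False t p by (auto simp: Q_def)
        qed
      qed
      then have "card (S T) \<le> card (?Z \<union> (?L \<union> ?Q))"
        by (intro card_mono finite_UnI finite_UN_I finI finLP finQ)
      also have "\<dots> \<le> card ?Z + (card ?L + card ?Q)"
        using card_Un_le[of ?Z "?L \<union> ?Q"] card_Un_le[of ?L ?Q] by linarith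
      finally have union: "real (card (S T)) \<le> real (card ?Z) + real (card ?L) + real (card ?Q)"
        by linarith
      have "card ?Z \<le> card {t. poly q t = 0}"
        using q0 by (intro card_mono poly_roots_finite) auto
      also have "\<dots> \<le> d"
        using card_poly_roots_bound[OF q0] d(2) by simp
      finally have Z: "real (card ?Z) \<le> real d"
        by simp
      have "real (card ?L) \<le> real (\<Sum>p\<in>LP. card {t\<in>?I. int p dvd poly q t})"
        by (intro of_nat_mono card_UN_le finLP)
      also have "\<dots> = (\<Sum>p\<in>LP. real (card {t\<in>?I. int p dvd poly q t}))"
        by simp
      also have "\<dots> \<le> (\<Sum>p\<in>LP. real d * (?N / real p + 1))"
      proof (rule sum_mono)
        fix p assume p: "p \<in> LP"
        then have "prime p" "z < p"
          by (auto simp: LP_def large_primes_def)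
        then show "real (card {t\<in>?I. int p dvd poly q t}) \<le> real d * (?N / real p + 1)"
          using d notdvd by (intro card_poly_roots_interval_le[of p q]) (auto simp: prime_gt_0_nat)
      qed
      also have "\<dots> = real d * ?N * s + real d * real (card LP)"
        by (simp add: s_def sum.distrib sum_distrib_left distrib_left)
      finally have L: "real (card ?L) \<le> real d * ?N * s + real d * real (card LP)" .
      have "real (card ?Q) \<le> real (\<Sum>p\<in>Q T. card {t\<in>?I. int p ^ d dvd poly q t})"
        by (intro of_nat_mono card_UN_le finQ)
      also have "\<dots> = (\<Sum>p\<in>Q T. real (card {t\<in>?I. int p ^ d dvd poly q t}))"
        by simp
      also have "\<dots> \<le> (\<Sum>p\<in>Q T. real d * (?N * (1 / (real p)\<^sup>2) + 1))"
      proof (rule sum_mono)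
        fix p assume p: "p \<in> Q T"
        then have p': "prime p" "z < p" "\<not> int p dvd D"
          by (auto simp: Q_def)
        have dvd: "int p dvd poly q t" if "int p ^ d dvd poly q t" for t
          using that d(1) by (metis dvd_power dvd_trans gr0I not_numeral_le_zero)
        have "real (card {t\<in>?I. int p ^ d dvd poly q t}) \<le> real d * (?N / real (p ^ d) + 1)"
        proof (rule card_poly_roots_interval_le[OF p'(1) notdvd[OF p'(1,2)] d(2)])
          fix s t assume st: "s \<in> {t\<in>?I. int p ^ d dvd poly q t}" "t \<in> {t\<in>?I. int p ^ d dvd poly q t}"
            "int p dvd s - t"
          have "\<not> int p dvd poly (pderiv q) t"
            using D[OF p'(1)] p'(3) dvd st(2) by blast
          then have "int p ^ d dvd s - t"
            using st by (intro simple_root_lift_unique[OF p'(1), of s t d q]) auto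
          then show "int (p ^ d) dvd s - t"
            by simp
        qed (use dvd p' in \<open>auto simp: prime_gt_0_nat\<close>)
        also have "?N / real (p ^ d) \<le> ?N / real (p\<^sup>2)"
        proof (intro divide_left_mono of_nat_mono power_increasing)
          show "0 < real (p ^ d) * real (p\<^sup>2)"
            using p' by (simp add: prime_gt_0_nat)
        qed (use d p' in auto)
        finally show "real (card {t\<in>?I. int p ^ d dvd poly q t}) \<le> real d * (?N * (1 / (real p)\<^sup>2) + 1)"
          by (simp add: mult_left_mono)
      qed
      also have "\<dots> = real d * ?N * (\<Sum>p\<in>Q T. 1 / (real p)\<^sup>2) + real d * real (card (Q T))"
        by (simp add: sum.distrib sum_distrib_left distrib_left)
      also have "\<dots> \<le> real d * ?N * (1 / real z) + real d * real (card {p. prime p \<and> p \<le> K * T})"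
        using z finQ
        by (intro add_mono mult_left_mono sum_inverse_squares_le of_nat_mono card_mono) (auto simp: Q_def)
      finally have Q: "real (card ?Q) \<le> real d * ?N / real z + real d * real (card {p. prime p \<and> p \<le> K * T})"
        by simp
      show ?thesis
        using union Z L Q by linarith
    qed
    have d0: "real d > 0" and z0: "real z > 0" and K0: "real K > 0"
      using d z K by auto
    \<comment> \<open>The density is chosen so that the rounding errors of the primes up to
      \<open>K * T\<close> amount to at most T / z.\<close>
    have "eventually (\<lambda>N. real (card {p. prime p \<and> p \<le> N}) \<le> 1 / (real z * real d * real K) * real N) at_top"
      using d0 z0 K0 by (intro prime_density_zero) simp
    then obtain N0 where N0: "\<And>N. N \<ge> N0 \<Longrightarrow>
        real (card {p. prime p \<and> p \<le> N}) \<le> 1 / (real z * real d * real K) * real N"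
      by (auto simp: eventually_at_top_linorder)
    \<comment> \<open>Beyond this threshold the zeros of \<open>q\<close> and the rounding errors of
      the finitely many primes in \<open>LP\<close> also stay below T / z.\<close>
    have "real (card (S T)) \<le> (2 * real T + 1) * (real (d + 1) / real z + real d * prime_weight z D)"
      if T: "T \<ge> N0 + z * (d + d * card LP) + 1" for T
    proof -
      have "N0 \<le> 1 * T"
        using T by simp
      also have "1 * T \<le> K * T"
        using K(1) by (rule mult_right_mono) simp
      finally have "real d * real (card {p. prime p \<and> p \<le> K * T}) \<le>
          real d * (1 / (real z * real d * real K) * real (K * T))"
        by (intro mult_left_mono N0) auto
      also have "\<dots> = real T / real z"
        using d0 z0 K0 by (simp add: field_simps)
      finally have 1: "real d * real (card {p. prime p \<and> p \<le> K * T}) \<le> real T / real z" .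
      have "real (z * (d + d * card LP)) \<le> real T"
        using T by (intro of_nat_mono) linarith
      then have 2: "real d + real d * real (card LP) \<le> real T / real z"
        using z0 by (simp add: field_simps)
      have "2 * (real T / real z) \<le> (2 * real T + 1) / real z"
        using z0 by (simp add: field_simps)
      moreover have "T \<ge> 1"
        using T by simp
      ultimately have main: "real (card (S T)) \<le> real d * (2 * real T + 1) * s +
          real d * (2 * real T + 1) / real z + (2 * real T + 1) / real z"
        using count[of T] 1 2 by linarith
      \<comment> \<open>If \<open>s\<close> exceeds 1, the weight is 1 and the trivial bound
        suffices.\<close>
      show ?thesis
      proof (cases "s \<le> 1")
        case True
        then have "prime_weight z D = s"
          using D0 by (simp add: prime_weight_def s_def LP_def)
        then show ?thesis
          using main by (simp add: algebra_simps add_divide_distrib)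
      next
        case False
        then have "prime_weight z D = 1"
          using D0 by (simp add: prime_weight_def s_def LP_def)
        then have "1 \<le> real (d + 1) / real z + real d * prime_weight z D"
          using d by (simp add: add_increasing)
        then show ?thesis
          by (intro order_trans[OF trivial] mult_left_mono) auto
      qed
    qed
    moreover have no_content: "of_bool (\<exists>p. prime p \<and> z < p \<and> (\<forall>k. int p dvd coeff q k)) = (0 :: real)"
      using False by (simp only: of_bool_eq(1))
    ultimately show ?thesis
      unfolding S_def[symmetric] eventually_at_top_linorder no_content
      by (intro exI[of _ "N0 + z * (d + d * card LP) + 1"]) simp
  qed
qed

text \<open>Here the inner limit is exploited: for fixed radii the box over \<open>V\<close> is
  finite, so the one-variable sieve applies to all fibers at once, each with its own threshold. What
  remains is the average of the fiberwise proportions. \<open>J\<close> and \<open>E\<close> capture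
  the fibers on which a prime divides the whole polynomial by conditions of codimension two.\<close>

lemma sieve_tail:
  fixes q :: "(nat \<Rightarrow> int) \<Rightarrow> int poly" and D :: "(nat \<Rightarrow> int) \<Rightarrow> int"
  assumes V: "finite V" "n \<notin> V" and d: "d \<ge> 2" "\<And>x. degree (q x) \<le> d"
    and coeffs: "\<And>k. polyfun V (\<lambda>x. coeff (q x) k)"
    and D: "polyfun V D" "D x0 \<noteq> 0"
      "\<And>x t p. prime p \<Longrightarrow> int p dvd poly (q x) t \<Longrightarrow> int p dvd poly (pderiv (q x)) t \<Longrightarrow> int p dvd D x"
    and J: "J \<subseteq> V" and E: "\<And>j. j \<in> J \<Longrightarrow> polyfun (V - {j}) (E j)" "\<And>j. j \<in> J \<Longrightarrow> \<exists>x. E j x \<noteq> 0"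
    and content: "\<And>x p. prime p \<Longrightarrow> (\<forall>k. int p dvd coeff (q x) k) \<Longrightarrow>
      \<exists>j\<in>J. int p dvd x j \<and> int p dvd E j x"
  shows "\<exists>K. \<forall>z R. z \<ge> 2 \<longrightarrow> (\<forall>i\<in>V. R i \<ge> z) \<longrightarrow> eventually (\<lambda>T.
    real (card {x\<in>int_box (insert n V) (R(n := T)). \<exists>p. prime p \<and> z < p \<and> int p ^ d dvd poly (q x) (x n)})
      \<le> real K / real z * real (card (int_box (insert n V) (R(n := T))))) at_top"
proof -
  obtain KD where KD: "\<And>z R. z \<ge> 2 \<Longrightarrow> (\<forall>i\<in>V. R i \<ge> z) \<Longrightarrow>
      (\<Sum>x\<in>int_box V R. prime_weight z (D x)) \<le> real KD / real z * (\<Prod>i\<in>V. 2 * real (R i) + 1)"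
    using polyfun_average_weight[OF V(1) D(1,2)] by metis
  let ?bad = "\<lambda>z j x. \<exists>p. prime p \<and> z < p \<and> int p dvd x j \<and> int p dvd E j x"
  have "\<forall>j\<in>J. \<exists>K. \<forall>z R. z \<ge> 2 \<longrightarrow> (\<forall>i\<in>V. R i \<ge> z) \<longrightarrow>
      (\<Sum>x\<in>int_box V R. of_bool (?bad z j x)) \<le> real K / real z * (\<Prod>i\<in>V. 2 * real (R i) + 1)"
    using polyfun_average_pair[OF V(1)] E J by blast
  from bchoice[OF this] obtain M where M': "\<forall>j\<in>J. \<forall>z R. z \<ge> 2 \<longrightarrow> (\<forall>i\<in>V. R i \<ge> z) \<longrightarrow>
      (\<Sum>x\<in>int_box V R. of_bool (?bad z j x)) \<le> real (M j) / real z * (\<Prod>i\<in>V. 2 * real (R i) + 1)"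
    by (elim exE)
  have M: "(\<Sum>x\<in>int_box V R. of_bool (?bad z j x)) \<le> real (M j) / real z * (\<Prod>i\<in>V. 2 * real (R i) + 1)"
    if "j \<in> J" "z \<ge> 2" "\<forall>i\<in>V. R i \<ge> z" for j z R
    using M'[rule_format, OF that(1,2)] that(3) by blast
  have finJ: "finite J"
    using J V(1) by (rule finite_subset)
  show ?thesis
  proof (intro exI[of _ "d + 1 + d * KD + (\<Sum>j\<in>J. M j)"] allI impI)
    fix z :: nat and R :: "nat \<Rightarrow> nat" assume z: "z \<ge> 2" and R: "\<forall>i\<in>V. R i \<ge> z"
    let ?content = "\<lambda>x. \<exists>p. prime p \<and> z < p \<and> (\<forall>k. int p dvd coeff (q x) k)"
    define b :: "(nat \<Rightarrow> int) \<Rightarrow> real" where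
      "b x = real (d + 1) / real z + real d * prime_weight z (D x) + of_bool (?content x)" for x
    let ?S = "\<lambda>x T. {t\<in>{-int T..int T}. \<exists>p. prime p \<and> z < p \<and> int p ^ d dvd poly (q x) t}"
    define P where "P = (\<Prod>i\<in>V. 2 * real (R i) + 1)"
    \<comment> \<open>Fibers with \<open>D x = 0\<close> have weight 1, so the trivial bound covers
      them.\<close>
    have fiber: "eventually (\<lambda>T. real (card (?S x T)) \<le> (2 * real T + 1) * b x) at_top" for x
    proof (cases "D x = 0")
      case True
      then have "1 \<le> b x"
        using d by (simp add: b_def prime_weight_def add_increasing)
      have "real (card (?S x T)) \<le> (2 * real T + 1) * b x" for T
      proof -
        have "real (card (?S x T)) \<le> real (card {-int T..int T})"
          by (intro of_nat_mono card_mono) auto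
        also have "\<dots> = (2 * real T + 1) * 1"
          by simp
        also have "\<dots> \<le> (2 * real T + 1) * b x"
          using \<open>1 \<le> b x\<close> by (intro mult_left_mono) auto
        finally show ?thesis .
      qed
      then show ?thesis
        by simp
    next
      case False
      show ?thesis
        unfolding b_def by (rule one_variable_sieve[OF d(1) d(2) False D(3) z])
    qed
    have "(\<Sum>x\<in>int_box V R. of_bool (?content x) :: real) \<le> (\<Sum>x\<in>int_box V R. \<Sum>j\<in>J. of_bool (?bad z j x))"
    proof (rule sum_mono)
      fix x
      show "(of_bool (?content x) :: real) \<le> (\<Sum>j\<in>J. of_bool (?bad z j x))"
      proof (cases "?content x")
        case True
        then obtain p j where "prime p" "z < p" "j \<in> J" "int p dvd x j" "int p dvd E j x"
          using content by blast
        then have "1 \<le> (of_bool (?bad z j x) :: real)"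
          by auto
        also have "\<dots> \<le> (\<Sum>j\<in>J. of_bool (?bad z j x))"
          using finJ \<open>j \<in> J\<close> by (intro member_le_sum) auto
        finally show ?thesis
          using True by simp
      next
        case False
        have "0 \<le> (\<Sum>j\<in>J. (of_bool (?bad z j x) :: real))"
          by (intro sum_nonneg) simp
        moreover have "(of_bool (?content x) :: real) = 0"
          using False by (simp only: of_bool_eq(1))
        ultimately show ?thesis
          by (simp only:)
      qed
    qed
    also have "\<dots> = (\<Sum>j\<in>J. \<Sum>x\<in>int_box V R. of_bool (?bad z j x))"
      by (rule sum.swap)
    also have "\<dots> \<le> (\<Sum>j\<in>J. real (M j) / real z * P)"
      unfolding P_def by (intro sum_mono M z R)
    also have "\<dots> = real (\<Sum>j\<in>J. M j) / real z * P"
      by (simp add: sum_distrib_right sum_divide_distrib)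
    finally have C: "(\<Sum>x\<in>int_box V R. of_bool (?content x)) \<le> real (\<Sum>j\<in>J. M j) / real z * P" .
    have P0: "P \<ge> 0"
      unfolding P_def by (intro prod_nonneg) auto
    have cardP: "real (card (int_box V R)) = P"
      using V(1) by (simp add: card_int_box P_def add.commute)
    have "(\<Sum>x\<in>int_box V R. b x) = P * (real (d + 1) / real z) +
        real d * (\<Sum>x\<in>int_box V R. prime_weight z (D x)) + (\<Sum>x\<in>int_box V R. of_bool (?content x))"
      unfolding b_def sum.distrib sum_distrib_left by (simp add: cardP)
    also have "\<dots> \<le> P * (real (d + 1) / real z) + real d * (real KD / real z * P) +
        real (\<Sum>j\<in>J. M j) / real z * P"
      using KD[OF z R] C P0 unfolding P_def[symmetric] by (intro add_mono mult_left_mono) auto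
    also have "\<dots> = real (d + 1 + d * KD + (\<Sum>j\<in>J. M j)) / real z * P"
      by (simp add: algebra_simps add_divide_distrib)
    finally have sum_b: "(\<Sum>x\<in>int_box V R. b x) \<le> real (d + 1 + d * KD + (\<Sum>j\<in>J. M j)) / real z * P" .
    have "eventually (\<lambda>T. \<forall>x\<in>int_box V R. real (card (?S x T)) \<le> (2 * real T + 1) * b x) at_top"
      using finite_int_box[OF V(1)] fiber by (intro eventually_ball_finite) auto
    then show "eventually (\<lambda>T. real (card {x\<in>int_box (insert n V) (R(n := T)).
        \<exists>p. prime p \<and> z < p \<and> int p ^ d dvd poly (q x) (x n)}) \<le>
        real (d + 1 + d * KD + (\<Sum>j\<in>J. M j)) / real z * real (card (int_box (insert n V) (R(n := T))))) at_top"
    proof eventually_elim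
      case (elim T)
      let ?tail = "\<lambda>x. \<exists>p. prime p \<and> z < p \<and> int p ^ d dvd poly (q x) (x n)"
      have box: "int_box V (R(n := T)) = int_box V R"
        unfolding int_box_def using V(2) by (intro PiE_cong) auto
      have upd: "q (x(n := t)) = q x" for x t
        using V(2) by (intro poly_eqI polyfun_eq_on[OF coeffs]) auto
      have "real (card {x\<in>int_box (insert n V) (R(n := T)). ?tail x}) =
          (\<Sum>x\<in>int_box (insert n V) (R(n := T)). of_bool (?tail x))"
        using V(1) by (intro sum_of_bool_card[symmetric] finite_int_box) simp
      also have "\<dots> = (\<Sum>x\<in>int_box V R. \<Sum>t\<in>{-int T..int T}. of_bool (?tail (x(n := t))))"
        unfolding sum_int_box_insert[OF V] box by simp
      also have "\<dots> = (\<Sum>x\<in>int_box V R. real (card (?S x T)))"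
        unfolding upd fun_upd_same by (intro sum.cong refl sum_of_bool_card) simp
      also have "\<dots> \<le> (\<Sum>x\<in>int_box V R. (2 * real T + 1) * b x)"
        using elim by (intro sum_mono) blast
      also have "\<dots> = (2 * real T + 1) * (\<Sum>x\<in>int_box V R. b x)"
        by (rule sum_distrib_left[symmetric])
      also have "\<dots> \<le> (2 * real T + 1) * (real (d + 1 + d * KD + (\<Sum>j\<in>J. M j)) / real z * P)"
        using sum_b by (intro mult_left_mono) auto
      also have "(2 * real T + 1) * (real (d + 1 + d * KD + (\<Sum>j\<in>J. M j)) / real z * P) =
          real (d + 1 + d * KD + (\<Sum>j\<in>J. M j)) / real z * ((2 * real T + 1) * P)"
        by (simp only: ac_simps)
      also have "(2 * real T + 1) * P = real (card (int_box (insert n V) (R(n := T))))"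
      proof -
        have "card (int_box (insert n V) (R(n := T))) = (2 * T + 1) * (\<Prod>i\<in>V. 2 * R i + 1)"
        proof -
          have "(\<Prod>i\<in>V. 2 * (R(n := T)) i + 1) = (\<Prod>i\<in>V. 2 * R i + 1)"
            using V(2) by (intro prod.cong) auto
          then show ?thesis
            unfolding card_int_box[OF finite.insertI[OF V(1)]] prod.insert[OF V] fun_upd_same by (rule arg_cong)
        qed
        then show ?thesis
          by (simp add: P_def algebra_simps)
      qed
      finally show ?case .
    qed
  qed
qed

section \<open>Resultants of binary forms\<close>

text \<open>Row \<open>i\<close> lists the coefficients of \<open>f i\<close>, the highest first, as in the Sylvester matrix.\<close>

definition poly_rows :: "nat \<Rightarrow> (nat \<Rightarrow> 'a::comm_ring_1 poly) \<Rightarrow> 'a mat" where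
  "poly_rows n f = mat n n (\<lambda>(i, j). coeff (f i) (n - Suc j))"

lemma poly_rows_carrier: "poly_rows n f \<in> carrier_mat n n"
  by (simp add: poly_rows_def)

lemma poly_rows_cong: "(\<And>i. i < n \<Longrightarrow> f i = g i) \<Longrightarrow> poly_rows n f = poly_rows n g"
  by (auto simp: poly_rows_def intro!: eq_matI)

lemma poly_as_sum_lessThan:
  fixes p :: "'a::comm_ring_1 poly"
  assumes "degree p < n"
  shows "p = (\<Sum>j<n. monom (coeff p (n - Suc j)) (n - Suc j))"
proof -
  have "(\<Sum>j<n. monom (coeff p (n - Suc j)) (n - Suc j)) = (\<Sum>j<n. monom (coeff p j) j)"
    by (rule sum.nat_diff_reindex)
  also have "\<dots> = p"
    using assms by (intro poly_eqI) (auto simp: coeff_sum if_distrib coeff_eq_0 not_less cong: if_cong)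
  finally show ?thesis ..
qed

lemma sum_lessThan_add:
  fixes f :: "nat \<Rightarrow> 'a::comm_monoid_add"
  shows "sum f {..<m + n} = (\<Sum>k<m. f k) + (\<Sum>k<n. f (m + k))"
  by (induction n) (simp_all add: ac_simps)

lemma mult_poly_rows:
  assumes A: "A \<in> carrier_mat n n"
  shows "A * poly_rows n f = poly_rows n (\<lambda>i. \<Sum>k<n. smult (A $$ (i, k)) (f k))"
proof (rule eq_matI)
  fix i j assume "i < dim_row (poly_rows n (\<lambda>i. \<Sum>k<n. smult (A $$ (i, k)) (f k)))"
    "j < dim_col (poly_rows n (\<lambda>i. \<Sum>k<n. smult (A $$ (i, k)) (f k)))"
  then have ij: "i < n" "j < n"
    by (auto simp: poly_rows_def)
  then show "(A * poly_rows n f) $$ (i, j) = poly_rows n (\<lambda>i. \<Sum>k<n. smult (A $$ (i, k)) (f k)) $$ (i, j)"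
    using A by (simp add: poly_rows_def scalar_prod_def coeff_sum atLeast0LessThan)
qed (use A in \<open>auto simp: poly_rows_def\<close>)

text \<open>Right multiplication replaces each monomial of the row polynomials by one of the
  \<open>h k\<close>; this is how substitutions enter.\<close>

lemma poly_rows_mult:
  shows "poly_rows n f * poly_rows n h = poly_rows n (\<lambda>i. \<Sum>k<n. smult (coeff (f i) (n - Suc k)) (h k))"
  by (subst mult_poly_rows[OF poly_rows_carrier]) (auto intro!: poly_rows_cong simp: poly_rows_def)

text \<open>The degree bound makes a row faithful to its polynomial, so a kernel vector of the
  transpose is a linear relation between the polynomials.\<close>

lemma det_poly_rows_eq_0_iff:
  fixes f :: "nat \<Rightarrow> 'a::idom poly"
  assumes deg: "\<And>i. i < n \<Longrightarrow> degree (f i) < n"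
  shows "det (poly_rows n f) = 0 \<longleftrightarrow> (\<exists>w. (\<exists>i<n. w i \<noteq> 0) \<and> (\<Sum>i<n. smult (w i) (f i)) = 0)"
proof -
  let ?M = "poly_rows n f"
  have entry: "(transpose_mat ?M *\<^sub>v v) $ j = coeff (\<Sum>i<n. smult (v $ i) (f i)) (n - Suc j)"
    if "v \<in> carrier_vec n" "j < n" for v j
    using that by (auto simp: poly_rows_def scalar_prod_def coeff_sum atLeast0LessThan ac_simps intro!: sum.cong)
  have zero: "transpose_mat ?M *\<^sub>v v = 0\<^sub>v n \<longleftrightarrow> (\<Sum>i<n. smult (v $ i) (f i)) = 0"
    if v: "v \<in> carrier_vec n" for v
  proof
    let ?s = "\<Sum>i<n. smult (v $ i) (f i)"
    assume eq: "transpose_mat ?M *\<^sub>v v = 0\<^sub>v n"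
    have "coeff ?s k = 0" for k
    proof (cases "k < n")
      case True
      then show ?thesis
        using entry[OF v, of "n - Suc k"] eq by simp
    next
      case False
      then show ?thesis
        by (auto simp: coeff_sum not_less intro!: sum.neutral coeff_eq_0 less_le_trans[OF deg])
    qed
    then show "?s = 0"
      by (simp add: poly_eq_iff)
  next
    assume "(\<Sum>i<n. smult (v $ i) (f i)) = 0"
    then show "transpose_mat ?M *\<^sub>v v = 0\<^sub>v n"
      using entry[OF v] by (intro eq_vecI) (auto simp: poly_rows_def)
  qed
  have "det ?M = det (transpose_mat ?M)"
    by (rule det_transpose[symmetric, OF poly_rows_carrier])
  then have "det ?M = 0 \<longleftrightarrow> (\<exists>v\<in>carrier_vec n. v \<noteq> 0\<^sub>v n \<and> transpose_mat ?M *\<^sub>v v = 0\<^sub>v n)"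
    using det_0_iff_vec_prod_zero[of "transpose_mat ?M" n] poly_rows_carrier by (auto simp: transpose_carrier_mat)
  also have "\<dots> \<longleftrightarrow> (\<exists>v\<in>carrier_vec n. v \<noteq> 0\<^sub>v n \<and> (\<Sum>i<n. smult (v $ i) (f i)) = 0)"
    using zero by blast
  also have "\<dots> \<longleftrightarrow> (\<exists>w. (\<exists>i<n. w i \<noteq> 0) \<and> (\<Sum>i<n. smult (w i) (f i)) = 0)"
  proof
    assume "\<exists>v\<in>carrier_vec n. v \<noteq> 0\<^sub>v n \<and> (\<Sum>i<n. smult (v $ i) (f i)) = 0"
    then obtain v where v: "v \<in> carrier_vec n" "v \<noteq> 0\<^sub>v n" "(\<Sum>i<n. smult (v $ i) (f i)) = 0"
      by blast
    have "\<exists>i<n. v $ i \<noteq> 0"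
    proof (rule ccontr)
      assume "\<not> (\<exists>i<n. v $ i \<noteq> 0)"
      then have "v = 0\<^sub>v n"
        using v(1) by (intro eq_vecI) auto
      then show False
        using v(2) by simp
    qed
    then show "\<exists>w. (\<exists>i<n. w i \<noteq> 0) \<and> (\<Sum>i<n. smult (w i) (f i)) = 0"
      using v(3) by (intro exI[of _ "($) v"]) simp
  next
    assume "\<exists>w. (\<exists>i<n. w i \<noteq> 0) \<and> (\<Sum>i<n. smult (w i) (f i)) = 0"
    then obtain w i where w: "i < n" "w i \<noteq> 0" "(\<Sum>i<n. smult (w i) (f i)) = 0"
      by blast
    have "vec n w \<noteq> 0\<^sub>v n"
      using w(1,2) by (metis index_vec index_zero_vec(1))
    moreover have "(\<Sum>i<n. smult (vec n w $ i) (f i)) = (\<Sum>i<n. smult (w i) (f i))"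
      by (intro sum.cong) auto
    ultimately show "\<exists>v\<in>carrier_vec n. v \<noteq> 0\<^sub>v n \<and> (\<Sum>i<n. smult (v $ i) (f i)) = 0"
      using w(3) by (intro bexI[of _ "vec n w"]) auto
  qed
  finally show ?thesis .
qed

text \<open>The matrix sends the vector of powers of \<open>t\<close> to the values
  \<open>poly (f i) t\<close>, and the adjugate recovers the determinant times that vector from
  them. This works over any commutative ring, without passing to a quotient.\<close>

lemma det_poly_rows_dvd:
  fixes f :: "nat \<Rightarrow> 'a::comm_ring_1 poly"
  assumes n: "n > 0" and deg: "\<And>i. i < n \<Longrightarrow> degree (f i) < n" and dvd: "\<And>i. i < n \<Longrightarrow> m dvd poly (f i) t"
  shows "m dvd det (poly_rows n f)"
proof -
  let ?M = "poly_rows n f"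
  define v where "v = vec n (\<lambda>j. t ^ (n - Suc j))"
  have v: "v \<in> carrier_vec n"
    by (simp add: v_def)
  have Mv: "?M *\<^sub>v v = vec n (\<lambda>i. poly (f i) t)"
  proof (rule eq_vecI)
    fix i assume "i < dim_vec (vec n (\<lambda>i. poly (f i) t))"
    then have i: "i < n"
      by simp
    have "(?M *\<^sub>v v) $ i = (\<Sum>j<n. coeff (f i) (n - Suc j) * t ^ (n - Suc j))"
      using i by (auto simp: poly_rows_def v_def scalar_prod_def atLeast0LessThan intro!: sum.cong)
    also have "\<dots> = poly (f i) t"
      using arg_cong[OF poly_as_sum_lessThan[OF deg[OF i]], of "\<lambda>p. poly p t"]
      by (simp add: poly_sum poly_monom)
    finally show "(?M *\<^sub>v v) $ i = vec n (\<lambda>i. poly (f i) t) $ i"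
      using i by simp
  qed (simp add: poly_rows_def)
  have "det ?M \<cdot>\<^sub>v v = (det ?M \<cdot>\<^sub>m 1\<^sub>m n) *\<^sub>v v"
    using v by (auto intro!: eq_vecI simp: scalar_prod_def v_def if_distrib if_distribR cong: if_cong)
  also have "\<dots> = (adj_mat ?M * ?M) *\<^sub>v v"
    by (simp add: adj_mat(3)[OF poly_rows_carrier])
  also have "\<dots> = adj_mat ?M *\<^sub>v (?M *\<^sub>v v)"
    by (rule assoc_mult_mat_vec[OF adj_mat(1)[OF poly_rows_carrier] poly_rows_carrier v])
  \<comment> \<open>The last entry of the vector of powers is \<open>t ^ 0\<close>, so the
    determinant itself appears there.\<close>
  finally have "(det ?M \<cdot>\<^sub>v v) $ (n - 1) = (adj_mat ?M *\<^sub>v vec n (\<lambda>i. poly (f i) t)) $ (n - 1)"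
    by (simp add: Mv)
  also have "\<dots> = (\<Sum>i<n. adj_mat ?M $$ (n - 1, i) * poly (f i) t)"
    using n adj_mat(1)[OF poly_rows_carrier[of n f]]
    by (auto simp: scalar_prod_def atLeast0LessThan intro!: sum.cong)
  finally have "det ?M = (\<Sum>i<n. adj_mat ?M $$ (n - 1, i) * poly (f i) t)"
    using n by (simp add: v_def)
  then show ?thesis
    using dvd by (auto intro!: dvd_sum dvd_mult)
qed

text \<open>The polynomials z^k P and then z^k Q, with k running down from d - 1; for i >= d the
  exponent \<open>2 * d - Suc i\<close> is d - 1 - (i - d).\<close>

definition syl_rows :: "nat \<Rightarrow> 'a::comm_ring_1 poly \<Rightarrow> 'a poly \<Rightarrow> nat \<Rightarrow> 'a poly" where
  "syl_rows d P Q i = (if i < d then monom 1 (d - Suc i) * P else monom 1 (2 * d - Suc i) * Q)"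

lemma sylvester_mat_sub_eq_poly_rows:
  assumes "degree P \<le> d" and "degree Q \<le> d"
  shows "sylvester_mat_sub d d P Q = poly_rows (2 * d) (syl_rows d P Q)"
proof (rule eq_matI)
  fix i j assume "i < dim_row (poly_rows (2 * d) (syl_rows d P Q))" "j < dim_col (poly_rows (2 * d) (syl_rows d P Q))"
  then have ij: "i < d + d" "j < d + d"
    by (auto simp: poly_rows_def)
  show "sylvester_mat_sub d d P Q $$ (i, j) = poly_rows (2 * d) (syl_rows d P Q) $$ (i, j)"
  proof (cases "i < d")
    case True
    have "2 * d - Suc j - (d - Suc i) = d + i - j" "d - Suc i \<le> 2 * d - Suc j \<longleftrightarrow> \<not> d + i < j"
      using True ij by auto
    then have "poly_rows (2 * d) (syl_rows d P Q) $$ (i, j) = (if d + i < j then 0 else coeff P (d + i - j))"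
      using True ij by (simp add: poly_rows_def syl_rows_def coeff_monom_mult)
    also have "\<dots> = sylvester_mat_sub d d P Q $$ (i, j)"
      using True ij assms(1) by (auto simp: sylvester_mat_sub_index intro!: coeff_eq_0)
    finally show ?thesis ..
  next
    case False
    have "2 * d - Suc j - (2 * d - Suc i) = i - j" "2 * d - Suc i \<le> 2 * d - Suc j \<longleftrightarrow> \<not> i < j"
      using False ij by auto
    then have "poly_rows (2 * d) (syl_rows d P Q) $$ (i, j) = (if i < j then 0 else coeff Q (i - j))"
      using False ij by (simp add: poly_rows_def syl_rows_def coeff_monom_mult)
    also have "\<dots> = sylvester_mat_sub d d P Q $$ (i, j)"
      using False ij assms(2) by (auto simp: sylvester_mat_sub_index intro!: coeff_eq_0)
    finally show ?thesis ..
  qed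
qed (auto simp: poly_rows_def)

lemma degree_syl_rows:
  assumes "degree P \<le> d" and "degree Q \<le> d" and "i < 2 * d"
  shows "degree (syl_rows d P Q i) < 2 * d"
proof -
  have deg: "degree (monom 1 k * R) \<le> k + degree R" for k and R :: "'a poly"
    using degree_mult_le[of "monom 1 k" R] degree_monom_le[of "1 :: 'a" k] by linarith
  show ?thesis
  proof (cases "i < d")
    case True
    then show ?thesis
      using deg[of "d - Suc i" P] assms by (simp add: syl_rows_def)
  next
    case False
    then show ?thesis
      using deg[of "2 * d - Suc i" Q] assms by (simp add: syl_rows_def)
  qed
qed

lemma resultant_sub_eq_det:
  "degree P \<le> d \<Longrightarrow> degree Q \<le> d \<Longrightarrow> resultant_sub d d P Q = det (poly_rows (2 * d) (syl_rows d P Q))"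
  by (simp add: resultant_sub_def sylvester_mat_sub_eq_poly_rows)

text \<open>A common zero modulo \<open>m\<close> is a zero of all Sylvester rows. Later
  \<open>m\<close> is a prime, for the discriminant, or 0, for actual common roots.\<close>

lemma resultant_sub_dvd:
  fixes P Q :: "'a::comm_ring_1 poly"
  assumes "d > 0" and "degree P \<le> d" and "degree Q \<le> d" and "m dvd poly P t" and "m dvd poly Q t"
  shows "m dvd resultant_sub d d P Q"
  unfolding resultant_sub_eq_det[OF assms(2,3)]
proof (rule det_poly_rows_dvd)
  show "m dvd poly (syl_rows d P Q i) t" for i
    using assms(4,5) by (simp add: syl_rows_def)
qed (use assms degree_syl_rows in auto)

lemma sum_syl_rows:
  "(\<Sum>i<2 * d. smult (w i) (syl_rows d P Q i)) =
    (\<Sum>i<d. monom (w i) (d - Suc i)) * P + (\<Sum>i<d. monom (w (d + i)) (d - Suc i)) * Q"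
proof -
  have "(\<Sum>i<2 * d. smult (w i) (syl_rows d P Q i)) =
      (\<Sum>i<d. smult (w i) (syl_rows d P Q i)) + (\<Sum>i<d. smult (w (d + i)) (syl_rows d P Q (d + i)))"
    unfolding mult_2 by (rule sum_lessThan_add)
  also have "(\<Sum>i<d. smult (w i) (syl_rows d P Q i)) = (\<Sum>i<d. monom (w i) (d - Suc i)) * P"
    by (simp add: syl_rows_def sum_distrib_right smult_monom flip: mult_smult_left)
  also have "(\<Sum>i<d. smult (w (d + i)) (syl_rows d P Q (d + i))) = (\<Sum>i<d. monom (w (d + i)) (d - Suc i)) * Q"
    by (simp add: syl_rows_def sum_distrib_right smult_monom flip: mult_smult_left)
  finally show ?thesis .
qed

lemma coeff_sum_monom_rev:
  "coeff (\<Sum>i<d. monom (w i) (d - Suc i)) k = (if k < d then w (d - Suc k) else 0)"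
proof -
  have "(\<Sum>i<d. monom (w i) (d - Suc i)) = (\<Sum>i<d. monom (w (d - Suc (d - Suc i))) (d - Suc i))"
    by (intro sum.cong) auto
  also have "\<dots> = (\<Sum>i<d. monom (w (d - Suc i)) i)"
    by (rule sum.nat_diff_reindex)
  finally show ?thesis
    by (simp add: coeff_sum if_distrib cong: if_cong)
qed

text \<open>Stated with cofactors instead of a common factor, because the resultant also vanishes
  when the formal degree \<open>d\<close> exceeds both actual degrees.\<close>

lemma resultant_sub_eq_0_iff:
  fixes P Q :: "'a::idom poly"
  assumes "d > 0" and deg: "degree P \<le> d" "degree Q \<le> d"
  shows "resultant_sub d d P Q = 0 \<longleftrightarrow>
    (\<exists>U W. (U \<noteq> 0 \<or> W \<noteq> 0) \<and> degree U < d \<and> degree W < d \<and> U * P + W * Q = 0)"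
proof -
  have "resultant_sub d d P Q = 0 \<longleftrightarrow>
      (\<exists>w. (\<exists>i<2 * d. w i \<noteq> 0) \<and> (\<Sum>i<2 * d. smult (w i) (syl_rows d P Q i)) = 0)"
    unfolding resultant_sub_eq_det[OF deg] using degree_syl_rows[OF deg] by (rule det_poly_rows_eq_0_iff)
  also have "\<dots> \<longleftrightarrow> (\<exists>U W. (U \<noteq> 0 \<or> W \<noteq> 0) \<and> degree U < d \<and> degree W < d \<and> U * P + W * Q = 0)"
  proof
    assume "\<exists>w. (\<exists>i<2 * d. w i \<noteq> 0) \<and> (\<Sum>i<2 * d. smult (w i) (syl_rows d P Q i)) = 0"
    then obtain w i where i: "i < 2 * d" "w i \<noteq> 0" and sum: "(\<Sum>i<2 * d. smult (w i) (syl_rows d P Q i)) = 0"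
      by blast
    define U where "U = (\<Sum>i<d. monom (w i) (d - Suc i))"
    define W where "W = (\<Sum>i<d. monom (w (d + i)) (d - Suc i))"
    have coeffs: "coeff U k = (if k < d then w (d - Suc k) else 0)"
        "coeff W k = (if k < d then w (d + (d - Suc k)) else 0)" for k
      unfolding U_def W_def using coeff_sum_monom_rev[of w d k] coeff_sum_monom_rev[of "\<lambda>i. w (d + i)" d k]
      by simp_all
    have "degree U < d" "degree W < d"
      using assms(1) by (auto simp: coeffs intro!: degree_lessI)
    moreover have "U \<noteq> 0 \<or> W \<noteq> 0"
    proof (cases "i < d")
      case True
      then have "coeff U (d - Suc i) \<noteq> 0"
        using i by (simp add: coeffs)
      then show ?thesis
        by auto
    next
      case False
      then have "coeff W (2 * d - Suc i) \<noteq> 0"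
        using i by (auto simp: coeffs)
      then show ?thesis
        by auto
    qed
    moreover have "U * P + W * Q = 0"
      using sum by (simp add: sum_syl_rows U_def W_def)
    ultimately show "\<exists>U W. (U \<noteq> 0 \<or> W \<noteq> 0) \<and> degree U < d \<and> degree W < d \<and> U * P + W * Q = 0"
      by blast
  next
    assume "\<exists>U W. (U \<noteq> 0 \<or> W \<noteq> 0) \<and> degree U < d \<and> degree W < d \<and> U * P + W * Q = 0"
    then obtain U W where UW: "U \<noteq> 0 \<or> W \<noteq> 0" "degree U < d" "degree W < d" "U * P + W * Q = 0"
      by blast
    define w where "w i = (if i < d then coeff U (d - Suc i) else coeff W (2 * d - Suc i))" for i
    have U: "(\<Sum>i<d. monom (w i) (d - Suc i)) = U"
      using poly_as_sum_lessThan[OF UW(2)] by (simp add: w_def)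
    have W: "(\<Sum>i<d. monom (w (d + i)) (d - Suc i)) = W"
      using poly_as_sum_lessThan[OF UW(3)] by (simp add: w_def)
    have "\<exists>i<2 * d. w i \<noteq> 0"
    proof (rule ccontr)
      assume "\<not> (\<exists>i<2 * d. w i \<noteq> 0)"
      then have "U = 0 \<and> W = 0"
        using U W by simp
      then show False
        using UW(1) by simp
    qed
    moreover have "(\<Sum>i<2 * d. smult (w i) (syl_rows d P Q i)) = 0"
      using UW(4) by (simp add: sum_syl_rows U W)
    ultimately show "\<exists>w. (\<exists>i<2 * d. w i \<noteq> 0) \<and> (\<Sum>i<2 * d. smult (w i) (syl_rows d P Q i)) = 0"
      by blast
  qed
  finally show ?thesis .
qed

section \<open>Behaviour of the resultant under linear changes of the forms\<close>

lemma resultant_sub_smult: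
  assumes "degree P \<le> d" and "degree Q \<le> d"
  shows "resultant_sub d d (smult h P) (smult h Q) = h ^ (2 * d) * resultant_sub d d P Q"
proof -
  have "sylvester_mat_sub d d (smult h P) (smult h Q) = h \<cdot>\<^sub>m sylvester_mat_sub d d P Q"
    by (rule eq_matI) (auto simp: sylvester_mat_sub_index)
  then show ?thesis
    by (simp add: resultant_sub_def mult_2)
qed

text \<open>The Sylvester rows are multiplied on the left by a matrix of four scalar blocks; as
  these commute, its determinant is that of the scalar matrix \<open>a * e - b * c\<close> of size
  \<open>d\<close>.\<close>

lemma resultant_sub_linear_combination:
  fixes P Q :: "'a::idom poly"
  assumes deg: "degree P \<le> d" "degree Q \<le> d"
  shows "resultant_sub d d (smult a P + smult b Q) (smult c P + smult e Q) =
    (a * e - b * c) ^ d * resultant_sub d d P Q"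
proof -
  let ?P = "smult a P + smult b Q" and ?Q = "smult c P + smult e Q"
  define A where "A = four_block_mat (a \<cdot>\<^sub>m 1\<^sub>m d) (b \<cdot>\<^sub>m 1\<^sub>m d) (c \<cdot>\<^sub>m 1\<^sub>m d) (e \<cdot>\<^sub>m (1\<^sub>m d :: 'a mat))"
  have A: "A \<in> carrier_mat (2 * d) (2 * d)"
    unfolding A_def mult_2 by (intro four_block_carrier_mat) auto
  have entry: "A $$ (i, k) = (if i < d then (if k < d then a * of_bool (i = k) else b * of_bool (i = k - d))
      else (if k < d then c * of_bool (i - d = k) else e * of_bool (i - d = k - d)))"
    if "i < 2 * d" "k < 2 * d" for i k
    using that by (auto simp: A_def)
  have degs: "degree ?P \<le> d" "degree ?Q \<le> d"
    using deg by (auto intro!: degree_add_le order_trans[OF degree_smult_le])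
  have row: "(\<Sum>k<2 * d. smult (A $$ (i, k)) (syl_rows d P Q k)) = syl_rows d ?P ?Q i" if i: "i < 2 * d" for i
  proof -
    have "(\<Sum>k<2 * d. smult (A $$ (i, k)) (syl_rows d P Q k)) =
        (\<Sum>k<d. smult (A $$ (i, k)) (syl_rows d P Q k)) + (\<Sum>k<d. smult (A $$ (i, d + k)) (syl_rows d P Q (d + k)))"
      unfolding mult_2 by (rule sum_lessThan_add)
    also have "\<dots> = syl_rows d ?P ?Q i"
    proof (cases "i < d")
      case True
      have "(\<Sum>k<d. smult (A $$ (i, k)) (syl_rows d P Q k)) = (\<Sum>k<d. if k = i then smult a (syl_rows d P Q i) else 0)"
        "(\<Sum>k<d. smult (A $$ (i, d + k)) (syl_rows d P Q (d + k))) =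
          (\<Sum>k<d. if k = i then smult b (syl_rows d P Q (d + i)) else 0)"
        by (intro sum.cong refl; use True in \<open>simp add: entry\<close>)+
      then show ?thesis
        using True by (simp add: syl_rows_def distrib_left)
    next
      case False
      have "(\<Sum>k<d. smult (A $$ (i, k)) (syl_rows d P Q k)) = (\<Sum>k<d. if k = i - d then smult c (syl_rows d P Q (i - d)) else 0)"
        "(\<Sum>k<d. smult (A $$ (i, d + k)) (syl_rows d P Q (d + k))) =
          (\<Sum>k<d. if k = i - d then smult e (syl_rows d P Q i) else 0)"
        by (intro sum.cong refl; use False i in \<open>auto simp: entry\<close>)+
      moreover have "d - Suc (i - d) = 2 * d - Suc i"
        using False by simp
      ultimately show ?thesis
        using False i by (simp add: syl_rows_def distrib_left)
    qed
    finally show ?thesis .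
  qed
  have "A * poly_rows (2 * d) (syl_rows d P Q) = poly_rows (2 * d) (syl_rows d ?P ?Q)"
    unfolding mult_poly_rows[OF A] using row by (rule poly_rows_cong)
  then have "resultant_sub d d ?P ?Q = det A * resultant_sub d d P Q"
    unfolding resultant_sub_eq_det[OF deg] resultant_sub_eq_det[OF degs]
    using det_mult[OF A poly_rows_carrier] by metis
  also have "det A = det ((a * e - b * c) \<cdot>\<^sub>m (1\<^sub>m d :: 'a mat))"
  proof -
    have "det A = det ((a \<cdot>\<^sub>m 1\<^sub>m d) * (e \<cdot>\<^sub>m 1\<^sub>m d) - (b \<cdot>\<^sub>m 1\<^sub>m d) * (c \<cdot>\<^sub>m (1\<^sub>m d :: 'a mat)))"
      unfolding A_def
    proof (rule det_four_block_mat)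
      show "c \<cdot>\<^sub>m 1\<^sub>m d * (e \<cdot>\<^sub>m 1\<^sub>m d) = e \<cdot>\<^sub>m 1\<^sub>m d * (c \<cdot>\<^sub>m (1\<^sub>m d :: 'a mat))"
        by (auto simp: scalar_prod_def intro!: eq_matI sum.cong)
    qed auto
    also have "(a \<cdot>\<^sub>m 1\<^sub>m d) * (e \<cdot>\<^sub>m 1\<^sub>m d) - (b \<cdot>\<^sub>m 1\<^sub>m d) * (c \<cdot>\<^sub>m (1\<^sub>m d :: 'a mat)) = (a * e - b * c) \<cdot>\<^sub>m 1\<^sub>m d"
    proof -
      have "(x \<cdot>\<^sub>m 1\<^sub>m d) * (y \<cdot>\<^sub>m (1\<^sub>m d :: 'a mat)) = (x * y) \<cdot>\<^sub>m 1\<^sub>m d" for x y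
        by (auto simp: mult_smult_assoc_mat[of _ d d _ d] intro!: eq_matI)
      then show ?thesis
        by (auto intro!: eq_matI)
    qed
    finally show ?thesis .
  qed
  also have "\<dots> = (a * e - b * c) ^ d"
    by simp
  finally show ?thesis .
qed

text \<open>
  The binary form of degree \<open>m\<close> with dehomogenization \<open>P\<close>, evaluated at \<open>(a z + b, c z + e)\<close>.
\<close>

definition hsub :: "nat \<Rightarrow> 'a::comm_ring_1 \<Rightarrow> 'a \<Rightarrow> 'a \<Rightarrow> 'a \<Rightarrow> 'a poly \<Rightarrow> 'a poly" where
  "hsub m a b c e P = (\<Sum>i\<le>m. smult (coeff P i) ([:b, a:] ^ i * [:e, c:] ^ (m - i)))"

lemma degree_linear_power_mult_le:
  "degree ([:b, a:] ^ i * [:e, c:] ^ j) \<le> i + j" for a b c e :: "'a::comm_ring_1"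
proof -
  have "degree ([:b, a:] ^ i) \<le> i" for a b :: 'a and i
    using degree_power_le[of "[:b, a:]" i] by (auto split: if_splits)
  then show ?thesis
    using degree_mult_le[of "[:b, a:] ^ i" "[:e, c:] ^ j"] by (meson add_mono le_trans)
qed

lemma degree_hsub: "degree (hsub m a b c e P) \<le> m"
  unfolding hsub_def
  using degree_linear_power_mult_le
  by (intro degree_sum_le) (auto intro!: order_trans[OF degree_smult_le] intro: order_trans[OF degree_linear_power_mult_le])

lemma hsub_add: "hsub m a b c e (P + Q) = hsub m a b c e P + hsub m a b c e Q"
  by (simp add: hsub_def smult_add_left sum.distrib)

lemma hsub_0: "hsub m a b c e 0 = 0"
  by (simp add: hsub_def)

lemma hsub_sum: "hsub m a b c e (\<Sum>x\<in>A. f x) = (\<Sum>x\<in>A. hsub m a b c e (f x))"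
  by (induction A rule: infinite_finite_induct) (simp_all add: hsub_add hsub_0)

lemma hsub_monom:
  assumes "i \<le> m"
  shows "hsub m a b c e (monom k i) = smult k ([:b, a:] ^ i * [:e, c:] ^ (m - i))"
proof -
  have "hsub m a b c e (monom k i) = (\<Sum>j\<le>m. if j = i then smult k ([:b, a:] ^ i * [:e, c:] ^ (m - i)) else 0)"
    unfolding hsub_def by (intro sum.cong) auto
  then show ?thesis
    using assms by simp
qed

lemma poly_as_sum_atMost:
  fixes p :: "'a::comm_ring_1 poly"
  assumes "degree p \<le> n"
  shows "p = (\<Sum>j\<le>n. monom (coeff p j) j)"
  using assms by (intro poly_eqI) (auto simp: coeff_sum if_distrib coeff_eq_0 not_le cong: if_cong)

text \<open>The formal degrees have to add up, since \<open>hsub m\<close> homogenizes to degree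
  \<open>m\<close> whatever the actual degree is.\<close>

lemma hsub_mult:
  assumes "degree U \<le> m" and "degree F \<le> k"
  shows "hsub (m + k) a b c e (U * F) = hsub m a b c e U * hsub k a b c e F"
proof -
  have "hsub (m + k) a b c e (monom u i * monom f j) = hsub m a b c e (monom u i) * hsub k a b c e (monom f j)"
    if "i \<le> m" "j \<le> k" for i j u f
  proof -
    have "m + k - (i + j) = (m - i) + (k - j)"
      using that by simp
    then have "[:e, c:] ^ (m + k - (i + j)) = [:e, c:] ^ (m - i) * [:e, c:] ^ (k - j)"
      by (simp only: power_add)
    then show ?thesis
      unfolding mult_monom hsub_monom[OF add_mono[OF that]] hsub_monom[OF that(1)] hsub_monom[OF that(2)]
      by (simp add: power_add ac_simps)
  qed
  then have "(\<Sum>i\<le>m. \<Sum>j\<le>k. hsub (m + k) a b c e (monom (coeff U i) i * monom (coeff F j) j)) =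
      (\<Sum>i\<le>m. \<Sum>j\<le>k. hsub m a b c e (monom (coeff U i) i) * hsub k a b c e (monom (coeff F j) j))"
    by (intro sum.cong) auto
  moreover have "U * F = (\<Sum>i\<le>m. \<Sum>j\<le>k. monom (coeff U i) i * monom (coeff F j) j)"
    unfolding sum_product[symmetric]
    by (rule arg_cong2[where f = "(*)"]; rule poly_as_sum_atMost; fact)
  moreover have "hsub m a b c e U * hsub k a b c e F =
      (\<Sum>i\<le>m. \<Sum>j\<le>k. hsub m a b c e (monom (coeff U i) i) * hsub k a b c e (monom (coeff F j) j))"
    using arg_cong[OF poly_as_sum_atMost[OF assms(1)], of "hsub m a b c e"]
      arg_cong[OF poly_as_sum_atMost[OF assms(2)], of "hsub k a b c e"]
    by (simp add: hsub_sum sum_product)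
  ultimately show ?thesis
    by (simp only: hsub_sum)
qed

lemma hsub_linear: "hsub 1 a b c e [:y, x:] = [:x * b + y * e, x * a + y * c:]"
  by (simp add: hsub_def ac_simps)

lemma hsub_one: "hsub 0 a b c e 1 = 1"
  by (simp add: hsub_def)

lemma hsub_linear_power:
  "hsub k a b c e ([:y, x:] ^ k) = [:x * b + y * e, x * a + y * c:] ^ k"
proof (induction k)
  case (Suc k)
  have "degree ([:y, x:] ^ k) \<le> k"
    using degree_linear_power_mult_le[of y x k 1 0 0] by simp
  then have "hsub (1 + k) a b c e ([:y, x:] * [:y, x:] ^ k) =
      hsub 1 a b c e [:y, x:] * hsub k a b c e ([:y, x:] ^ k)"
    by (intro hsub_mult) auto
  then show ?case
    unfolding hsub_linear Suc by simp
qed (simp add: hsub_one)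

lemma hsub_basis:
  assumes "i \<le> m"
  shows "hsub m a' b' c' e' ([:b, a:] ^ i * [:e, c:] ^ (m - i)) =
    [:a * b' + b * e', a * a' + b * c':] ^ i * [:c * b' + e * e', c * a' + e * c':] ^ (m - i)"
proof -
  have deg: "degree ([:y, x:] ^ k) \<le> k" for x y :: 'a and k
    using degree_linear_power_mult_le[of y x k 1 0 0] by simp
  show ?thesis
    using hsub_mult[OF deg[of b a i] deg[of e c "m - i"], of a' b' c' e'] assms
    by (simp add: hsub_linear_power)
qed

text \<open>The right factor does not depend on \<open>f\<close>, so a substitution changes all such
  determinants by the same factor.\<close>

lemma poly_rows_hsub:
  "poly_rows (Suc m) f * poly_rows (Suc m) (\<lambda>k. [:b, a:] ^ (m - k) * [:e, c:] ^ k) =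
    poly_rows (Suc m) (\<lambda>i. hsub m a b c e (f i))"
  unfolding poly_rows_mult
proof (rule poly_rows_cong)
  fix i
  have "(\<Sum>k<Suc m. smult (coeff (f i) (Suc m - Suc k)) ([:b, a:] ^ (m - k) * [:e, c:] ^ k)) =
      (\<Sum>k<Suc m. smult (coeff (f i) (Suc m - Suc k)) ([:b, a:] ^ (Suc m - Suc k) * [:e, c:] ^ (m - (Suc m - Suc k))))"
    by (intro sum.cong) auto
  also have "\<dots> = (\<Sum>k<Suc m. smult (coeff (f i) k) ([:b, a:] ^ k * [:e, c:] ^ (m - k)))"
    by (rule sum.nat_diff_reindex)
  finally show "(\<Sum>k<Suc m. smult (coeff (f i) (Suc m - Suc k)) ([:b, a:] ^ (m - k) * [:e, c:] ^ k)) =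
      hsub m a b c e (f i)"
    by (simp add: hsub_def lessThan_Suc_atMost)
qed

text \<open>The determinant of the substitution acting on binary forms of degree \<open>m\<close>,
  that is, of the \<open>m\<close>-th symmetric power of the matrix.\<close>

definition subst_det :: "nat \<Rightarrow> 'a::comm_ring_1 \<Rightarrow> 'a \<Rightarrow> 'a \<Rightarrow> 'a \<Rightarrow> 'a" where
  "subst_det m a b c e = det (poly_rows (Suc m) (\<lambda>i. [:b, a:] ^ (m - i) * [:e, c:] ^ i))"

lemma subst_det_mult:
  "subst_det m a b c e * subst_det m a' b' c' e' =
    subst_det m (a * a' + b * c') (a * b' + b * e') (c * a' + e * c') (c * b' + e * e')"
proof -
  have eq: "poly_rows (Suc m) (\<lambda>i. [:b, a:] ^ (m - i) * [:e, c:] ^ i) *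
      poly_rows (Suc m) (\<lambda>i. [:b', a':] ^ (m - i) * [:e', c':] ^ i) =
      poly_rows (Suc m) (\<lambda>i. [:a * b' + b * e', a * a' + b * c':] ^ (m - i) * [:c * b' + e * e', c * a' + e * c':] ^ i)"
    unfolding poly_rows_hsub
  proof (rule poly_rows_cong)
    fix i assume "i < Suc m"
    then show "hsub m a' b' c' e' ([:b, a:] ^ (m - i) * [:e, c:] ^ i) =
        [:a * b' + b * e', a * a' + b * c':] ^ (m - i) * [:c * b' + e * e', c * a' + e * c':] ^ i"
      using hsub_basis[of "m - i" m a' b' c' e' b a e c] by simp
  qed
  show ?thesis
    unfolding subst_det_def using arg_cong[OF eq, of det]
    by (simp only: det_mult[OF poly_rows_carrier poly_rows_carrier])
qed

lemma subst_det_upper: "subst_det m a b 0 e = (a * e) ^ (\<Sum>i<Suc m. i)"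
proof -
  let ?f = "\<lambda>i. [:b, a:] ^ (m - i) * [:e, 0:] ^ i"
  have f: "?f i = smult (e ^ i) ([:b, a:] ^ (m - i))" for i
    by (simp add: poly_const_pow)
  have deg: "degree ([:b, a:] ^ k) \<le> k" for k
    using degree_linear_power_mult_le[of b a k 1 0 0] by simp
  have top: "coeff ([:b, a:] ^ k) k = a ^ k" for k
    by (induction k) (simp_all add: coeff_eq_0 le_imp_less_Suc[OF deg])
  have upper: "upper_triangular (poly_rows (Suc m) ?f)"
  proof (rule upper_triangularI)
    fix i j assume ij: "j < i" "i < dim_row (poly_rows (Suc m) ?f)"
    then have "m - i < Suc m - Suc j"
      by (auto simp: poly_rows_def)
    then have "coeff ([:b, a:] ^ (m - i)) (Suc m - Suc j) = 0"
      using deg[of "m - i"] by (intro coeff_eq_0) linarith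
    then show "poly_rows (Suc m) ?f $$ (i, j) = 0"
      using ij unfolding f by (simp add: poly_rows_def)
  qed
  have "subst_det m a b 0 e = prod_list (diag_mat (poly_rows (Suc m) ?f))"
    unfolding subst_det_def by (rule det_upper_triangular[OF upper poly_rows_carrier])
  also have "\<dots> = (\<Prod>i<Suc m. poly_rows (Suc m) ?f $$ (i, i))"
    by (simp add: prod_list_diag_prod poly_rows_def atLeast0LessThan)
  also have "\<dots> = (\<Prod>i<Suc m. a ^ (Suc m - Suc i) * e ^ i)"
    unfolding f by (intro prod.cong refl) (simp add: poly_rows_def top)
  also have "\<dots> = (\<Prod>i<Suc m. a ^ (Suc m - Suc i)) * (\<Prod>i<Suc m. e ^ i)"
    by (rule prod.distrib)
  also have "(\<Prod>i<Suc m. a ^ (Suc m - Suc i)) = (\<Prod>i<Suc m. a ^ i)"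
    by (rule prod.nat_diff_reindex)
  finally show ?thesis
    by (simp add: power_sum[symmetric] power_mult_distrib del: sum.lessThan_Suc prod.lessThan_Suc)
qed

text \<open>For nonzero \<open>c\<close>, a Bruhat decomposition writes the matrix as upper
  triangular times the exchange of variables times upper triangular. The exchange is an involution,
  so its determinant is a sign; it is left open because only divisibility matters.\<close>

lemma subst_det_eq:
  fixes a b c e :: "'a::field"
  shows "\<exists>s\<in>{1, -1}. subst_det m a b c e = s * (a * e - b * c) ^ (\<Sum>i<Suc m. i)"
proof (cases "c = 0")
  case True
  then show ?thesis
    by (simp add: subst_det_upper)
next
  case False
  let ?g = "\<Sum>i<Suc m. i"
  have "subst_det m 0 1 1 0 * subst_det m 0 1 1 0 = (1 :: 'a)"
    using subst_det_mult[of m "0 :: 'a" 1 1 0 0 1 1 0] subst_det_upper[of m "1 :: 'a" 0 1] by simp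
  then have swap: "subst_det m 0 1 1 0 = (1 :: 'a) \<or> subst_det m 0 1 1 0 = (- 1 :: 'a)"
    by (simp add: square_eq_1_iff)
  have "subst_det m a b c e =
      subst_det m ((b * c - a * e) / c) (a / c) 0 1 * subst_det m 0 1 1 0 * subst_det m c e 0 1"
  proof -
    have "subst_det m ((b * c - a * e) / c) (a / c) 0 1 * subst_det m 0 1 1 0 =
        subst_det m (a / c) ((b * c - a * e) / c) 1 0"
      by (simp add: subst_det_mult)
    moreover have "subst_det m (a / c) ((b * c - a * e) / c) 1 0 * subst_det m c e 0 1 = subst_det m a b c e"
      unfolding subst_det_mult using False by (simp add: field_simps)
    ultimately show ?thesis
      by (simp only:)
  qed
  also have "\<dots> = subst_det m 0 1 1 0 * (((b * c - a * e) / c) ^ ?g * c ^ ?g)"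
    by (simp only: subst_det_upper mult_1_left mult_1_right ac_simps)
  also have "((b * c - a * e) / c) ^ ?g * c ^ ?g = (b * c - a * e) ^ ?g"
    using False by (simp only: power_mult_distrib[symmetric]) simp
  also have "b * c - a * e = (- 1) * (a * e - b * c)"
    by simp
  also have "\<dots> ^ ?g = (- 1) ^ ?g * (a * e - b * c) ^ ?g"
    by (rule power_mult_distrib)
  finally have "subst_det m a b c e = (subst_det m 0 1 1 0 * (- 1) ^ ?g) * (a * e - b * c) ^ ?g"
    by (simp only: ac_simps)
  moreover have "subst_det m 0 1 1 0 * (- 1) ^ ?g \<in> {1, - 1 :: 'a}"
    using swap by (cases "even ?g") auto
  ultimately show ?thesis
    by blast
qed

text \<open>
  Substitution multiplies the Sylvester matrix on the right by the substitution matrix of forms of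
  degree \<open>2 d - 1\<close>. The multipliers of \<open>P\<close> and \<open>Q\<close>, which are forms of degree \<open>d - 1\<close>, are
  transformed as well, and this is undone by a block diagonal matrix on the left.
\<close>

lemma resultant_sub_hsub:
  fixes P Q :: "'a::idom poly"
  assumes "degree P \<le> Suc d" and "degree Q \<le> Suc d"
  shows "resultant_sub (Suc d) (Suc d) P Q * subst_det (2 * d + 1) a b c e =
    subst_det d a b c e ^ 2 * resultant_sub (Suc d) (Suc d) (hsub (Suc d) a b c e P) (hsub (Suc d) a b c e Q)"
proof -
  let ?D = "Suc d"
  let ?P = "hsub ?D a b c e P" and ?Q = "hsub ?D a b c e Q"
  let ?h = "\<lambda>i. [:b, a:] ^ (d - i) * [:e, c:] ^ i"
  define N where "N = poly_rows ?D ?h"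
  \<comment> \<open>Acts on the two blocks of multipliers, whose degree \<open>d\<close> is one less
    than the formal degree of \<open>P\<close> and \<open>Q\<close>.\<close>
  define A where "A = four_block_mat N (0\<^sub>m ?D ?D) (0\<^sub>m ?D ?D) N"
  have N: "N \<in> carrier_mat ?D ?D"
    by (simp add: N_def poly_rows_carrier)
  then have A: "A \<in> carrier_mat (2 * ?D) (2 * ?D)"
    unfolding A_def mult_2 by (intro four_block_carrier_mat) auto
  have entry: "A $$ (i, k) = (if i < ?D then (if k < ?D then coeff (?h i) (?D - Suc k) else 0)
      else (if k < ?D then 0 else coeff (?h (i - ?D)) (?D - Suc (k - ?D))))"
    if "i < 2 * ?D" "k < 2 * ?D" for i k
    using that N by (auto simp: A_def N_def poly_rows_def)
  have deg_h: "degree (?h i) < ?D" if "i < ?D" for i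
    using degree_linear_power_mult_le[of b a "d - i" e c i] that by simp
  have hsub_syl: "hsub (2 * d + 1) a b c e (monom 1 (d - i) * R) = ?h i * hsub ?D a b c e R"
    if "i < ?D" "degree R \<le> ?D" for i R
  proof -
    have "degree (monom (1 :: 'a) (d - i)) \<le> d"
      using degree_monom_le[of "1 :: 'a" "d - i"] by simp
    then have "hsub (d + ?D) a b c e (monom 1 (d - i) * R) = hsub d a b c e (monom 1 (d - i)) * hsub ?D a b c e R"
      using that(2) by (rule hsub_mult)
    moreover have "hsub d a b c e (monom 1 (d - i)) = ?h i"
      using that by (simp add: hsub_monom)
    moreover have "d + ?D = 2 * d + 1"
      by simp
    ultimately show ?thesis
      by metis
  qed
  have row: "(\<Sum>k<2 * ?D. smult (A $$ (i, k)) (syl_rows ?D ?P ?Q k)) =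
      hsub (2 * d + 1) a b c e (syl_rows ?D P Q i)" if i: "i < 2 * ?D" for i
  proof -
    have "(\<Sum>k<2 * ?D. smult (A $$ (i, k)) (syl_rows ?D ?P ?Q k)) =
        (\<Sum>k<?D. monom (A $$ (i, k)) (?D - Suc k)) * ?P + (\<Sum>k<?D. monom (A $$ (i, ?D + k)) (?D - Suc k)) * ?Q"
      by (rule sum_syl_rows)
    also have "\<dots> = hsub (2 * d + 1) a b c e (syl_rows ?D P Q i)"
    proof (cases "i < ?D")
      case True
      have "(\<Sum>k<?D. monom (A $$ (i, k)) (?D - Suc k)) = (\<Sum>k<?D. monom (coeff (?h i) (?D - Suc k)) (?D - Suc k))"
        using True i by (intro sum.cong refl) (simp add: entry)
      also have "\<dots> = ?h i"
        using poly_as_sum_lessThan[OF deg_h[OF True]] ..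
      finally have 1: "(\<Sum>k<?D. monom (A $$ (i, k)) (?D - Suc k)) = ?h i" .
      have "(\<Sum>k<?D. monom (A $$ (i, ?D + k)) (?D - Suc k)) = (\<Sum>k<?D. 0)"
        using True i by (intro sum.cong refl) (simp add: entry)
      then have 2: "(\<Sum>k<?D. monom (A $$ (i, ?D + k)) (?D - Suc k)) = 0"
        by simp
      show ?thesis
        unfolding 1 2 using True hsub_syl[OF True assms(1)] by (simp add: syl_rows_def)
    next
      case False
      define j where "j = i - ?D"
      have j: "j < ?D" "i = ?D + j"
        using False i by (auto simp: j_def)
      have "(\<Sum>k<?D. monom (A $$ (i, ?D + k)) (?D - Suc k)) = (\<Sum>k<?D. monom (coeff (?h j) (?D - Suc k)) (?D - Suc k))"
        using False i by (intro sum.cong refl) (simp add: entry j_def)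
      also have "\<dots> = ?h j"
        using poly_as_sum_lessThan[OF deg_h[OF j(1)]] ..
      finally have 1: "(\<Sum>k<?D. monom (A $$ (i, ?D + k)) (?D - Suc k)) = ?h j" .
      have "(\<Sum>k<?D. monom (A $$ (i, k)) (?D - Suc k)) = (\<Sum>k<?D. 0)"
        using False i by (intro sum.cong refl) (simp add: entry)
      then have 2: "(\<Sum>k<?D. monom (A $$ (i, k)) (?D - Suc k)) = 0"
        by simp
      have 3: "syl_rows ?D P Q i = monom 1 (d - j) * Q"
        unfolding syl_rows_def j by simp
      show ?thesis
        unfolding 1 2 3 hsub_syl[OF j(1) assms(2)] by simp
    qed
    finally show ?thesis .
  qed
  have "A * poly_rows (2 * ?D) (syl_rows ?D ?P ?Q) =
      poly_rows (2 * ?D) (\<lambda>i. hsub (2 * d + 1) a b c e (syl_rows ?D P Q i))"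
    unfolding mult_poly_rows[OF A] using row by (rule poly_rows_cong)
  also have "\<dots> = poly_rows (2 * ?D) (syl_rows ?D P Q) *
      poly_rows (2 * ?D) (\<lambda>k. [:b, a:] ^ (2 * d + 1 - k) * [:e, c:] ^ k)"
    using poly_rows_hsub[of "2 * d + 1" "syl_rows ?D P Q" b a e c] by simp
  finally have "det (A * poly_rows (2 * ?D) (syl_rows ?D ?P ?Q)) =
      det (poly_rows (2 * ?D) (syl_rows ?D P Q) *
      poly_rows (2 * ?D) (\<lambda>k. [:b, a:] ^ (2 * d + 1 - k) * [:e, c:] ^ k))"
    by (rule arg_cong)
  then have "det A * det (poly_rows (2 * ?D) (syl_rows ?D ?P ?Q)) =
      det (poly_rows (2 * ?D) (syl_rows ?D P Q)) *
      det (poly_rows (2 * ?D) (\<lambda>k. [:b, a:] ^ (2 * d + 1 - k) * [:e, c:] ^ k))"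
    by (simp only: det_mult[OF A poly_rows_carrier] det_mult[OF poly_rows_carrier poly_rows_carrier])
  moreover have "det A = subst_det d a b c e ^ 2"
    unfolding A_def using det_four_block_mat_lower_left_zero[OF N _ refl N, of "0\<^sub>m ?D ?D"]
    by (simp add: subst_det_def N_def power2_eq_square)
  moreover have "subst_det (2 * d + 1) a b c e =
      det (poly_rows (2 * ?D) (\<lambda>k. [:b, a:] ^ (2 * d + 1 - k) * [:e, c:] ^ k))"
    by (simp add: subst_det_def)
  ultimately show ?thesis
    unfolding resultant_sub_eq_det[OF assms] resultant_sub_eq_det[OF degree_hsub degree_hsub] by simp
qed

text \<open>The exponent is the triangular number of 2 k + 1 minus twice that of k, where d = k + 1:
  (2 k + 1) (k + 1) - k (k + 1) = d^2.\<close>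

lemma resultant_sub_hsub_eq:
  fixes P Q :: "'a::field poly"
  assumes "d > 0" and deg: "degree P \<le> d" "degree Q \<le> d" and nz: "a * e - b * c \<noteq> 0"
  shows "\<exists>s\<in>{1, -1}. resultant_sub d d (hsub d a b c e P) (hsub d a b c e Q) =
    s * (a * e - b * c) ^ (d * d) * resultant_sub d d P Q"
proof -
  obtain k where d: "d = Suc k"
    using assms(1) gr0_implies_Suc by blast
  let ?\<Delta> = "a * e - b * c"
  let ?g = "\<lambda>m. \<Sum>i<Suc m. i :: nat"
  have gauss: "2 * ?g m = m * (m + 1)" for m
    by (induction m) simp_all
  obtain s where s: "s \<in> {1, -1}" "subst_det (2 * k + 1) a b c e = s * ?\<Delta> ^ ?g (2 * k + 1)"
    using subst_det_eq by blast
  obtain s' where s': "s' \<in> {1, -1}" "subst_det k a b c e = s' * ?\<Delta> ^ ?g k"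
    using subst_det_eq by blast
  have "?g (2 * k + 1) = 2 * ?g k + d * d"
    using gauss[of "2 * k + 1"] gauss[of k] by (simp add: d algebra_simps del: sum.lessThan_Suc)
  then have pow: "?\<Delta> ^ ?g (2 * k + 1) = (?\<Delta> ^ ?g k)\<^sup>2 * ?\<Delta> ^ (d * d)"
    by (simp only: power_add power_mult[symmetric] mult.commute[of _ 2])
  have "s'\<^sup>2 = 1"
    using s'(1) by auto
  have "resultant_sub d d P Q * subst_det (2 * k + 1) a b c e =
      subst_det k a b c e ^ 2 * resultant_sub d d (hsub d a b c e P) (hsub d a b c e Q)"
    using resultant_sub_hsub[of P k Q a b c e] deg by (simp add: d)
  then have "resultant_sub d d P Q * (s * ((?\<Delta> ^ ?g k)\<^sup>2 * ?\<Delta> ^ (d * d))) =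
      (?\<Delta> ^ ?g k)\<^sup>2 * resultant_sub d d (hsub d a b c e P) (hsub d a b c e Q)"
    unfolding s(2) s'(2) pow power_mult_distrib \<open>s'\<^sup>2 = 1\<close> mult_1 .
  then have "(?\<Delta> ^ ?g k)\<^sup>2 * (s * ?\<Delta> ^ (d * d) * resultant_sub d d P Q) =
      (?\<Delta> ^ ?g k)\<^sup>2 * resultant_sub d d (hsub d a b c e P) (hsub d a b c e Q)"
    by (simp only: ac_simps)
  then have "s * ?\<Delta> ^ (d * d) * resultant_sub d d P Q = resultant_sub d d (hsub d a b c e P) (hsub d a b c e Q)"
    using nz by (simp only: mult_cancel_left power_eq_0_iff) simp
  then show ?thesis
    using s(1) by metis
qed

section \<open>Resultants with a monomial\<close>

lemma resultant_sub_monom_Suc: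
  "resultant_sub (Suc m) n (monom 1 (Suc i)) G = coeff G 0 * resultant_sub m n (monom 1 i) G"
proof -
  let ?S = "sylvester_mat_sub (Suc m) n (monom 1 (Suc i)) G"
  have S: "?S \<in> carrier_mat (Suc (m + n)) (Suc (m + n))"
    using sylvester_mat_sub_carrier[of "Suc m" n "monom 1 (Suc i)" G] by simp
  have entry: "?S $$ (r, m + n) = (if r = m + n then coeff G 0 else 0)" if "r < Suc (m + n)" for r
    using that by (auto simp: sylvester_mat_sub_index)
  have "det ?S = (\<Sum>r<Suc (m + n). ?S $$ (r, m + n) * cofactor ?S r (m + n))"
    using S by (rule laplace_expansion_column) simp
  also have "\<dots> = (\<Sum>r<Suc (m + n). if r = m + n then coeff G 0 * cofactor ?S (m + n) (m + n) else 0)"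
    by (intro sum.cong refl) (auto simp: entry)
  also have "\<dots> = coeff G 0 * cofactor ?S (m + n) (m + n)"
    by simp
  also have "cofactor ?S (m + n) (m + n) = det (mat_delete ?S (m + n) (m + n))"
    by (simp add: cofactor_def)
  also have "mat_delete ?S (m + n) (m + n) = sylvester_mat_sub m n (monom 1 i) G"
    by (rule eq_matI) (auto simp: mat_delete_def sylvester_mat_sub_index)
  finally show ?thesis
    by (simp add: resultant_sub_def)
qed

lemma resultant_sub_Suc_one:
  "resultant_sub (Suc m) n 1 G = (- 1) ^ n * coeff G n * resultant_sub m n 1 G"
proof -
  let ?S = "sylvester_mat_sub (Suc m) n 1 G"
  have S: "?S \<in> carrier_mat (Suc (m + n)) (Suc (m + n))"
    using sylvester_mat_sub_carrier[of "Suc m" n 1 G] by simp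
  have entry: "?S $$ (r, 0) = (if r = n then coeff G n else 0)" if "r < Suc (m + n)" for r
    using that by (auto simp: sylvester_mat_sub_index)
  have "det ?S = (\<Sum>r<Suc (m + n). ?S $$ (r, 0) * cofactor ?S r 0)"
    using S by (rule laplace_expansion_column) simp
  also have "\<dots> = (\<Sum>r<Suc (m + n). if r = n then coeff G n * cofactor ?S n 0 else 0)"
    by (intro sum.cong refl) (auto simp: entry)
  also have "\<dots> = coeff G n * cofactor ?S n 0"
    by simp
  also have "cofactor ?S n 0 = (- 1) ^ n * det (mat_delete ?S n 0)"
    by (simp add: cofactor_def)
  also have "mat_delete ?S n 0 = sylvester_mat_sub m n 1 G"
    by (rule eq_matI) (auto simp: mat_delete_def sylvester_mat_sub_index)
  finally show ?thesis
    by (simp add: resultant_sub_def)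
qed

text \<open>The form X^i Y^(m-i) vanishes to order \<open>i\<close> at 0 and to order
  \<open>m - i\<close> at infinity, where the other form takes the values \<open>coeff G 0\<close>
  and \<open>coeff G n\<close>. A factor X is removed by expanding along the last column of the
  Sylvester matrix, a factor Y along the first.\<close>

lemma resultant_sub_monom:
  fixes G :: "'a::comm_ring_1 poly"
  assumes "i \<le> m"
  shows "\<exists>s\<in>{1, -1}. resultant_sub m n (monom 1 i) G = s * coeff G 0 ^ i * coeff G n ^ (m - i)"
  using assms
proof (induction m arbitrary: i)
  case 0
  have "sylvester_mat_sub 0 n 1 G = 1\<^sub>m n"
    by (rule eq_matI) (auto simp: sylvester_mat_sub_index)
  then show ?case
    using 0 by (simp add: resultant_sub_def)
next
  case (Suc m)
  show ?case
  proof (cases i)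
    case 0
    obtain s where "s \<in> {1, -1}" "resultant_sub m n (monom 1 0) G = s * coeff G 0 ^ 0 * coeff G n ^ (m - 0)"
      using Suc.IH[of 0] by blast
    then show ?thesis
      using 0 by (intro bexI[of _ "(- 1) ^ n * s"])
        (auto simp: resultant_sub_Suc_one ac_simps minus_one_power_iff)
  next
    case (Suc k)
    then have "k \<le> m"
      using Suc.prems by simp
    from Suc.IH[OF this]
    obtain s where "s \<in> {1, -1}" "resultant_sub m n (monom 1 k) G = s * coeff G 0 ^ k * coeff G n ^ (m - k)"
      by blast
    then show ?thesis
      using Suc by (intro bexI[of _ s]) (auto simp: resultant_sub_monom_Suc ac_simps)
  qed
qed

section \<open>The resultant as a polynomial in one coefficient\<close>

lemma polyfun_if: "polyfun V f \<Longrightarrow> polyfun V g \<Longrightarrow> polyfun V (\<lambda>x. if C then f x else g x)"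
  by (cases C) simp_all

lemma polyfun_det:
  assumes "\<And>x. M x \<in> carrier_mat n n" and "\<And>i j. i < n \<Longrightarrow> j < n \<Longrightarrow> polyfun V (\<lambda>x. M x $$ (i, j))"
  shows "polyfun V (\<lambda>x. det (M x))"
  unfolding det_def'[OF assms(1)]
  by (intro polyfun_sum polyfun_mult polyfun_const polyfun_prod assms(2)) (auto dest: permutes_in_image)

lemma polyfun_subst: "polyfun V g \<Longrightarrow> polyfun (V - {j}) (\<lambda>x. g (x(j := c)))"
proof (induction rule: polyfun.induct)
  case (polyfun_var i)
  then show ?case
    by (cases "i = j") (auto intro: polyfun.intros)
qed (auto intro: polyfun.intros)

lemma polyfun_coeff_mult:
  assumes "\<And>k. polyfun V (\<lambda>x. coeff (f x) k)" and "\<And>k. polyfun V (\<lambda>x. coeff (g x) k)"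
  shows "polyfun V (\<lambda>x. coeff (f x * g x) k)"
  unfolding coeff_mult by (intro polyfun_sum polyfun_mult assms)

lemma polyfun_coeff_prod:
  assumes "\<And>a k. a \<in> A \<Longrightarrow> polyfun V (\<lambda>x. coeff (f a x) k)"
  shows "polyfun V (\<lambda>x. coeff (\<Prod>a\<in>A. f a x) k)"
  using assms
proof (induction A arbitrary: k rule: infinite_finite_induct)
  case (insert a A)
  then show ?case
    by (simp add: polyfun_coeff_mult)
qed (simp_all add: polyfun_const)

lemma polyfun_coeff_det:
  assumes "\<And>x. M x \<in> carrier_mat n n"
    and "\<And>i j k. i < n \<Longrightarrow> j < n \<Longrightarrow> polyfun V (\<lambda>x. coeff (M x $$ (i, j)) k)"
  shows "polyfun V (\<lambda>x. coeff (det (M x)) k)"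
  unfolding det_def'[OF assms(1)] coeff_sum
  by (intro polyfun_sum polyfun_coeff_mult polyfun_const polyfun_coeff_prod assms(2)) (auto dest: permutes_in_image)

lemma coeff_mult_top:
  fixes p q :: "'a::comm_ring_1 poly"
  assumes "degree p \<le> a" and "degree q \<le> b"
  shows "coeff (p * q) (a + b) = coeff p a * coeff q b"
proof -
  have "coeff (p * q) (a + b) = (\<Sum>i\<le>a + b. if i = a then coeff p a * coeff q b else 0)"
    unfolding coeff_mult
  proof (intro sum.cong refl)
    fix i assume "i \<in> {..a + b}"
    show "coeff p i * coeff q (a + b - i) = (if i = a then coeff p a * coeff q b else 0)"
      using assms coeff_eq_0[of p i] coeff_eq_0[of q "a + b - i"] by (cases i a rule: linorder_cases) auto
  qed
  then show ?thesis
    by simp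
qed

lemma coeff_prod_top:
  fixes f :: "'b \<Rightarrow> 'a::comm_ring_1 poly"
  assumes "finite A" and "\<And>i. i \<in> A \<Longrightarrow> degree (f i) \<le> b i"
  shows "degree (prod f A) \<le> sum b A" and "coeff (prod f A) (sum b A) = (\<Prod>i\<in>A. coeff (f i) (b i))"
proof -
  have "degree (prod f A) \<le> sum b A \<and> coeff (prod f A) (sum b A) = (\<Prod>i\<in>A. coeff (f i) (b i))"
    using assms
  proof (induction A rule: finite_induct)
    case (insert i A)
    then have "degree (f i) \<le> b i" "degree (prod f A) \<le> sum b A"
      by auto
    moreover from this have "degree (f i * prod f A) \<le> b i + sum b A"
      by (intro order_trans[OF degree_mult_le] add_mono)
    ultimately show ?case
      using insert by (auto simp: coeff_mult_top)
  qed simp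
  then show "degree (prod f A) \<le> sum b A" "coeff (prod f A) (sum b A) = (\<Prod>i\<in>A. coeff (f i) (b i))"
    by blast+
qed

text \<open>Row-wise degree bounds suffice, since each product in the Leibniz formula takes one
  entry from every row.\<close>

lemma det_poly_top:
  fixes M :: "'a::comm_ring_1 poly mat"
  assumes M: "M \<in> carrier_mat n n" and deg: "\<And>i j. i < n \<Longrightarrow> j < n \<Longrightarrow> degree (M $$ (i, j)) \<le> b i"
  shows "degree (det M) \<le> (\<Sum>i<n. b i)"
    and "coeff (det M) (\<Sum>i<n. b i) = det (mat n n (\<lambda>(i, j). coeff (M $$ (i, j)) (b i)))"
proof -
  let ?S = "{p. p permutes {0..<n}}"
  let ?g = "\<lambda>p. \<Prod>i<n. M $$ (i, p i)"
  have det: "det M = (\<Sum>p\<in>?S. signof p * ?g p)"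
    using det_def'[OF M] by (simp add: atLeast0LessThan)
  have sign: "signof p * q = smult (signof p) q" for p :: "nat \<Rightarrow> nat" and q :: "'a poly"
    by (simp add: sign_def)
  have perm: "p i < n" if "p \<in> ?S" "i < n" for p i
    using that by (auto dest: permutes_in_image)
  have g: "degree (?g p) \<le> (\<Sum>i<n. b i)" "coeff (?g p) (\<Sum>i<n. b i) = (\<Prod>i<n. coeff (M $$ (i, p i)) (b i))"
    if "p \<in> ?S" for p
    using coeff_prod_top[of "{..<n}" "\<lambda>i. M $$ (i, p i)" b] deg perm[OF that] by auto
  show "degree (det M) \<le> (\<Sum>i<n. b i)"
    unfolding det sign using g(1)
    by (intro degree_sum_le) (auto simp: finite_permutations intro!: order_trans[OF degree_smult_le])
  have "coeff (det M) (\<Sum>i<n. b i) = (\<Sum>p\<in>?S. signof p * (\<Prod>i<n. coeff (M $$ (i, p i)) (b i)))"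
    unfolding det sign coeff_sum using g(2) by (intro sum.cong) auto
  also have "\<dots> = det (mat n n (\<lambda>(i, j). coeff (M $$ (i, j)) (b i)))"
    using perm by (subst det_def'[of _ n]) (auto simp: atLeast0LessThan intro!: sum.cong prod.cong arg_cong[of _ _ "\<lambda>y. _ * y"])
  finally show "coeff (det M) (\<Sum>i<n. b i) = det (mat n n (\<lambda>(i, j). coeff (M $$ (i, j)) (b i)))" .
qed

text \<open>The roots are simple, so a cofactor \<open>W\<close> of the derivative vanishes at all
  \<open>d\<close> of them although its degree is below \<open>d\<close>. Giving the derivative the
  formal degree \<open>d\<close> as well contributes, up to sign, a factor \<open>coeff q d\<close>
  to the usual resultant.\<close>

lemma resultant_sub_pderiv_nonzero:
  fixes q :: "int poly"
  assumes d: "d > 0" and deg: "degree q \<le> d" and lead: "coeff q d \<noteq> 0"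
    and A: "finite A" "card A = d" "\<And>t. t \<in> A \<Longrightarrow> poly q t = 0"
  shows "resultant_sub d d q (pderiv q) \<noteq> 0"
proof
  have q0: "q \<noteq> 0" and degq: "degree q = d"
    using lead deg le_degree[of q d] by auto
  have simple: "poly (pderiv q) t \<noteq> 0" if t: "t \<in> A" for t
  proof
    assume deriv: "poly (pderiv q) t = 0"
    obtain r where r: "q = [:-t, 1:] * r"
      using A(3)[OF t] by (auto simp: poly_eq_0_iff_dvd)
    have "poly (pderiv q) t = poly r t"
      unfolding r pderiv_mult by (simp add: pderiv_pCons)
    then have "poly r t = 0"
      using deriv by simp
    then obtain s where s: "r = [:-t, 1:] * s"
      by (auto simp: poly_eq_0_iff_dvd)
    have s0: "s \<noteq> 0"
      using q0 r s by auto
    moreover have lin: "[:-t, 1:] \<noteq> 0" "degree [:-t, 1:] = 1"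
      by simp_all
    moreover have "r \<noteq> 0"
      using q0 r by auto
    ultimately have "degree q = 2 + degree s"
      unfolding r using degree_mult_eq[OF lin(1) \<open>r \<noteq> 0\<close>] degree_mult_eq[OF lin(1) s0] by (simp only: s lin(2))
    have "A - {t} \<subseteq> {y. poly s y = 0}"
    proof
      fix y assume y: "y \<in> A - {t}"
      then have "poly q y = 0"
        using A(3) by blast
      then show "y \<in> {y. poly s y = 0}"
        using y by (simp add: r s)
    qed
    then have "card (A - {t}) \<le> card {y. poly s y = 0}"
      by (rule card_mono[OF poly_roots_finite[OF s0]])
    also have "\<dots> \<le> degree s"
      by (rule card_poly_roots_bound[OF s0])
    finally have "card (A - {t}) \<le> degree s" .
    then show False
      using A(1,2) t \<open>degree q = 2 + degree s\<close> degq by simp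
  qed
  assume "resultant_sub d d q (pderiv q) = 0"
  moreover have "degree (pderiv q) \<le> d"
    using deg by (simp add: degree_pderiv)
  ultimately obtain U W where UW: "U \<noteq> 0 \<or> W \<noteq> 0" "degree U < d" "degree W < d" "U * q + W * pderiv q = 0"
    using resultant_sub_eq_0_iff[OF d deg] by blast
  have "poly W t = 0" if "t \<in> A" for t
    using arg_cong[OF UW(4), of "\<lambda>p. poly p t"] simple[OF that] A(3)[OF that] by simp
  then have "A \<subseteq> {t. poly W t = 0}"
    by blast
  have "W = 0"
  proof (rule ccontr)
    assume "W \<noteq> 0"
    then have "card A \<le> card {t. poly W t = 0}"
      using \<open>A \<subseteq> {t. poly W t = 0}\<close> by (intro card_mono poly_roots_finite)
    also have "\<dots> \<le> degree W"
      by (rule card_poly_roots_bound[OF \<open>W \<noteq> 0\<close>])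
    finally show False
      using A(2) UW(3) by simp
  qed
  then show False
    using UW(1,4) q0 by simp
qed

text \<open>
  The offset \<open>b\<close> selects a block of coordinates: \<open>b = 0\<close> gives the numerator and \<open>b = d + 1\<close> the
  denominator. In \<open>generic_form\<close> the coordinate \<open>n\<close> is an indeterminate.
\<close>

definition form_poly :: "nat \<Rightarrow> nat \<Rightarrow> (nat \<Rightarrow> int) \<Rightarrow> int poly" where
  "form_poly d b x = (\<Sum>i\<le>d. monom (x (b + i)) i)"

lemma coeff_form_poly: "coeff (form_poly d b x) i = (if i \<le> d then x (b + i) else 0)"
  by (auto simp: form_poly_def coeff_sum if_distrib cong: if_cong)

lemma degree_form_poly: "degree (form_poly d b x) \<le> d"
  by (intro degree_le) (simp add: coeff_form_poly)

definition generic_form :: "nat \<Rightarrow> nat \<Rightarrow> nat \<Rightarrow> (nat \<Rightarrow> int) \<Rightarrow> int poly poly" where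
  "generic_form d b n x = (\<Sum>i\<le>d. monom (if b + i = n then [:0, 1:] else [:x (b + i):]) i)"

lemma coeff_generic_form:
  "coeff (generic_form d b n x) i = (if i \<le> d then if b + i = n then [:0, 1:] else [:x (b + i):] else 0)"
  unfolding generic_form_def coeff_sum coeff_monom by simp

text \<open>The offsets are parameters, so that the form containing the coordinate \<open>n\<close>
  can always be put first.\<close>

definition fiber_resultant :: "nat \<Rightarrow> nat \<Rightarrow> nat \<Rightarrow> nat \<Rightarrow> (nat \<Rightarrow> int) \<Rightarrow> int poly" where
  "fiber_resultant d b b' n x = resultant_sub d d (generic_form d b n x) (generic_form d b' n x)"

lemma poly_fiber_resultant:
  "poly (fiber_resultant d b b' n x) t =
    resultant_sub d d (form_poly d b (x(n := t))) (form_poly d b' (x(n := t)))"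
proof -
  have hom: "comm_ring_hom (\<lambda>p :: int poly. poly p t)"
    by unfold_locales auto
  have map: "map_poly (\<lambda>p. poly p t) (generic_form d b n x) = form_poly d b (x(n := t))" for b
    by (rule poly_eqI) (simp add: coeff_map_poly coeff_generic_form coeff_form_poly)
  show ?thesis
    unfolding fiber_resultant_def resultant_sub_def comm_ring_hom.hom_det[OF hom, symmetric]
    by (subst sylvester_mat_sub_map) (simp_all add: map)
qed

text \<open>The indeterminate occurs only in the first form, hence in only \<open>d\<close> rows and
  linearly in each. Extracting the linear coefficients of these rows replaces the first form by the
  monomial at the position of \<open>n\<close>.\<close>

lemma fiber_resultant_top:
  assumes n: "n = b + i" "i \<le> d" and disj: "\<And>k. k \<le> d \<Longrightarrow> b' + k \<noteq> n"
  shows "degree (fiber_resultant d b b' n x) \<le> d"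
    and "coeff (fiber_resultant d b b' n x) d = resultant_sub d d (monom 1 i) (form_poly d b' x)"
proof -
  let ?M = "sylvester_mat_sub d d (generic_form d b n x) (generic_form d b' n x)"
  have other: "coeff (generic_form d b' n x) k = [:coeff (form_poly d b' x) k:]" for k
    using disj by (auto simp: coeff_generic_form coeff_form_poly)
  define e where "e r = (if r < d then 1 else 0 :: nat)" for r
  have deg: "degree (?M $$ (r, j)) \<le> e r" if "r < d + d" "j < d + d" for r j
    using that by (auto simp: sylvester_mat_sub_index coeff_generic_form[of d b] other e_def)
  have e: "(\<Sum>r<d + d. e r) = d"
    unfolding sum_lessThan_add by (simp add: e_def)
  have mat: "mat (d + d) (d + d) (\<lambda>(r, j). coeff (?M $$ (r, j)) (e r)) =
      sylvester_mat_sub d d (monom 1 i) (form_poly d b' x)"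
    using n by (intro eq_matI) (auto simp: sylvester_mat_sub_index coeff_generic_form[of d b] other[unfolded n(1)] e_def)
  show "degree (fiber_resultant d b b' n x) \<le> d"
    using det_poly_top(1)[of ?M "d + d" e, OF sylvester_mat_sub_carrier deg] unfolding e by (simp add: fiber_resultant_def resultant_sub_def)
  show "coeff (fiber_resultant d b b' n x) d = resultant_sub d d (monom 1 i) (form_poly d b' x)"
    using det_poly_top(2)[of ?M "d + d" e, OF sylvester_mat_sub_carrier deg] unfolding e mat
    by (simp add: fiber_resultant_def resultant_sub_def)
qed

lemma polyfun_coeff_fiber_resultant:
  assumes "\<And>k. k \<le> d \<Longrightarrow> b + k \<in> insert n V" and "\<And>k. k \<le> d \<Longrightarrow> b' + k \<in> insert n V"
  shows "polyfun V (\<lambda>x. coeff (fiber_resultant d b b' n x) k)"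
  unfolding fiber_resultant_def resultant_sub_def
proof (rule polyfun_coeff_det[of _ "d + d"])
  fix r j k assume rj: "r < d + d" "j < d + d"
  have lin: "polyfun V (\<lambda>x. coeff [:x i:] k)" if "i \<in> V" for i k
    using that by (cases k) (auto intro: polyfun.intros)
  have form: "polyfun V (\<lambda>x. coeff (coeff (generic_form d c n x) i) k)"
    if "\<And>k. k \<le> d \<Longrightarrow> c + k \<in> insert n V" for c i k
    using that[of i] lin[of "c + i"]
    by (cases "i \<le> d"; cases "c + i = n") (auto simp: coeff_generic_form intro: polyfun_const)
  show "polyfun V (\<lambda>x. coeff (sylvester_mat_sub d d (generic_form d b n x) (generic_form d b' n x) $$ (r, j)) k)"
    unfolding sylvester_mat_sub_index[OF rj] if_distrib[of "\<lambda>p. coeff p k"] coeff_0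
    by (intro polyfun_if polyfun_const form[OF assms(1)] form[OF assms(2)])
qed (rule sylvester_mat_sub_carrier)


text \<open>
  The leading coefficient of the fiber resultant is, up to sign, a monomial in the two extreme
  coefficients of the other form. If a prime divides the whole fiber resultant, it therefore divides
  one of these, and also the constant term with that coefficient removed: a condition of codimension two.
\<close>

lemma resultant_tail:
  assumes d: "d \<ge> 2" and b: "(b, b') = (0, d + 1) \<or> (b, b') = (d + 1, 0)" and n: "n = b + i" "i \<le> d"
  defines "V \<equiv> {..<2 * d + 2} - {n}"
  shows "\<exists>K. \<forall>z R. z \<ge> 2 \<longrightarrow> (\<forall>i\<in>V. R i \<ge> z) \<longrightarrow> eventually (\<lambda>T.
    real (card {x\<in>int_box (insert n V) (R(n := T)). \<exists>p. prime p \<and> z < p \<and>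
      int p ^ d dvd poly (fiber_resultant d b b' n x) (x n)})
      \<le> real K / real z * real (card (int_box (insert n V) (R(n := T))))) at_top"
proof -
  let ?q = "fiber_resultant d b b' n"
  have disj: "b' + k \<noteq> n" if "k \<le> d" for k
    using that b n by auto
  have mem: "b + k \<in> insert n V" "b' + k \<in> insert n V" if "k \<le> d" for k
    using that b by (auto simp: V_def)
  have memV: "b' + k \<in> V" if "k \<le> d" for k
    using mem(2)[OF that] disj[OF that] by simp
  have top: "degree (?q x) \<le> d" "coeff (?q x) d = resultant_sub d d (monom 1 i) (form_poly d b' x)" for x
    using fiber_resultant_top[OF n disj] by auto
  have coeffs: "polyfun V (\<lambda>x. coeff (?q x) k)" for k
    using mem by (rule polyfun_coeff_fiber_resultant)
  have lead: "\<exists>s\<in>{1, -1}. coeff (?q x) d = s * x b' ^ i * x (b' + d) ^ (d - i)" for x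
    using resultant_sub_monom[OF n(2), of d "form_poly d b' x"] by (simp add: top(2) coeff_form_poly)
  define D where "D x = resultant_sub d d (?q x) (pderiv (?q x))" for x
  have D: "polyfun V D"
    unfolding D_def resultant_sub_def
  proof (rule polyfun_det[of _ "d + d"])
    fix r j assume rj: "r < d + d" "j < d + d"
    have deriv: "polyfun V (\<lambda>x. coeff (pderiv (?q x)) k)" for k
      unfolding coeff_pderiv by (intro polyfun_mult polyfun_const coeffs)
    show "polyfun V (\<lambda>x. sylvester_mat_sub d d (?q x) (pderiv (?q x)) $$ (r, j))"
      unfolding sylvester_mat_sub_index[OF rj] by (intro polyfun_if polyfun_const coeffs deriv)
  qed (rule sylvester_mat_sub_carrier)
  have Dvd: "int p dvd D x" if "int p dvd poly (?q x) t" "int p dvd poly (pderiv (?q x)) t" for x t p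
    unfolding D_def
  proof (rule resultant_sub_dvd[OF _ _ _ that])
    show "degree (pderiv (?q x)) \<le> d"
      using top(1)[of x] by (simp add: degree_pderiv)
  qed (use d top in auto)
  \<comment> \<open>Witness for a nonzero discriminant: the other form is the product of z - j over
    1 <= j <= d, and the form containing \<open>n\<close> is z + t for i = 0 and t z^i + (d!)^i
    otherwise. At \<open>t = \<tau> j\<close> both vanish at \<open>j\<close>, so the fiber
    resultant has \<open>d\<close> distinct roots; the factorial keeps them integral.\<close>
  define \<tau> :: "nat \<Rightarrow> int" where "\<tau> j = (if i = 0 then - int j else - (int (fact d div j) ^ i))" for j
  define G :: "int poly" where "G = (\<Prod>j\<in>{1..d}. [:- int j, 1:])"
  have G: "degree G \<le> d" "coeff G d = 1"
    using coeff_prod_top[of "{1..d}" "\<lambda>j. [:- int j, 1:]" "\<lambda>j. 1"] by (simp_all add: G_def)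
  have G0: "coeff G 0 \<noteq> 0"
    by (simp add: G_def poly_0_coeff_0[symmetric] poly_prod)
  define y :: "nat \<Rightarrow> int" where "y k = (if k < b' \<or> k > b' + d then
      if i = 0 then of_bool (k = b + 1) else of_bool (k = b) * int (fact d) ^ i else coeff G (k - b'))" for k
  have formG: "form_poly d b' (y(n := t)) = G" for t
  proof (rule poly_eqI)
    show "coeff (form_poly d b' (y(n := t))) k = coeff G k" for k
      using disj[of k] G(1) by (auto simp: coeff_form_poly y_def coeff_eq_0)
  qed
  have formF: "form_poly d b (y(n := t)) = monom t i + (if i = 0 then monom 1 1 else monom (int (fact d) ^ i) 0)" for t
  proof (rule poly_eqI)
    fix k
    have out: "b + k < b' \<or> b + k > b' + d" if "k \<le> d"
      using that b by auto
    show "coeff (form_poly d b (y(n := t))) k =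
        coeff (monom t i + (if i = 0 then monom 1 1 else monom (int (fact d) ^ i) 0)) k"
      using out n d by (auto simp: coeff_form_poly y_def)
  qed
  have "D y \<noteq> 0"
    unfolding D_def
  proof (rule resultant_sub_pderiv_nonzero[OF _ top(1), where A = "\<tau> ` {1..d}"])
    obtain s where "s \<in> {1, -1}" "coeff (?q y) d = s * y b' ^ i * y (b' + d) ^ (d - i)"
      using lead by blast
    moreover have "y b' = coeff G 0" "y (b' + d) = 1"
      using G by (simp_all add: y_def)
    ultimately show "coeff (?q y) d \<noteq> 0"
      using G0 by auto
    have "inj_on \<tau> {1..d}"
    proof (rule inj_onI)
      fix j k assume jk: "j \<in> {1..d}" "k \<in> {1..d}" "\<tau> j = \<tau> k"
      show "j = k"
      proof (cases "i = 0")
        case False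
        then have "fact d div j = (fact d div k :: nat)"
          using jk(3) by (simp add: \<tau>_def power_eq_iff_eq_base flip: of_nat_power)
        moreover have "j dvd fact d" "k dvd fact d"
          using jk(1,2) by (auto intro: dvd_fact)
        ultimately show ?thesis
          by (metis dvd_div_eq_cancel dvd_div_mult_self fact_nonzero mult_cancel_left mult_eq_0_iff)
      qed (use jk in \<open>simp add: \<tau>_def\<close>)
    qed
    then show "card (\<tau> ` {1..d}) = d"
      by (simp add: card_image)
    fix t assume "t \<in> \<tau> ` {1..d}"
    then obtain j where j: "j \<in> {1..d}" "t = \<tau> j"
      by blast
    have "poly G (int j) = 0"
      using j(1) by (auto simp: G_def poly_prod)
    moreover have "poly (form_poly d b (y(n := t))) (int j) = 0"
    proof (cases "i = 0")
      case True
      then show ?thesis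
        unfolding formF by (simp add: j(2) \<tau>_def poly_monom)
    next
      case False
      have "j dvd fact d"
        using j(1) by (auto intro: dvd_fact)
      then have "int (fact d div j) * int j = int (fact d)"
        by (metis dvd_div_mult_self of_nat_mult)
      then have "int (fact d div j) ^ i * int j ^ i = int (fact d) ^ i"
        by (metis power_mult_distrib)
      then show ?thesis
        unfolding formF using False by (simp add: j(2) \<tau>_def poly_monom)
    qed
    \<comment> \<open>Divisibility by 0 is vanishing, so the divisibility lemma covers common
      roots.\<close>
    ultimately have "0 dvd resultant_sub d d (form_poly d b (y(n := t))) (form_poly d b' (y(n := t)))"
      using d by (intro resultant_sub_dvd[where t = "int j", OF _ degree_form_poly degree_form_poly]) (simp_all add: formG)
    then show "poly (?q y) t = 0"
      by (simp add: poly_fiber_resultant)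
  qed (use d in auto)
  \<comment> \<open>The extreme coefficients that occur in the leading coefficient with positive
    exponent. \<open>E\<close> is the constant coefficient with the coordinate \<open>j\<close>
    deleted; modulo a prime dividing \<open>x j\<close> it agrees with the constant coefficient
    itself.\<close>
  define J where "J = {j. j = b' \<and> i \<noteq> 0 \<or> j = b' + d \<and> i \<noteq> d}"
  define E where "E j x = coeff (?q (x(j := 0))) 0" for j x
  show ?thesis
  proof (rule sieve_tail[where D = D and J = J and E = E])
    show "J \<subseteq> V"
      using memV[of 0] memV[of d] by (auto simp: J_def)
    show "polyfun (V - {j}) (E j)" for j
      unfolding E_def by (rule polyfun_subst[OF coeffs])
    have E_at: "E j x = resultant_sub d d (form_poly d b x) (form_poly d b' x)" if "x n = 0" "x j = 0" for j x
    proof -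
      have "x(j := 0) = x" "x(n := 0) = x"
        using that by auto
      then show ?thesis
        unfolding E_def poly_0_coeff_0[symmetric] poly_fiber_resultant by simp
    qed
    have bd: "b + d < b' \<or> b' + d < b"
      using b by auto
    show "\<exists>x. E j x \<noteq> 0" if "j \<in> J" for j
    proof (cases "j = b' \<and> i \<noteq> 0")
      case True
      \<comment> \<open>The pair 1 and z^d (in the other case, z^d and 1) has resultant \<plusminus>
        1, and its nonzero coordinates avoid both \<open>n\<close> and \<open>j\<close>: here
        \<open>i\<close> is not 0, in the other case it is not \<open>d\<close>.\<close>
      define x :: "nat \<Rightarrow> int" where "x k = of_bool (k = b \<or> k = b' + d)" for k
      have "form_poly d b x = monom 1 0" "form_poly d b' x = monom 1 d"
        using bd d by (auto intro!: poly_eqI simp: coeff_form_poly x_def)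
      moreover have "\<exists>s\<in>{1, -1}. resultant_sub d d (monom 1 0) (monom 1 d) = (s :: int)"
        using resultant_sub_monom[of 0 d d "monom 1 d :: int poly"] by simp
      moreover have "x n = 0" "x j = 0"
        using True n bd d by (auto simp: x_def)
      ultimately have "E j x \<noteq> 0"
        using E_at by force
      then show ?thesis
        by blast
    next
      case False
      then have j: "j = b' + d" "i \<noteq> d"
        using that by (auto simp: J_def split: if_splits)
      define x :: "nat \<Rightarrow> int" where "x k = of_bool (k = b + d \<or> k = b')" for k
      have "form_poly d b x = monom 1 d" "form_poly d b' x = monom 1 0"
        using bd d by (auto intro!: poly_eqI simp: coeff_form_poly x_def)
      moreover have "\<exists>s\<in>{1, -1}. resultant_sub d d (monom 1 d) (monom 1 0) = (s :: int)"
        using resultant_sub_monom[of d d d "monom 1 0 :: int poly"] by simp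
      moreover have "x n = 0" "x j = 0"
        using j n bd d by (auto simp: x_def)
      ultimately have "E j x \<noteq> 0"
        using E_at by force
      then show ?thesis
        by blast
    qed
    fix x p assume p: "prime p" and all: "\<forall>k. int p dvd coeff (?q x) k"
    obtain s where s: "s \<in> {1, -1}" "coeff (?q x) d = s * x b' ^ i * x (b' + d) ^ (d - i)"
      using lead by blast
    have pint: "prime (int p)"
      using p by simp
    have "int p dvd x b' ^ i * x (b' + d) ^ (d - i)"
      using all s by (metis dvd_minus_iff insert_iff mult_1 mult_minus1 mult_minus_left singletonD)
    then have "int p dvd x b' ^ i \<or> int p dvd x (b' + d) ^ (d - i)"
      using pint by (simp add: prime_dvd_mult_iff)
    then have "int p dvd x b' \<and> i \<noteq> 0 \<or> int p dvd x (b' + d) \<and> i \<noteq> d"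
    proof
      assume dvd: "int p dvd x b' ^ i"
      then have "i \<noteq> 0"
        using pint by (cases "i = 0") auto
      then show ?thesis
        using prime_dvd_power[OF pint dvd] by blast
    next
      assume dvd: "int p dvd x (b' + d) ^ (d - i)"
      then have "i \<noteq> d"
        using pint by (cases "i = d") auto
      then show ?thesis
        using prime_dvd_power[OF pint dvd] by blast
    qed
    then obtain j where j: "j \<in> J" "int p dvd x j"
      by (auto simp: J_def)
    have "int p dvd coeff (?q x) 0 - E j x"
      unfolding E_def using j(2) by (intro polyfun_cong_mod[OF coeffs]) auto
    then have "int p dvd E j x"
      using all by (metis dvd_diff_right_iff)
    then show "\<exists>j\<in>J. int p dvd x j \<and> int p dvd E j x"
      using j by blast
  qed (use d top(1) coeffs D \<open>D y \<noteq> 0\<close> Dvd in \<open>auto simp: V_def\<close>)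
qed

section \<open>Conjugation of rational maps\<close>

text \<open>Coprime representatives differ by a unit of the polynomial ring, that is, by a
  constant.\<close>

lemma quot_of_fract_proportional:
  fixes P Q :: "rat poly"
  assumes cop: "coprime P Q" and Q: "Q \<noteq> 0" and quot: "quot_of_fract (Fract P Q) = (P0, Q0)"
  shows "\<exists>h. h \<noteq> 0 \<and> P = smult h P0 \<and> Q = smult h Q0"
proof -
  have cop0: "coprime P0 Q0" and Q0: "Q0 \<noteq> 0"
    using coprime_quot_of_fract[of "Fract P Q"] snd_quot_of_fract_nonzero[of "Fract P Q"] quot by simp_all
  have "Fract P0 Q0 = Fract P Q"
    using Fract_quot_of_fract[of "Fract P Q"] unfolding quot fst_conv snd_conv .
  then have eq: "P0 * Q = P * Q0"
    using Q Q0 by (simp add: eq_fract)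
  have "Q0 dvd P0 * Q"
    unfolding eq by simp
  then have "Q0 dvd Q"
    using cop0 by (simp add: coprime_commute coprime_dvd_mult_right_iff)
  then obtain l where l: "Q = Q0 * l" ..
  have "Q dvd P * Q0"
    unfolding eq[symmetric] by simp
  then have "Q dvd Q0"
    using cop by (simp add: coprime_commute coprime_dvd_mult_right_iff)
  then have "Q0 * l dvd Q0 * 1"
    using l by simp
  then have "l dvd 1"
    using Q0 by (simp only: dvd_mult_cancel_left) simp
  then have "l \<noteq> 0" "degree l = 0"
    by (auto simp: is_unit_iff_degree)
  then obtain h where h: "l = [:h:]" "h \<noteq> 0"
    by (metis degree_eq_zeroE pCons_0_0)
  have "P * Q0 = (P0 * l) * Q0"
    unfolding eq[symmetric] l by (simp only: ac_simps)
  then have "P = P0 * l"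
    using mult_right_cancel[OF Q0] by blast
  then show ?thesis
    using l h by (intro exI[of _ h]) simp
qed

text \<open>A common factor would leave cofactors of degree below \<open>d\<close>; if both formal
  leading coefficients vanished, \<open>Q\<close> and \<open>- P\<close> would be such
  cofactors.\<close>

lemma resultant_sub_nonzero_imp:
  fixes P Q :: "rat poly"
  assumes d: "d > 0" and deg: "degree P \<le> d" "degree Q \<le> d" and res: "resultant_sub d d P Q \<noteq> 0"
  shows "coprime P Q" and "coeff P d \<noteq> 0 \<or> coeff Q d \<noteq> 0" and "Q \<noteq> 0"
proof -
  have no_kernel: "U = 0 \<and> W = 0" if "degree U < d" "degree W < d" "U * P + W * Q = 0" for U W
    using res resultant_sub_eq_0_iff[OF d deg] that by blast
  show Q: "Q \<noteq> 0"
    using no_kernel[of 0 1] d by auto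
  show "coprime P Q"
  proof (rule coprimeI)
    fix H assume H: "H dvd P" "H dvd Q"
    then obtain P1 Q1 where PQ: "P = H * P1" "Q = H * Q1"
      by (auto elim!: dvdE)
    have H0: "H \<noteq> 0"
      using PQ Q by auto
    show "is_unit H"
    proof (rule ccontr)
      assume "\<not> is_unit H"
      then have "degree H > 0"
        using H0 by (simp add: is_unit_iff_degree)
      moreover have "degree P = degree H + degree P1" if "P1 \<noteq> 0"
        using PQ(1) H0 that by (simp add: degree_mult_eq)
      moreover have "degree Q = degree H + degree Q1" if "Q1 \<noteq> 0"
        using PQ(2) H0 that by (simp add: degree_mult_eq)
      ultimately have "degree Q1 < d" "degree (- P1) < d"
        using deg d by (cases "Q1 = 0"; cases "P1 = 0"; simp)+
      moreover have "Q1 * P + (- P1) * Q = 0"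
        by (simp add: PQ)
      ultimately have "Q1 = 0"
        using no_kernel by blast
      then show False
        using PQ Q by simp
    qed
  qed
  show "coeff P d \<noteq> 0 \<or> coeff Q d \<noteq> 0"
  proof (rule ccontr)
    assume "\<not> (coeff P d \<noteq> 0 \<or> coeff Q d \<noteq> 0)"
    then have "degree P \<noteq> d" "degree Q \<noteq> d"
      using d Q by (metis degree_0 leading_coeff_neq_0 less_irrefl)+
    then have "degree Q < d" "degree (- P) < d"
      using deg by auto
    then have "Q = 0"
      using no_kernel[of Q "- P"] by (simp add: mult.commute)
    then show False
      using Q by simp
  qed
qed

lemma rat_degree_Fract:
  fixes P Q :: "rat poly"
  assumes d: "d > 0" and deg: "degree P \<le> d" "degree Q \<le> d" and res: "resultant_sub d d P Q \<noteq> 0"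
  shows "rat_degree (Fract P Q) = d"
proof -
  note PQ = resultant_sub_nonzero_imp[OF assms]
  obtain P0 Q0 where quot: "quot_of_fract (Fract P Q) = (P0, Q0)"
    by (cases "quot_of_fract (Fract P Q)")
  then obtain h where h: "h \<noteq> 0" "P = smult h P0" "Q = smult h Q0"
    using quot_of_fract_proportional[OF PQ(1,3)] by blast
  then have "degree P = degree P0" "degree Q = degree Q0"
    by simp_all
  moreover have "degree P = d \<or> degree Q = d"
    using PQ(2) deg le_degree[of P d] le_degree[of Q d] by auto
  ultimately show ?thesis
    using deg quot by (auto simp: rat_degree_def)
qed

lemma is_coeff_vec_coeff_vec: "is_coeff_vec (rat_degree \<phi>) \<phi> (coeff_vec \<phi>)"
  unfolding coeff_vec_def using coeff_vec_unique_existence[OF refl] by (rule theI')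

lemma degree_num_den_poly:
  "degree (map_poly rat_of_int (num_poly d C)) \<le> d" "degree (map_poly rat_of_int (den_poly d C)) \<le> d"
  by (intro degree_le; simp add: coeff_map_poly coeff_num_poly coeff_den_poly)+

lemma of_int_form_resultant:
  "of_int (form_resultant d C) =
    resultant_sub d d (map_poly rat_of_int (num_poly d C)) (map_poly rat_of_int (den_poly d C))"
proof -
  have hom: "comm_ring_hom (of_int :: int \<Rightarrow> rat)"
    by unfold_locales auto
  show ?thesis
    unfolding form_resultant_def resultant_sub_def comm_ring_hom.hom_det[OF hom, symmetric]
    by (subst sylvester_mat_sub_map) simp_all
qed

text \<open>Passing to the primitive integral vector scales numerator and denominator by the same
  constant, so any representative of formal degree \<open>d\<close> gives the resultant up to a
  2d-th power.\<close>

lemma rat_resultant_Fract: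
  fixes P Q :: "rat poly"
  assumes d: "d > 0" and deg: "degree P \<le> d" "degree Q \<le> d" and res: "resultant_sub d d P Q \<noteq> 0"
  shows "\<exists>h. h \<noteq> 0 \<and> of_int (rat_resultant (Fract P Q)) = h ^ (2 * d) * resultant_sub d d P Q"
proof -
  let ?\<psi> = "Fract P Q"
  let ?C = "coeff_vec ?\<psi>"
  let ?F = "map_poly rat_of_int (num_poly d ?C)" and ?G = "map_poly rat_of_int (den_poly d ?C)"
  have rd: "rat_degree ?\<psi> = d"
    by (rule rat_degree_Fract[OF assms])
  have C: "is_coeff_vec d ?\<psi> ?C"
    using is_coeff_vec_coeff_vec[of ?\<psi>] by (simp add: rd)
  have G: "?G \<noteq> 0" and \<psi>: "?\<psi> = Fract ?F ?G"
    using C unfolding is_coeff_vec_def by simp_all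
  obtain P0 Q0 where quot: "quot_of_fract ?\<psi> = (P0, Q0)"
    by (cases "quot_of_fract ?\<psi>")
  obtain h1 where h1: "h1 \<noteq> 0" "?F = smult h1 P0" "?G = smult h1 Q0"
    using Fract_formal_degree[OF \<psi> G _ _ quot] degree_num_den_poly[of d ?C] unfolding rd by blast
  obtain h2 where h2: "h2 \<noteq> 0" "P = smult h2 P0" "Q = smult h2 Q0"
    using Fract_formal_degree[OF refl resultant_sub_nonzero_imp(3)[OF assms] _ _ quot] deg unfolding rd by blast
  have FG: "?F = smult (h1 / h2) P" "?G = smult (h1 / h2) Q"
    unfolding h1 using h2 by simp_all
  have "of_int (rat_resultant ?\<psi>) = resultant_sub d d ?F ?G"
    by (simp add: rat_resultant_def rd of_int_form_resultant)
  also have "\<dots> = (h1 / h2) ^ (2 * d) * resultant_sub d d P Q"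
    unfolding FG by (rule resultant_sub_smult[OF deg])
  finally show ?thesis
    using h1(1) h2(1) by (intro exI[of _ "h1 / h2"]) simp
qed

lemma to_fract_power: "to_fract (x ^ k) = to_fract x ^ k"
  by (induction k) simp_all

definition eval_ratfun :: "rat poly \<Rightarrow> ratfun \<Rightarrow> ratfun" where
  "eval_ratfun P \<psi> = poly (map_poly (\<lambda>c. to_fract [:c:]) P) \<psi>"

lemma eval_ratfun_altdef:
  assumes "degree P \<le> d"
  shows "eval_ratfun P \<psi> = (\<Sum>i\<le>d. to_fract [:coeff P i:] * \<psi> ^ i)"
proof -
  have "degree (map_poly (\<lambda>c. to_fract [:c:]) P) \<le> d"
    using degree_map_poly_le[of "\<lambda>c. to_fract [:c:]" P] assms by simp
  then have "eval_ratfun P \<psi> = (\<Sum>i\<le>d. coeff (map_poly (\<lambda>c. to_fract [:c:]) P) i * \<psi> ^ i)"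
    unfolding eval_ratfun_def poly_altdef by (intro sum.mono_neutral_left) (auto simp: coeff_eq_0)
  then show ?thesis
    by (simp add: coeff_map_poly)
qed

lemma eval_ratfun_smult: "eval_ratfun (smult h P) \<psi> = to_fract [:h:] * eval_ratfun P \<psi>"
proof -
  have "to_fract [:h * c:] = to_fract [:h:] * to_fract [:c:]" for c :: rat
    by (subst to_fract_mult[symmetric]) simp
  then show ?thesis
    unfolding eval_ratfun_altdef[OF degree_smult_le] eval_ratfun_altdef[OF order_refl]
    by (simp add: sum_distrib_left mult.assoc)
qed

lemma power_divide_mult_power:
  fixes x y :: "'a::field"
  assumes "y \<noteq> 0" and "i \<le> d"
  shows "(x / y) ^ i * y ^ d = x ^ i * y ^ (d - i)"
  using assms by (simp add: power_divide power_diff)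

lemma eval_ratfun_hsub:
  assumes "degree P \<le> d" and "[:e, c:] \<noteq> 0"
  shows "eval_ratfun P (moebius_map a b c e) = to_fract (hsub d a b c e P) / to_fract [:e, c:] ^ d"
proof -
  let ?L = "to_fract [:b, a:]" and ?M = "to_fract [:e, c:]"
  have M: "?M \<noteq> 0"
    using assms(2) by simp
  have \<psi>: "moebius_map a b c e = ?L / ?M"
    using assms(2) by (simp add: moebius_map_def Fract_conv_to_fract)
  have "eval_ratfun P (moebius_map a b c e) * ?M ^ d = (\<Sum>i\<le>d. to_fract [:coeff P i:] * (?L / ?M) ^ i * ?M ^ d)"
    unfolding eval_ratfun_altdef[OF assms(1)] \<psi> by (rule sum_distrib_right)
  also have "\<dots> = (\<Sum>i\<le>d. to_fract (smult (coeff P i) ([:b, a:] ^ i * [:e, c:] ^ (d - i))))"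
  proof (intro sum.cong refl)
    fix i assume "i \<in> {..d}"
    then have "(?L / ?M) ^ i * ?M ^ d = ?L ^ i * ?M ^ (d - i)"
      using M by (intro power_divide_mult_power) auto
    moreover have "smult (coeff P i) R = [:coeff P i:] * R" for R
      by simp
    ultimately show "to_fract [:coeff P i:] * (?L / ?M) ^ i * ?M ^ d =
        to_fract (smult (coeff P i) ([:b, a:] ^ i * [:e, c:] ^ (d - i)))"
      by (simp add: to_fract_power mult.assoc del: mult_pCons_left mult_pCons_right)
  qed
  also have "\<dots> = to_fract (hsub d a b c e P)"
    by (simp add: hsub_def to_fract_sum)
  finally show ?thesis
    using eq_divide_imp[OF power_not_zero[OF M]] by blast
qed

lemma rat_compose_Fract:
  assumes "coprime P Q" and "Q \<noteq> 0"
  shows "rat_compose (Fract P Q) \<psi> = eval_ratfun P \<psi> / eval_ratfun Q \<psi>"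
proof -
  obtain P0 Q0 where quot: "quot_of_fract (Fract P Q) = (P0, Q0)"
    by (cases "quot_of_fract (Fract P Q)")
  then obtain h where "h \<noteq> 0" "P = smult h P0" "Q = smult h Q0"
    using quot_of_fract_proportional[OF assms] by blast
  then show ?thesis
    unfolding rat_compose_def quot prod.case eval_ratfun_def[symmetric] by (simp add: eval_ratfun_smult)
qed

text \<open>In the exponent, d^2 comes from substituting into both forms and d from the combination
  with the adjugate, whose determinant is again \<open>a * e - b * c\<close>.\<close>

lemma moebius_conj_Fract:
  fixes P Q :: "rat poly"
  assumes d: "d > 0" and deg: "degree P \<le> d" "degree Q \<le> d" and res: "resultant_sub d d P Q \<noteq> 0"
    and det: "a * e - b * c \<noteq> 0"
  defines "P' \<equiv> hsub d a b c e P" and "Q' \<equiv> hsub d a b c e Q"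
  shows "moebius_conj (a, b, c, e) (Fract P Q) = Fract (smult e P' + smult (- b) Q') (smult (- c) P' + smult a Q')"
    and "\<exists>s\<in>{1, -1}. resultant_sub d d (smult e P' + smult (- b) Q') (smult (- c) P' + smult a Q') =
      s * (a * e - b * c) ^ (d * d + d) * resultant_sub d d P Q"
proof -
  let ?N = "smult e P' + smult (- b) Q'" and ?D = "smult (- c) P' + smult a Q'"
  have deg': "degree P' \<le> d" "degree Q' \<le> d"
    by (simp_all add: P'_def Q'_def degree_hsub)
  obtain s where s: "s \<in> {1, -1}" "resultant_sub d d P' Q' = s * (a * e - b * c) ^ (d * d) * resultant_sub d d P Q"
    unfolding P'_def Q'_def using resultant_sub_hsub_eq[OF d deg det] by blast
  have resND: "resultant_sub d d ?N ?D = s * (a * e - b * c) ^ (d * d + d) * resultant_sub d d P Q"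
    unfolding resultant_sub_linear_combination[OF deg'] s(2) by (simp add: power_add ac_simps)
  then show "\<exists>s\<in>{1, -1}. resultant_sub d d ?N ?D = s * (a * e - b * c) ^ (d * d + d) * resultant_sub d d P Q"
    using s(1) by blast
  have res': "resultant_sub d d P' Q' \<noteq> 0" "resultant_sub d d ?N ?D \<noteq> 0"
    using s resND res det by auto
  have degND: "degree ?N \<le> d" "degree ?D \<le> d"
    by (intro degree_add_le order_trans[OF degree_smult_le] deg')+
  have Q'0: "Q' \<noteq> 0" and D0: "?D \<noteq> 0"
    using resultant_sub_nonzero_imp(3)[OF d deg' res'(1)] resultant_sub_nonzero_imp(3)[OF d degND res'(2)] .
  have ec: "[:e, c:] \<noteq> 0" and ac: "[:a, - c:] \<noteq> 0"
    using det by auto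
  \<comment> \<open>The denominator (c z + e)^d is common to both evaluated polynomials and
    cancels.\<close>
  have inner: "rat_compose (Fract P Q) (moebius_map a b c e) = to_fract P' / to_fract Q'"
  proof -
    have cancel: "(x / m) / (y / m) = x / y" if "m \<noteq> 0" for x y m :: ratfun
      using that by simp
    have "to_fract [:e, c:] ^ d \<noteq> 0"
      using ec by (intro power_not_zero) (simp only: to_fract_eq_0_iff not_False_eq_True)
    then show ?thesis
      unfolding rat_compose_Fract[OF resultant_sub_nonzero_imp(1,3)[OF d deg res]]
        eval_ratfun_hsub[OF deg(1) ec] eval_ratfun_hsub[OF deg(2) ec] P'_def Q'_def
      by (rule cancel)
  qed
  have cop: "coprime [:- b, e:] [:a, - c:]"
  proof (rule coprimeI)
    fix H assume "H dvd [:- b, e:]" "H dvd [:a, - c:]"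
    then have "H dvd smult c [:- b, e:] + smult e [:a, - c:]"
      by (intro dvd_add dvd_smult)
    also have "smult c [:- b, e:] + smult e [:a, - c:] = [:a * e - b * c:]"
      by (simp add: ac_simps)
    finally show "is_unit H"
      using det by (metis dvd_trans is_unit_const_poly_iff dvd_field_iff one_neq_zero)
  qed
  have lin: "eval_ratfun [:y, x:] \<chi> = to_fract [:y:] + to_fract [:x:] * \<chi>" for x y \<chi>
    by (simp add: eval_ratfun_altdef[of _ 1])
  let ?\<chi> = "to_fract P' / to_fract Q'"
  have cs: "smult k R = [:k:] * R" for k :: rat and R
    by simp
  have lin': "(to_fract [:y:] + to_fract [:x:] * ?\<chi>) * to_fract Q' = to_fract (smult x P' + smult y Q')" for x y
    unfolding cs using Q'0 by (simp add: field_simps del: mult_pCons_left mult_pCons_right)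
  have "moebius_conj (a, b, c, e) (Fract P Q) = eval_ratfun [:- b, e:] ?\<chi> / eval_ratfun [:a, - c:] ?\<chi>"
    unfolding moebius_conj_def prod.case inner moebius_map_def[of e] by (rule rat_compose_Fract[OF cop ac])
  also have "\<dots> = (eval_ratfun [:- b, e:] ?\<chi> * to_fract Q') / (eval_ratfun [:a, - c:] ?\<chi> * to_fract Q')"
    using Q'0 by simp
  also have "\<dots> = to_fract ?N / to_fract ?D"
    unfolding lin lin' ..
  also have "\<dots> = Fract ?N ?D"
    using D0 by (simp add: Fract_conv_to_fract)
  finally show "moebius_conj (a, b, c, e) (Fract P Q) = Fract ?N ?D" .
qed

lemma hsub_identity:
  assumes "degree P \<le> d"
  shows "hsub d 1 0 0 1 P = P"
proof -
  have "smult (coeff P i) ([:0, 1:] ^ i * [:1, 0:] ^ (d - i)) = monom (coeff P i) i" for i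
    by (simp add: monom_altdef flip: one_pCons)
  then show ?thesis
    unfolding hsub_def using poly_as_sum_atMost[OF assms] by simp
qed

lemma rat_resultant_moebius_conj:
  assumes d: "rat_degree \<phi> = d" "d > 0" and res: "rat_resultant \<phi> \<noteq> 0" and A: "A \<in> GL2"
  shows "\<exists>k s. k \<noteq> 0 \<and> s \<in> {1, -1} \<and> of_int (rat_resultant (moebius_conj A \<phi>)) = s * k ^ d * rat_of_int (rat_resultant \<phi>)"
    and "moebius_conj (1, 0, 0, 1) \<phi> = \<phi>"
proof -
  let ?C = "coeff_vec \<phi>"
  let ?F = "map_poly rat_of_int (num_poly d ?C)" and ?G = "map_poly rat_of_int (den_poly d ?C)"
  have C: "is_coeff_vec d \<phi> ?C"
    using is_coeff_vec_coeff_vec[of \<phi>] by (simp add: d)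
  have \<phi>: "\<phi> = Fract ?F ?G"
    using C unfolding is_coeff_vec_def by simp
  have resFG: "of_int (rat_resultant \<phi>) = resultant_sub d d ?F ?G"
    by (simp add: rat_resultant_def d of_int_form_resultant)
  have nz: "resultant_sub d d ?F ?G \<noteq> 0"
    using res unfolding resFG[symmetric] by simp
  note conj = moebius_conj_Fract[OF d(2) degree_num_den_poly nz]
  obtain a b c e where A': "A = (a, b, c, e)" "a * e - b * c \<noteq> 0"
    using A by (auto simp: GL2_def)
  let ?N = "smult e (hsub d a b c e ?F) + smult (- b) (hsub d a b c e ?G)"
  let ?D = "smult (- c) (hsub d a b c e ?F) + smult a (hsub d a b c e ?G)"
  obtain s where s: "s \<in> {1, -1}"
    "resultant_sub d d ?N ?D = s * (a * e - b * c) ^ (d * d + d) * resultant_sub d d ?F ?G"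
    using conj(2)[OF A'(2)] by blast
  have degND: "degree ?N \<le> d" "degree ?D \<le> d"
    by (intro degree_add_le order_trans[OF degree_smult_le] degree_hsub)+
  have "resultant_sub d d ?N ?D \<noteq> 0"
    using s A'(2) nz by auto
  then obtain h where h: "h \<noteq> 0" "of_int (rat_resultant (Fract ?N ?D)) = h ^ (2 * d) * resultant_sub d d ?N ?D"
    using rat_resultant_Fract[OF d(2) degND] by blast
  have "moebius_conj A \<phi> = Fract ?N ?D"
    unfolding A'(1) by (subst \<phi>) (rule conj(1)[OF A'(2)])
  then have "of_int (rat_resultant (moebius_conj A \<phi>)) =
      h ^ (2 * d) * (s * (a * e - b * c) ^ (d * d + d) * rat_of_int (rat_resultant \<phi>))"
    using h(2) s(2) resFG by simp
  \<comment> \<open>Both exponents, 2 d from normalization and d^2 + d from conjugation, are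
    multiples of \<open>d\<close>; the \<open>d\<close>-th root taken here is the witness
    \<open>k\<close>.\<close>
  also have "\<dots> = s * (h\<^sup>2 * (a * e - b * c) ^ (d + 1)) ^ d * rat_of_int (rat_resultant \<phi>)"
  proof -
    have pow: "(h\<^sup>2 * x ^ (d + 1)) ^ d = h ^ (2 * d) * x ^ (d * d + d)" for x
      by (simp add: power_mult_distrib power_mult[symmetric] algebra_simps power_add)
    show ?thesis
      unfolding pow by (simp only: ac_simps)
  qed
  finally show "\<exists>k s. k \<noteq> 0 \<and> s \<in> {1, -1} \<and>
      of_int (rat_resultant (moebius_conj A \<phi>)) = s * k ^ d * rat_of_int (rat_resultant \<phi>)"
    using h(1) A'(2) s(1) by (intro exI[of _ "h\<^sup>2 * (a * e - b * c) ^ (d + 1)"] exI[of _ s]) simp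
  have "moebius_conj (1, 0, 0, 1) (Fract ?F ?G) = Fract ?F ?G"
    using conj(1)[of 1 1 0 0] by (simp add: hsub_identity[OF degree_num_den_poly(1)] hsub_identity[OF degree_num_den_poly(2)])
  then show "moebius_conj (1, 0, 0, 1) \<phi> = \<phi>"
    by (simp flip: \<phi>)
qed

text \<open>The order of \<open>R'\<close> is that of \<open>R\<close> plus a multiple of
  \<open>d\<close>. Since the order of \<open>R\<close> is below \<open>d\<close> and that of
  \<open>R'\<close> is not negative, neither is the multiple.\<close>

lemma multiplicity_le_of_power_ratio:
  fixes R R' :: int
  assumes p: "prime p" and d: "d > 0" and R: "\<not> p ^ d dvd R" and s: "s \<in> {1, -1 :: rat}" and k: "k \<noteq> 0"
    and eq: "of_int R' = s * k ^ d * rat_of_int R"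
  shows "multiplicity p R \<le> multiplicity p R'"
proof -
  obtain u v where uv: "quotient_of k = (u, v)"
    by (cases "quotient_of k")
  then have k': "k = of_int u / of_int v" and v: "v \<noteq> 0"
    using quotient_of_denom_pos[OF uv] by (auto simp: quotient_of_div)
  have u: "u \<noteq> 0"
    using k k' by auto
  have R0: "R \<noteq> 0"
    using R by auto
  obtain \<sigma> :: int where \<sigma>: "\<sigma> \<in> {1, -1}" "s = of_int \<sigma>"
  proof (cases "s = 1")
    case True
    then show ?thesis
      using that[of 1] by simp
  next
    case False
    then show ?thesis
      using s that[of "- 1"] by simp
  qed
  have "rat_of_int (R' * v ^ d) = rat_of_int (\<sigma> * u ^ d * R)"
    using eq v by (simp add: k' \<sigma>(2) power_divide)
  then have int_eq: "R' * v ^ d = \<sigma> * u ^ d * R"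
    by (simp only: of_int_eq_iff)
  have "R' * v ^ d \<noteq> 0"
    unfolding int_eq using \<sigma>(1) u R0 by auto
  then have R'0: "R' \<noteq> 0"
    by auto
  have p': "prime_elem p"
    using p by (rule prime_imp_prime_elem)
  have "multiplicity p (R' * v ^ d) = multiplicity p R' + d * multiplicity p v"
    using R'0 v by (simp add: prime_elem_multiplicity_mult_distrib[OF p'] prime_elem_multiplicity_power_distrib[OF p'])
  moreover have "multiplicity p (\<sigma> * (u ^ d * R)) = multiplicity p (u ^ d * R)"
    using \<sigma>(1) by (intro multiplicity_times_unit_right) auto
  moreover have "multiplicity p (u ^ d * R) = d * multiplicity p u + multiplicity p R"
    using R0 u by (simp add: prime_elem_multiplicity_mult_distrib[OF p'] prime_elem_multiplicity_power_distrib[OF p'])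
  ultimately have m: "multiplicity p R' + d * multiplicity p v = d * multiplicity p u + multiplicity p R"
    using int_eq by (simp add: mult.assoc)
  have "multiplicity p R < d"
    using R by (metis multiplicity_dvd' not_less)
  show ?thesis
  proof (cases "multiplicity p v \<le> multiplicity p u")
    case True
    then have "d * multiplicity p v \<le> d * multiplicity p u"
      by simp
    then show ?thesis
      using m by linarith
  next
    case False
    then have "d * Suc (multiplicity p u) \<le> d * multiplicity p v"
      by (intro mult_left_mono) auto
    then show ?thesis
      using m \<open>multiplicity p R < d\<close> by simp
  qed
qed

text \<open>
  Conjugation changes the resultant by a \<open>d\<close>-th power, so its order at \<open>p\<close> is fixed modulo \<open>d\<close>; an
  order below \<open>d\<close> is the least possible one.
\<close>

lemma power_free_imp_globally_minimal:
  assumes "d > 0" and \<phi>: "\<phi> \<in> power_free_res_maps d \<Sigma>"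
  shows "globally_minimal \<phi>"
  unfolding globally_minimal_def
proof (intro allI impI)
  fix p :: nat assume p: "prime p"
  have d: "rat_degree \<phi> = d" and free: "\<not> int p ^ d dvd rat_resultant \<phi>"
    using \<phi> p by (auto simp: power_free_res_maps_def)
  have res: "rat_resultant \<phi> \<noteq> 0"
    using free by auto
  note conj = rat_resultant_moebius_conj[OF d assms(1) res]
  have lower: "multiplicity (int p) (rat_resultant \<phi>) \<le> multiplicity (int p) (rat_resultant (moebius_conj A \<phi>))"
    if "A \<in> GL2" for A
    using conj(1)[OF that] multiplicity_le_of_power_ratio[of "int p" d "rat_resultant \<phi>"] p assms(1) free by auto
  have one: "(1, 0, 0, 1) \<in> GL2"
    by (simp add: GL2_def)
  show "multiplicity (int p) (rat_resultant \<phi>) = min_ord_res p \<phi>"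
    unfolding min_ord_res_def
  proof (rule antisym)
    show "multiplicity (int p) (rat_resultant \<phi>) \<le>
        (INF A\<in>GL2. multiplicity (int p) (rat_resultant (moebius_conj A \<phi>)))"
      using one lower by (intro cINF_greatest) auto
    have "(INF A\<in>GL2. multiplicity (int p) (rat_resultant (moebius_conj A \<phi>))) \<le>
        multiplicity (int p) (rat_resultant (moebius_conj (1, 0, 0, 1) \<phi>))"
      using one by (intro cINF_lower) auto
    then show "(INF A\<in>GL2. multiplicity (int p) (rat_resultant (moebius_conj A \<phi>))) \<le>
        multiplicity (int p) (rat_resultant \<phi>)"
      by (simp add: conj(2)[OF one])
  qed
qed

text \<open>A power-free resultant is not 0, so a primitive vector satisfying the conditions comes
  from a map of degree exactly \<open>d\<close>. This turns the set of maps into local conditions on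
  vectors.\<close>

lemma coeff_vec_power_free_res_maps:
  assumes "d > 0"
  shows "coeff_vec ` power_free_res_maps d \<Sigma> = {C \<in> proj_points (2 * d + 1).
    (\<forall>p. prime p \<longrightarrow> \<not> int p ^ d dvd form_resultant d C) \<and> (\<forall>p\<in>\<Sigma>. \<not> int p dvd form_resultant d C)}"
proof (intro equalityI subsetI)
  fix C assume "C \<in> coeff_vec ` power_free_res_maps d \<Sigma>"
  then obtain \<phi> where "\<phi> \<in> power_free_res_maps d \<Sigma>" and C: "C = coeff_vec \<phi>"
    by blast
  moreover from this have "rat_degree \<phi> = d"
    by (simp add: power_free_res_maps_def)
  moreover from this have "C \<in> proj_points (2 * d + 1)"
    using is_coeff_vec_coeff_vec[of \<phi>] C by (simp add: is_coeff_vec_def)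
  ultimately show "C \<in> {C \<in> proj_points (2 * d + 1). (\<forall>p. prime p \<longrightarrow> \<not> int p ^ d dvd form_resultant d C) \<and>
      (\<forall>p\<in>\<Sigma>. \<not> int p dvd form_resultant d C)}"
    by (simp add: power_free_res_maps_def good_reduction_at_def rat_resultant_def)
next
  fix C assume "C \<in> {C \<in> proj_points (2 * d + 1). (\<forall>p. prime p \<longrightarrow> \<not> int p ^ d dvd form_resultant d C) \<and>
    (\<forall>p\<in>\<Sigma>. \<not> int p dvd form_resultant d C)}"
  then have C: "C \<in> proj_points (2 * d + 1)" "\<And>p. prime p \<Longrightarrow> \<not> int p ^ d dvd form_resultant d C"
    "\<And>p. p \<in> \<Sigma> \<Longrightarrow> \<not> int p dvd form_resultant d C"
    by auto
  let ?F = "map_poly rat_of_int (num_poly d C)" and ?G = "map_poly rat_of_int (den_poly d C)"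
  define \<phi> where "\<phi> = Fract ?F ?G"
  have "form_resultant d C \<noteq> 0"
    using C(2)[OF two_is_prime_nat] by auto
  then have nz: "resultant_sub d d ?F ?G \<noteq> 0"
    unfolding of_int_form_resultant[symmetric] by simp
  note FG = resultant_sub_nonzero_imp[OF assms degree_num_den_poly nz]
  have rd: "rat_degree \<phi> = d"
    unfolding \<phi>_def by (rule rat_degree_Fract[OF assms degree_num_den_poly nz])
  have "C $ d \<noteq> 0 \<or> C $ (2 * d + 1) \<noteq> 0"
    using FG(2) by (simp add: coeff_map_poly coeff_num_poly coeff_den_poly mult_2)
  then have "is_coeff_vec d \<phi> C"
    unfolding is_coeff_vec_def \<phi>_def using C(1) coprime_forms[OF FG(1)] FG(3) by auto
  then have "coeff_vec \<phi> = C"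
    unfolding coeff_vec_def rd by (rule the1_equality[OF coeff_vec_unique_existence[OF rd]])
  moreover from this have "\<phi> \<in> power_free_res_maps d \<Sigma>"
    using C rd by (auto simp: power_free_res_maps_def good_reduction_at_def rat_resultant_def)
  ultimately show "C \<in> coeff_vec ` power_free_res_maps d \<Sigma>"
    by blast
qed

section \<open>Weak box densities and residue densities\<close>

text \<open>
  Limits along this filter are the iterated limits of the weak box density: first \<open>r n \<rightarrow> \<infinity>\<close>, then
  the other radii.
\<close>

definition iterated_filter :: "nat \<Rightarrow> nat \<Rightarrow> (nat \<Rightarrow> real) filter" where
  "iterated_filter d n =
     Abs_filter (\<lambda>P. eventually (\<lambda>r. eventually (\<lambda>t. P (r(n := t))) at_top) (others_at_top d n))"

lemma eventually_iterated_filter: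
  "eventually P (iterated_filter d n) \<longleftrightarrow>
    eventually (\<lambda>r. eventually (\<lambda>t. P (r(n := t))) at_top) (others_at_top d n)"
  unfolding iterated_filter_def
proof (rule eventually_Abs_filter, rule is_filter.intro)
  fix P Q :: "(nat \<Rightarrow> real) \<Rightarrow> bool"
  let ?ev = "\<lambda>P. eventually (\<lambda>r. eventually (\<lambda>t. P (r(n := t))) at_top) (others_at_top d n)"
  show "?ev (\<lambda>x. P x \<and> Q x)" if "?ev P" "?ev Q"
    using that by eventually_elim (rule eventually_conj)
  show "?ev Q" if "\<forall>x. P x \<longrightarrow> Q x" "?ev P"
    using that(2) by eventually_elim (erule eventually_mono, use that(1) in blast)
qed simp

text \<open>There are finitely many radii, so one bound serves for all of them.\<close>

lemma eventually_others_at_top: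
  "eventually P (others_at_top d n) \<longleftrightarrow>
    (\<exists>R. \<forall>r. (\<forall>i\<in>{1..2 * d + 2} - {n}. r i \<ge> R) \<longrightarrow> P r)"
proof
  let ?I = "{1..2 * d + 2} - {n}"
  assume "eventually P (others_at_top d n)"
  then obtain Q where Q: "\<forall>i\<in>?I. eventually (Q i) (filtercomap (\<lambda>r. r i) at_top)"
    and PQ: "\<forall>r. (\<forall>i\<in>?I. Q i r) \<longrightarrow> P r"
    unfolding others_at_top_def by (auto simp: eventually_INF_finite)
  have "\<forall>i\<in>?I. \<exists>b. \<forall>r. r i \<ge> b \<longrightarrow> Q i r"
    using Q by (fastforce simp: eventually_filtercomap eventually_at_top_linorder)
  from bchoice[OF this] obtain b where b: "\<forall>i\<in>?I. \<forall>r. r i \<ge> b i \<longrightarrow> Q i r"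
    by (elim exE)
  have "P r" if r: "\<forall>i\<in>?I. r i \<ge> Max (insert 0 (b ` ?I))" for r
  proof -
    have "r i \<ge> b i" if i: "i \<in> ?I" for i
    proof -
      have "b i \<le> Max (insert 0 (b ` ?I))"
        using i by (intro Max_ge) auto
      then show ?thesis
        using r i by (meson order_trans)
    qed
    then show ?thesis
      using b PQ by blast
  qed
  then show "\<exists>R. \<forall>r. (\<forall>i\<in>?I. r i \<ge> R) \<longrightarrow> P r"
    by blast
next
  let ?I = "{1..2 * d + 2} - {n}"
  assume "\<exists>R. \<forall>r. (\<forall>i\<in>?I. r i \<ge> R) \<longrightarrow> P r"
  then obtain R where R: "\<And>r. (\<forall>i\<in>?I. r i \<ge> R) \<Longrightarrow> P r"
    by blast
  have "eventually (\<lambda>r. r i \<ge> R) (filtercomap (\<lambda>r. r i) at_top)" for i :: nat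
    unfolding eventually_filtercomap using eventually_ge_at_top by blast
  then show "eventually P (others_at_top d n)"
    unfolding others_at_top_def using R
    by (subst eventually_INF_finite) (auto intro!: exI[of _ "\<lambda>i r. r i \<ge> R"])
qed

lemma others_at_top_neq_bot: "others_at_top d n \<noteq> bot"
  unfolding trivial_limit_def eventually_others_at_top
proof
  assume "\<exists>R. \<forall>r :: nat \<Rightarrow> real. (\<forall>i\<in>{1..2 * d + 2} - {n}. r i \<ge> R) \<longrightarrow> False"
  then obtain R where "\<forall>r :: nat \<Rightarrow> real. (\<forall>i\<in>{1..2 * d + 2} - {n}. r i \<ge> R) \<longrightarrow> False"
    by blast
  from spec[OF this, of "\<lambda>_. R"] show False
    by simp
qed

lemma iterated_filter_neq_bot: "iterated_filter d n \<noteq> bot"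
  unfolding trivial_limit_def eventually_iterated_filter
  using others_at_top_neq_bot by (simp add: eventually_False)

lemma filterlim_coordinate_at_top:
  assumes "i \<in> {1..2 * d + 2}"
  shows "filterlim (\<lambda>r. r i) at_top (iterated_filter d n)"
  unfolding filterlim_at_top eventually_iterated_filter
proof
  fix Z :: real
  show "eventually (\<lambda>r. eventually (\<lambda>t. Z \<le> (r(n := t)) i) at_top) (others_at_top d n)"
  proof (cases "i = n")
    case True
    then show ?thesis
      by (simp add: eventually_ge_at_top)
  next
    case False
    then show ?thesis
      using assms by (auto simp: eventually_others_at_top intro!: exI[of _ Z])
  qed
qed

text \<open>The inner limits need not exist: a ratio within \<epsilon> of \<mu> along the iterated
  filter confines the inner \<open>Liminf\<close> and \<open>Limsup\<close> to the same range, and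
  \<epsilon> is arbitrary.\<close>

lemma has_weak_box_densityI:
  assumes lim: "(box_ratio d S \<longlongrightarrow> \<mu>) (iterated_filter d n)"
  shows "has_weak_box_density d n S \<mu>"
proof -
  let ?f = "\<lambda>r t. ereal (box_ratio d S (r(n := t)))"
  have bounds: "lower_weak_box_density d n S \<ge> ereal (\<mu> - \<epsilon>) \<and> upper_weak_box_density d n S \<le> ereal (\<mu> + \<epsilon>)"
    if "\<epsilon> > 0" for \<epsilon>
  proof -
    have "eventually (\<lambda>r. dist (box_ratio d S r) \<mu> < \<epsilon>) (iterated_filter d n)"
      using lim that by (rule tendstoD)
    then have "eventually (\<lambda>r. ereal (\<mu> - \<epsilon>) \<le> Liminf at_top (?f r) \<and> Limsup at_top (?f r) \<le> ereal (\<mu> + \<epsilon>)) (others_at_top d n)"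
      unfolding eventually_iterated_filter
    proof eventually_elim
      case (elim r)
      show ?case
      proof
        show "ereal (\<mu> - \<epsilon>) \<le> Liminf at_top (?f r)"
          by (rule Liminf_bounded, use elim in eventually_elim) (auto simp: dist_real_def)
        show "Limsup at_top (?f r) \<le> ereal (\<mu> + \<epsilon>)"
          by (rule Limsup_bounded, use elim in eventually_elim) (auto simp: dist_real_def)
      qed
    qed
    then have "eventually (\<lambda>r. ereal (\<mu> - \<epsilon>) \<le> Liminf at_top (?f r)) (others_at_top d n)"
      "eventually (\<lambda>r. Limsup at_top (?f r) \<le> ereal (\<mu> + \<epsilon>)) (others_at_top d n)"
      by (rule eventually_mono, blast)+
    then show ?thesis
      unfolding lower_weak_box_density_def upper_weak_box_density_def
      by (intro conjI Liminf_bounded Limsup_bounded)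
  qed
  have "ereal \<mu> \<le> lower_weak_box_density d n S"
  proof (rule ereal_le_epsilon2)
    fix \<epsilon> :: real assume "\<epsilon> > 0"
    then have "ereal (\<mu> - \<epsilon>) + ereal \<epsilon> \<le> lower_weak_box_density d n S + ereal \<epsilon>"
      using bounds by (intro add_right_mono) auto
    then show "ereal \<mu> \<le> lower_weak_box_density d n S + ereal \<epsilon>"
      by simp
  qed
  moreover have "upper_weak_box_density d n S \<le> ereal \<mu>"
  proof (rule ereal_le_epsilon2)
    fix \<epsilon> :: real assume "\<epsilon> > 0"
    then show "upper_weak_box_density d n S \<le> ereal \<mu> + ereal \<epsilon>"
      using bounds[of \<epsilon>] by simp
  qed
  moreover have "lower_weak_box_density d n S \<le> upper_weak_box_density d n S"
  proof -
    have "Liminf (others_at_top d n) (\<lambda>r. Liminf at_top (?f r)) \<le> Liminf (others_at_top d n) (\<lambda>r. Limsup at_top (?f r))"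
      by (intro Liminf_mono always_eventually allI Liminf_le_Limsup) simp
    also have "\<dots> \<le> Limsup (others_at_top d n) (\<lambda>r. Limsup at_top (?f r))"
      by (intro Liminf_le_Limsup others_at_top_neq_bot)
    finally show ?thesis
      unfolding lower_weak_box_density_def upper_weak_box_density_def .
  qed
  ultimately show ?thesis
    unfolding has_weak_box_density_def by (meson antisym order_trans)
qed

text \<open>The lower bound follows from the upper bounds for the other \<open>m - 1\<close>
  classes, since all classes together fill the interval.\<close>

lemma residue_count_bounds:
  fixes m :: nat and a :: int
  assumes m: "m > 0" and a: "a \<in> {0..<int m}"
  shows "\<bar>real (card {y\<in>{-int R..int R}. y mod int m = a}) - (2 * real R + 1) / real m\<bar> \<le> real m"
proof -
  let ?I = "{-int R..int R}"
  let ?c = "\<lambda>b. {y\<in>?I. y mod int m = b}"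
  have upper: "real (card (?c b)) \<le> (2 * real R + 1) / real m + 1" for b
    using m by (intro card_congruent_le) (auto simp flip: mod_eq_dvd_iff)
  have fin: "finite (?c b)" for b
    by (rule finite_subset[of _ ?I]) auto
  have "?I = (\<Union>b\<in>{0..<int m}. ?c b)"
    using m by auto
  then have "card ?I = card (\<Union>b\<in>{0..<int m}. ?c b)"
    by (rule arg_cong)
  also have "\<dots> = (\<Sum>b\<in>{0..<int m}. card (?c b))"
    using fin by (intro card_UN_disjoint) auto
  finally have "2 * real R + 1 = (\<Sum>b\<in>{0..<int m}. real (card (?c b)))"
    by (simp add: of_nat_sum[symmetric] del: of_nat_sum)
  also have "\<dots> = real (card (?c a)) + (\<Sum>b\<in>{0..<int m} - {a}. real (card (?c b)))"
    using a by (intro sum.remove) auto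
  also have "\<dots> \<le> real (card (?c a)) + (\<Sum>b\<in>{0..<int m} - {a}. (2 * real R + 1) / real m + 1)"
    by (intro add_left_mono sum_mono upper)
  also have "(\<Sum>b\<in>{0..<int m} - {a}. (2 * real R + 1) / real m + 1) = (real m - 1) * ((2 * real R + 1) / real m + 1)"
    using a m by (simp add: of_nat_diff)
  also have "\<dots> = (2 * real R + 1) - (2 * real R + 1) / real m + real m - 1"
    using m by (simp add: field_simps)
  finally have "(2 * real R + 1) / real m - real m \<le> real (card (?c a))"
    by simp
  moreover have "real m \<ge> 1"
    using m by simp
  ultimately show ?thesis
    using upper[of a] by linarith
qed

lemma residue_density:
  fixes m :: nat and a :: int
  assumes m: "m > 0" and a: "a \<in> {0..<int m}"
  shows "(\<lambda>R. real (card {y\<in>{-int R..int R}. y mod int m = a}) / (2 * real R + 1)) \<longlonglongrightarrow> 1 / real m"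
proof (rule LIMSEQ_I)
  fix \<epsilon> :: real assume \<epsilon>: "\<epsilon> > 0"
  obtain R0 :: nat where R0: "real R0 > real m / \<epsilon>"
    using reals_Archimedean2 by blast
  have "norm (real (card {y\<in>{-int R..int R}. y mod int m = a}) / (2 * real R + 1) - 1 / real m) < \<epsilon>"
    if R: "R \<ge> R0" for R
  proof -
    let ?c = "real (card {y\<in>{-int R..int R}. y mod int m = a})" and ?N = "2 * real R + 1"
    have N: "?N > 0"
      by simp
    have "\<bar>?c / ?N - 1 / real m\<bar> = \<bar>?c - ?N / real m\<bar> / ?N"
    proof -
      have "?c / ?N - 1 / real m = (?c - ?N / real m) / ?N"
        using N by (simp add: diff_divide_distrib)
      then show ?thesis
        using N by (simp add: abs_divide)
    qed
    also have "\<dots> \<le> real m / ?N"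
      using residue_count_bounds[OF m a] by (intro divide_right_mono) auto
    also have "real m / ?N < \<epsilon>"
    proof -
      have "real m < \<epsilon> * real R0"
        using R0 \<epsilon> by (simp add: field_simps)
      also have "\<dots> \<le> \<epsilon> * ?N"
        using R \<epsilon> by (intro mult_left_mono) auto
      finally show ?thesis
        using N by (simp add: field_simps)
    qed
    finally show ?thesis
      by simp
  qed
  then show "\<exists>no. \<forall>R\<ge>no. norm (real (card {y\<in>{-int R..int R}. y mod int m = a}) / (2 * real R + 1) - 1 / real m) < \<epsilon>"
    by blast
qed

section \<open>Densities of periodic conditions\<close>

definition residue_vecs :: "nat set \<Rightarrow> nat \<Rightarrow> (nat \<Rightarrow> int) set" where
  "residue_vecs V m = (\<Pi>\<^sub>E i\<in>V. {0..<int m})"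

text \<open>Being determined by congruences on \<open>V\<close> includes independence of the values
  outside \<open>V\<close>.\<close>

definition periodic_on :: "nat set \<Rightarrow> nat \<Rightarrow> ((nat \<Rightarrow> int) \<Rightarrow> bool) \<Rightarrow> bool" where
  "periodic_on V m S \<longleftrightarrow> (\<forall>x y. (\<forall>i\<in>V. int m dvd x i - y i) \<longrightarrow> S x = S y)"

definition residue_density_of :: "nat set \<Rightarrow> nat \<Rightarrow> ((nat \<Rightarrow> int) \<Rightarrow> bool) \<Rightarrow> real" where
  "residue_density_of V m S = real (card {a\<in>residue_vecs V m. S a}) / real m ^ card V"

lemma periodic_onD: "periodic_on V m S \<Longrightarrow> (\<And>i. i \<in> V \<Longrightarrow> int m dvd x i - y i) \<Longrightarrow> S x = S y"
  unfolding periodic_on_def by blast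

lemma finite_residue_vecs: "finite V \<Longrightarrow> finite (residue_vecs V m)"
  by (simp add: residue_vecs_def finite_PiE)

definition reduce :: "nat set \<Rightarrow> nat \<Rightarrow> (nat \<Rightarrow> int) \<Rightarrow> nat \<Rightarrow> int" where
  "reduce V m x = (\<lambda>i\<in>V. x i mod int m)"

lemma reduce_in_residue_vecs: "m > 0 \<Longrightarrow> reduce V m x \<in> residue_vecs V m"
  by (auto simp: reduce_def residue_vecs_def)

lemma periodic_on_reduce: "periodic_on V m S \<Longrightarrow> S (reduce V m x) = S x"
  by (erule periodic_onD) (simp add: reduce_def mod_eq_dvd_iff[symmetric])

text \<open>The box splits into products of residue classes of intervals, one for each admissible
  residue vector. Each radius tends to infinity along the filter; no relation between their rates is
  required.\<close>

lemma periodic_density: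
  fixes R :: "'r \<Rightarrow> nat \<Rightarrow> nat"
  assumes V: "finite V" and m: "m > 0" and S: "periodic_on V m S"
    and R: "\<And>i. i \<in> V \<Longrightarrow> filterlim (\<lambda>r. R r i) at_top F"
  shows "((\<lambda>r. real (card {x\<in>int_box V (R r). S x}) / real (card (int_box V (R r)))) \<longlongrightarrow> residue_density_of V m S) F"
proof -
  let ?A = "{a\<in>residue_vecs V m. S a}"
  let ?c = "\<lambda>R a. {y\<in>{-int R..int R}. y mod int m = a}"
  have finA: "finite ?A"
    using V by (simp add: finite_residue_vecs)
  have "real (card {x\<in>int_box V R. S x}) / real (card (int_box V R)) =
      (\<Sum>a\<in>?A. \<Prod>i\<in>V. real (card (?c (R i) (a i))) / (2 * real (R i) + 1))" for R
  proof -
    have union: "{x\<in>int_box V R. S x} = (\<Union>a\<in>?A. \<Pi>\<^sub>E i\<in>V. ?c (R i) (a i))"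
    proof (intro equalityI subsetI)
      fix x assume x: "x \<in> {x\<in>int_box V R. S x}"
      then have "reduce V m x \<in> ?A"
        using m periodic_on_reduce[OF S] by (simp add: reduce_in_residue_vecs)
      moreover have "x \<in> (\<Pi>\<^sub>E i\<in>V. ?c (R i) (reduce V m x i))"
        using x by (auto simp: int_box_def reduce_def PiE_def Pi_def)
      ultimately show "x \<in> (\<Union>a\<in>?A. \<Pi>\<^sub>E i\<in>V. ?c (R i) (a i))"
        by blast
    next
      fix x assume "x \<in> (\<Union>a\<in>?A. \<Pi>\<^sub>E i\<in>V. ?c (R i) (a i))"
      then obtain a where a: "a \<in> residue_vecs V m" "S a" and x: "x \<in> (\<Pi>\<^sub>E i\<in>V. ?c (R i) (a i))"
        by blast
      have "int m dvd x i - a i" if "i \<in> V" for i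
      proof -
        have "x i mod int m = a i" "a i \<in> {0..<int m}"
          using PiE_mem[OF x that] a(1) that by (auto simp: residue_vecs_def)
        then show ?thesis
          by (simp flip: mod_eq_dvd_iff)
      qed
      then have "S x = S a"
        by (rule periodic_onD[OF S])
      moreover have "x \<in> int_box V R"
        using x by (auto simp: int_box_def PiE_def Pi_def)
      ultimately show "x \<in> {x\<in>int_box V R. S x}"
        using a by simp
    qed
    have fin: "finite (\<Pi>\<^sub>E i\<in>V. ?c (R i) (a i))" for a
    proof (rule finite_PiE[OF V])
      show "finite (?c (R i) (a i))" for i
        by (rule finite_subset[of _ "{-int (R i)..int (R i)}"]) auto
    qed
    have disj: "(\<Pi>\<^sub>E i\<in>V. ?c (R i) (a i)) \<inter> (\<Pi>\<^sub>E i\<in>V. ?c (R i) (b i)) = {}"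
      if ab: "a \<in> ?A" "b \<in> ?A" "a \<noteq> b" for a b
    proof (rule ccontr)
      assume "(\<Pi>\<^sub>E i\<in>V. ?c (R i) (a i)) \<inter> (\<Pi>\<^sub>E i\<in>V. ?c (R i) (b i)) \<noteq> {}"
      then obtain x where x: "x \<in> (\<Pi>\<^sub>E i\<in>V. ?c (R i) (a i))" "x \<in> (\<Pi>\<^sub>E i\<in>V. ?c (R i) (b i))"
        by blast
      have "a = b"
      proof (rule PiE_ext)
        show "a \<in> (\<Pi>\<^sub>E i\<in>V. {0..<int m})" "b \<in> (\<Pi>\<^sub>E i\<in>V. {0..<int m})"
          using ab by (auto simp: residue_vecs_def)
        show "a i = b i" if "i \<in> V" for i
          using PiE_mem[OF x(1) that] PiE_mem[OF x(2) that] by simp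
      qed
      then show False
        using ab(3) by simp
    qed
    have "card {x\<in>int_box V R. S x} = (\<Sum>a\<in>?A. card (\<Pi>\<^sub>E i\<in>V. ?c (R i) (a i)))"
      unfolding union using finA fin disj by (intro card_UN_disjoint) blast+
    also have "\<dots> = (\<Sum>a\<in>?A. \<Prod>i\<in>V. card (?c (R i) (a i)))"
      using V by (simp add: card_PiE)
    finally have "real (card {x\<in>int_box V R. S x}) = (\<Sum>a\<in>?A. \<Prod>i\<in>V. real (card (?c (R i) (a i))))"
      by simp
    moreover have "real (card (int_box V R)) = (\<Prod>i\<in>V. 2 * real (R i) + 1)"
      using V by (simp add: card_int_box add.commute)
    ultimately show ?thesis
      by (simp add: sum_divide_distrib prod_dividef)
  qed
  moreover have "((\<lambda>r. \<Sum>a\<in>?A. \<Prod>i\<in>V. real (card (?c (R r i) (a i))) / (2 * real (R r i) + 1)) \<longlongrightarrow>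
      (\<Sum>a\<in>?A. \<Prod>i\<in>V. 1 / real m)) F"
  proof (intro tendsto_sum tendsto_prod)
    fix a i assume "a \<in> ?A" "i \<in> V"
    then have "a i \<in> {0..<int m}"
      by (auto simp: residue_vecs_def)
    from filterlim_compose[OF residue_density[OF m this] R[OF \<open>i \<in> V\<close>]]
    show "((\<lambda>r. real (card (?c (R r i) (a i))) / (2 * real (R r i) + 1)) \<longlongrightarrow> 1 / real m) F" .
  qed
  moreover have "(\<Sum>a\<in>?A. \<Prod>i\<in>V. 1 / real m) = residue_density_of V m S"
    by (simp add: residue_density_of_def power_one_over)
  ultimately show ?thesis
    by simp
qed

text \<open>The Chinese remainder theorem, coordinate by coordinate.\<close>

lemma residue_density_of_mult:
  assumes V: "finite V" and m: "m1 > 0" "m2 > 0" "coprime m1 m2"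
    and A: "periodic_on V m1 A" and B: "periodic_on V m2 B"
  shows "residue_density_of V (m1 * m2) (\<lambda>x. A x \<and> B x) = residue_density_of V m1 A * residue_density_of V m2 B"
proof -
  let ?S = "{x\<in>residue_vecs V (m1 * m2). A x \<and> B x}"
  let ?A = "{x\<in>residue_vecs V m1. A x}" and ?B = "{x\<in>residue_vecs V m2. B x}"
  let ?f = "\<lambda>x. (reduce V m1 x, reduce V m2 x)"
  have cop: "coprime (int m1) (int m2)"
    using m(3) by simp
  have "bij_betw ?f ?S (?A \<times> ?B)"
    unfolding bij_betw_def
  proof
    show "inj_on ?f ?S"
    proof (rule inj_onI)
      fix x y assume xy: "x \<in> ?S" "y \<in> ?S" "?f x = ?f y"
      show "x = y"
      proof (rule PiE_ext)
        show "x \<in> (\<Pi>\<^sub>E i\<in>V. {0..<int (m1 * m2)})" "y \<in> (\<Pi>\<^sub>E i\<in>V. {0..<int (m1 * m2)})"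
          using xy by (auto simp: residue_vecs_def)
        fix i assume i: "i \<in> V"
        have "reduce V m1 x i = reduce V m1 y i" "reduce V m2 x i = reduce V m2 y i"
          using xy(3) by auto
        then have "int m1 dvd x i - y i" "int m2 dvd x i - y i"
          using i by (simp_all add: reduce_def mod_eq_dvd_iff)
        then have "int m1 * int m2 dvd x i - y i"
          using cop by (rule divides_mult)
        then have "x i mod int (m1 * m2) = y i mod int (m1 * m2)"
          by (simp add: mod_eq_dvd_iff)
        moreover have "x i \<in> {0..<int (m1 * m2)}" "y i \<in> {0..<int (m1 * m2)}"
          using xy i by (auto simp: residue_vecs_def simp del: of_nat_mult)
        ultimately show "x i = y i"
          by (simp del: of_nat_mult)
      qed
    qed
    show "?f ` ?S = ?A \<times> ?B"
    proof (intro equalityI subsetI)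
      fix w assume "w \<in> ?f ` ?S"
      then show "w \<in> ?A \<times> ?B"
        using m reduce_in_residue_vecs periodic_on_reduce[OF A] periodic_on_reduce[OF B] by auto
    next
      fix w assume "w \<in> ?A \<times> ?B"
      then obtain a b where w: "w = (a, b)" and a: "a \<in> residue_vecs V m1" "A a" and b: "b \<in> residue_vecs V m2" "B b"
        by auto
      obtain u v where uv: "u * int m1 + v * int m2 = 1"
        using cop by (metis bezout_int coprime_iff_gcd_eq_1)
      \<comment> \<open>By Bezout, \<open>v * int m2\<close> is 1 modulo \<open>m1\<close> and 0
        modulo \<open>m2\<close>, and the reverse holds for \<open>u * int m1\<close>.\<close>
      define x where "x = reduce V (m1 * m2) (\<lambda>i. a i * (v * int m2) + b i * (u * int m1))"
      have x1: "reduce V m1 x = a"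
      proof (rule PiE_ext)
        show "reduce V m1 x \<in> (\<Pi>\<^sub>E i\<in>V. {0..<int m1})" "a \<in> (\<Pi>\<^sub>E i\<in>V. {0..<int m1})"
          using a m reduce_in_residue_vecs[of m1 V x] by (auto simp: residue_vecs_def)
        fix i assume i: "i \<in> V"
        have eq: "a i * (v * int m2) + b i * (u * int m1) - a i = int m1 * ((b i - a i) * u)"
        proof -
          have v: "v * int m2 = 1 - u * int m1"
            using uv by simp
          show ?thesis
            unfolding v by (simp add: algebra_simps)
        qed
        have "reduce V m1 x i = (a i * (v * int m2) + b i * (u * int m1)) mod int m1"
          using i by (simp add: x_def reduce_def mod_mod_cancel)
        also have "\<dots> = a i mod int m1"
          unfolding mod_eq_dvd_iff eq by simp
        also have "\<dots> = a i"
          using PiE_mem[OF a(1)[unfolded residue_vecs_def] i] by simp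
        finally show "reduce V m1 x i = a i" .
      qed
      have x2: "reduce V m2 x = b"
      proof (rule PiE_ext)
        show "reduce V m2 x \<in> (\<Pi>\<^sub>E i\<in>V. {0..<int m2})" "b \<in> (\<Pi>\<^sub>E i\<in>V. {0..<int m2})"
          using b m reduce_in_residue_vecs[of m2 V x] by (auto simp: residue_vecs_def)
        fix i assume i: "i \<in> V"
        have eq: "a i * (v * int m2) + b i * (u * int m1) - b i = int m2 * ((a i - b i) * v)"
        proof -
          have u: "u * int m1 = 1 - v * int m2"
            using uv by simp
          show ?thesis
            unfolding u by (simp add: algebra_simps)
        qed
        have "reduce V m2 x i = (a i * (v * int m2) + b i * (u * int m1)) mod int m2"
          using i by (simp add: x_def reduce_def mod_mod_cancel)
        also have "\<dots> = b i mod int m2"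
          unfolding mod_eq_dvd_iff eq by simp
        also have "\<dots> = b i"
          using PiE_mem[OF b(1)[unfolded residue_vecs_def] i] by simp
        finally show "reduce V m2 x i = b i" .
      qed
      have "x \<in> ?S"
        using m a(2) b(2) periodic_on_reduce[OF A, of x] periodic_on_reduce[OF B, of x] x1 x2
          reduce_in_residue_vecs[of "m1 * m2"] by (simp add: x_def)
      then show "w \<in> ?f ` ?S"
        using x1 x2 w by (intro image_eqI[of _ _ x]) auto
    qed
  qed
  then have "card ?S = card (?A \<times> ?B)"
    by (rule bij_betw_same_card)
  then show ?thesis
    by (simp add: residue_density_of_def card_cartesian_product power_mult_distrib)
qed

lemma periodic_on_prod:
  assumes "finite A" and "\<And>p. p \<in> A \<Longrightarrow> periodic_on V (p ^ d) (bad p)"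
  shows "periodic_on V (\<Prod>p\<in>A. p ^ d) (\<lambda>x. \<forall>p\<in>A. \<not> bad p x)"
  unfolding periodic_on_def
proof (intro allI impI)
  fix x y assume xy: "\<forall>i\<in>V. int (\<Prod>p\<in>A. p ^ d) dvd x i - y i"
  have "bad p x = bad p y" if p: "p \<in> A" for p
  proof (rule periodic_onD[OF assms(2)[OF p]])
    fix i assume "i \<in> V"
    moreover have "int (p ^ d) dvd int (\<Prod>p\<in>A. p ^ d)"
      using dvd_prodI[OF assms(1) p, of "\<lambda>p. p ^ d"] by (simp only: int_dvd_int_iff)
    ultimately show "int (p ^ d) dvd x i - y i"
      using xy dvd_trans by blast
  qed
  then show "(\<forall>p\<in>A. \<not> bad p x) = (\<forall>p\<in>A. \<not> bad p y)"
    by blast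
qed

text \<open>
  Positivity: past a suitable bound the remaining primes remove at most half of all vectors, and by the
  Chinese remainder theorem this is independent of the conditions at the smaller primes.
\<close>

lemma sieve_density:
  fixes R :: "'r \<Rightarrow> nat \<Rightarrow> nat" and bad :: "nat \<Rightarrow> (nat \<Rightarrow> int) \<Rightarrow> bool"
  assumes V: "finite V" and F: "F \<noteq> bot" and R: "\<And>i. i \<in> V \<Longrightarrow> filterlim (\<lambda>r. R r i) at_top F"
    and per: "\<And>p. prime p \<Longrightarrow> periodic_on V (p ^ d) (bad p)"
    and tail: "\<And>z. z \<ge> 2 \<Longrightarrow> eventually (\<lambda>r. real (card {x\<in>int_box V (R r). \<exists>p. prime p \<and> z < p \<and> bad p x})
      \<le> real K / real z * real (card (int_box V (R r)))) F"
  shows "\<exists>P. ((\<lambda>r. real (card {x\<in>int_box V (R r). \<forall>p. prime p \<longrightarrow> \<not> bad p x}) / real (card (int_box V (R r)))) \<longlongrightarrow> P) F \<and>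
    ((\<exists>x. \<forall>p. prime p \<longrightarrow> \<not> bad p x) \<longrightarrow> P > 0)"
proof -
  define X where "X r = int_box V (R r)" for r
  have finX: "finite (X r)" and X0: "real (card (X r)) > 0" for r
    using V by (simp_all add: X_def finite_int_box card_int_box prod_pos)
  define m where "m A = (\<Prod>p\<in>A. p ^ d)" for A :: "nat set"
  define D where "D A = residue_density_of V (m A) (\<lambda>x. \<forall>p\<in>A. \<not> bad p x)" for A
  define ratio where "ratio A r = real (card {x\<in>X r. \<forall>p\<in>A. \<not> bad p x}) / real (card (X r))" for A r
  define total where "total r = real (card {x\<in>X r. \<forall>p. prime p \<longrightarrow> \<not> bad p x}) / real (card (X r))" for r
  define loss where "loss z r = real (card {x\<in>X r. \<exists>p. prime p \<and> z < p \<and> bad p x}) / real (card (X r))" for z r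
  have m0: "m A > 0" if "\<And>p. p \<in> A \<Longrightarrow> prime p" for A
    using that unfolding m_def by (intro prod_pos) (auto simp: prime_gt_0_nat)
  have lim: "(ratio A \<longlongrightarrow> D A) F" if "finite A" "\<And>p. p \<in> A \<Longrightarrow> prime p" for A
    unfolding ratio_def D_def X_def using that m0[of A] per
    by (intro periodic_density V R) (auto simp: m_def intro!: periodic_on_prod)
  have loss: "eventually (\<lambda>r. loss z r \<le> real K / real z) F" if "z \<ge> 2" for z
    using tail[OF that] unfolding loss_def X_def[symmetric] by eventually_elim (use X0 in \<open>simp add: divide_le_eq\<close>)
  define Pr where "Pr z = {p :: nat. prime p \<and> p \<le> z}" for z
  have Pr: "finite (Pr z)" "\<And>p. p \<in> Pr z \<Longrightarrow> prime p" for z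
    by (auto simp: Pr_def)
  have mPr: "m (Pr z) > 0" for z
    by (intro m0 Pr(2))
  have perPr: "periodic_on V (m A) (\<lambda>x. \<forall>p\<in>A. \<not> bad p x)" if "finite A" "\<And>p. p \<in> A \<Longrightarrow> prime p" for A
    unfolding m_def using that per by (intro periodic_on_prod) auto
  have upper: "total r \<le> ratio (Pr z) r" for z r
    unfolding total_def ratio_def using finX[of r]
    by (intro divide_right_mono of_nat_mono card_mono) (auto simp: Pr_def)
  have lower: "ratio (Pr z) r \<le> total r + loss z r" for z r
  proof -
    have "{x\<in>X r. \<forall>p\<in>Pr z. \<not> bad p x} \<subseteq>
        {x\<in>X r. \<forall>p. prime p \<longrightarrow> \<not> bad p x} \<union> {x\<in>X r. \<exists>p. prime p \<and> z < p \<and> bad p x}"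
      unfolding Pr_def using not_le by blast
    then have "card {x\<in>X r. \<forall>p\<in>Pr z. \<not> bad p x} \<le>
        card ({x\<in>X r. \<forall>p. prime p \<longrightarrow> \<not> bad p x} \<union> {x\<in>X r. \<exists>p. prime p \<and> z < p \<and> bad p x})"
      using finX[of r] by (intro card_mono) auto
    also have "\<dots> \<le> card {x\<in>X r. \<forall>p. prime p \<longrightarrow> \<not> bad p x} + card {x\<in>X r. \<exists>p. prime p \<and> z < p \<and> bad p x}"
      by (rule card_Un_le)
    finally have "real (card {x\<in>X r. \<forall>p\<in>Pr z. \<not> bad p x}) \<le>
        real (card {x\<in>X r. \<forall>p. prime p \<longrightarrow> \<not> bad p x}) + real (card {x\<in>X r. \<exists>p. prime p \<and> z < p \<and> bad p x})"
      by linarith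
    then show ?thesis
      unfolding ratio_def total_def loss_def add_divide_distrib[symmetric] by (rule divide_right_mono) simp
  qed
  \<comment> \<open>Monotonicity is inherited from the counts in the boxes by passing to the
    limit.\<close>
  have "decseq (\<lambda>z. D (Pr z))"
    unfolding decseq_def
  proof (intro allI impI)
    fix y z :: nat assume "y \<le> z"
    then have "ratio (Pr z) r \<le> ratio (Pr y) r" for r
      unfolding ratio_def using finX[of r]
      by (intro divide_right_mono of_nat_mono card_mono) (auto simp: Pr_def)
    then show "D (Pr z) \<le> D (Pr y)"
      using tendsto_le[OF F lim[OF Pr, of y] lim[OF Pr, of z]] by simp
  qed
  moreover have "0 \<le> D (Pr z)" for z
    by (simp add: D_def residue_density_of_def)
  ultimately obtain P where P: "(\<lambda>z. D (Pr z)) \<longlonglongrightarrow> P"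
    using decseq_convergent by blast
  have Kz: "(\<lambda>z. real K / real z) \<longlonglongrightarrow> 0"
    by (intro tendsto_divide_0[OF tendsto_const] filterlim_at_top_imp_at_infinity filterlim_real_sequentially)
  have "(total \<longlongrightarrow> P) F"
  proof (rule tendstoI)
    fix \<epsilon> :: real assume \<epsilon>: "\<epsilon> > 0"
    \<comment> \<open>A third of \<epsilon> each for the distance of the finite densities from their
      limit, for that of the box ratio from its density, and for the tail beyond
      \<open>z\<close>.\<close>
    then have "eventually (\<lambda>z. dist (D (Pr z)) P < \<epsilon> / 3 \<and> dist (real K / real z) 0 < \<epsilon> / 3 \<and> z \<ge> 2) at_top"
      by (intro eventually_conj tendstoD[OF P] tendstoD[OF Kz] eventually_ge_at_top) auto
    from eventually_happens'[OF sequentially_bot this]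
    obtain z where z: "dist (D (Pr z)) P < \<epsilon> / 3" "dist (real K / real z) 0 < \<epsilon> / 3" "z \<ge> 2"
      by blast
    have "eventually (\<lambda>r. dist (ratio (Pr z) r) (D (Pr z)) < \<epsilon> / 3) F"
      using lim[OF Pr, of z] \<epsilon> by (intro tendstoD) auto
    then show "eventually (\<lambda>r. dist (total r) P < \<epsilon>) F"
      using loss[OF z(3)]
    proof eventually_elim
      case (elim r)
      then show ?case
        using upper[of r z] lower[of z r] z(1,2) unfolding dist_real_def by linarith
    qed
  qed
  moreover have "P > 0" if good: "\<exists>x. \<forall>p. prime p \<longrightarrow> \<not> bad p x"
  proof -
    obtain x where x: "\<forall>p. prime p \<longrightarrow> \<not> bad p x"
      using good by blast
    have "eventually (\<lambda>z. dist (real K / real z) 0 < 1 / 2 \<and> z \<ge> 2) at_top"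
      by (intro eventually_conj tendstoD[OF Kz] eventually_ge_at_top) auto
    from eventually_happens'[OF sequentially_bot this]
    obtain y where "dist (real K / real y) 0 < 1 / 2" and "y \<ge> 2"
      by blast
    then have y: "real K / real y < 1 / 2" "y \<ge> 2"
      by (auto simp: dist_real_def)
    have "reduce V (m (Pr y)) x \<in> {a\<in>residue_vecs V (m (Pr y)). \<forall>p\<in>Pr y. \<not> bad p a}"
    proof -
      have "periodic_on V (m (Pr y)) (\<lambda>x. \<forall>p\<in>Pr y. \<not> bad p x)"
        unfolding m_def using Pr per by (intro periodic_on_prod) auto
      then have "\<forall>p\<in>Pr y. \<not> bad p (reduce V (m (Pr y)) x)"
        using periodic_on_reduce x Pr(2) by blast
      then show ?thesis
        using reduce_in_residue_vecs[OF mPr] by simp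
    qed
    then have "card {a\<in>residue_vecs V (m (Pr y)). \<forall>p\<in>Pr y. \<not> bad p a} > 0"
      using finite_residue_vecs[OF V] by (auto simp: card_gt_0_iff)
    then have Dy: "D (Pr y) > 0"
      using mPr[of y] by (simp add: D_def residue_density_of_def)
    have half: "D (Pr z) \<ge> D (Pr y) / 2" if z: "z \<ge> y" for z
    proof -
      define B where "B = Pr z - Pr y"
      have B: "finite B" "\<And>p. p \<in> B \<Longrightarrow> prime p" "\<And>p. p \<in> B \<Longrightarrow> y < p"
        by (auto simp: B_def Pr_def)
      have union: "Pr z = Pr y \<union> B" "Pr y \<inter> B = {}"
        using z by (auto simp: B_def Pr_def)
      have mz: "m (Pr z) = m (Pr y) * m B"
        unfolding m_def union(1) using Pr(1) B(1) union(2) by (rule prod.union_disjoint)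
      have cop: "coprime (m (Pr y)) (m B)"
        unfolding m_def
      proof (intro prod_coprime_left prod_coprime_right)
        fix p q assume "p \<in> Pr y" "q \<in> B"
        then have "prime p" "prime q" "p \<noteq> q"
          using Pr(2) B(2) union(2) by auto
        then have "coprime p q"
          by (rule primes_coprime)
        then show "coprime (p ^ d) (q ^ d)"
          by simp
      qed
      have split: "(\<lambda>x. \<forall>p\<in>Pr z. \<not> bad p x) = (\<lambda>x. (\<forall>p\<in>Pr y. \<not> bad p x) \<and> (\<forall>p\<in>B. \<not> bad p x))"
        unfolding union(1) by auto
      have "D (Pr z) = D (Pr y) * D B"
        unfolding D_def mz split
        by (rule residue_density_of_mult[OF V mPr m0[OF B(2)] cop perPr[OF Pr] perPr[OF B(1,2)]])
      \<comment> \<open>The primes of \<open>B\<close> lie above \<open>y\<close>, where the tail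
        eventually removes less than half of the box; the bound passes to the limit.\<close>
      moreover have "D B \<ge> 1 / 2"
      proof (rule tendsto_lowerbound[OF lim[OF B(1,2)] _ F])
        show "eventually (\<lambda>r. 1 / 2 \<le> ratio B r) F"
          using loss[OF y(2)]
        proof eventually_elim
          case (elim r)
          have "X r \<subseteq> {x\<in>X r. \<forall>p\<in>B. \<not> bad p x} \<union> {x\<in>X r. \<exists>p. prime p \<and> y < p \<and> bad p x}"
            using B by blast
          then have "card (X r) \<le> card ({x\<in>X r. \<forall>p\<in>B. \<not> bad p x} \<union> {x\<in>X r. \<exists>p. prime p \<and> y < p \<and> bad p x})"
            using finX[of r] by (intro card_mono) auto
          also have "\<dots> \<le> card {x\<in>X r. \<forall>p\<in>B. \<not> bad p x} + card {x\<in>X r. \<exists>p. prime p \<and> y < p \<and> bad p x}"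
            by (rule card_Un_le)
          finally have "real (card (X r)) \<le> real (card {x\<in>X r. \<forall>p\<in>B. \<not> bad p x}) +
              real (card {x\<in>X r. \<exists>p. prime p \<and> y < p \<and> bad p x})"
            by linarith
          then have "1 \<le> ratio B r + loss y r"
            unfolding ratio_def loss_def add_divide_distrib[symmetric] using X0[of r] by (simp add: le_divide_eq)
          then show ?case
            using elim y(1) by linarith
        qed
      qed
      ultimately show ?thesis
        using Dy by simp
    qed
    have "P \<ge> D (Pr y) / 2"
      using half by (intro LIMSEQ_le_const[OF P]) blast
    then show ?thesis
      using Dy by linarith
  qed
  ultimately show ?thesis
    unfolding total_def X_def by blast
qed

section \<open>The density of power-free resultants\<close>

definition res_fun :: "nat \<Rightarrow> (nat \<Rightarrow> int) \<Rightarrow> int" where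
  "res_fun d x = resultant_sub d d (form_poly d 0 x) (form_poly d (d + 1) x)"

lemma form_resultant_eq_res_fun: "form_resultant d C = res_fun d (($) C)"
  by (simp add: form_resultant_def res_fun_def num_poly_def den_poly_def form_poly_def)

lemma polyfun_res_fun: "polyfun {..<2 * d + 2} (res_fun d)"
  unfolding res_fun_def resultant_sub_def
proof (rule polyfun_det[of _ "d + d"])
  have form: "polyfun {..<2 * d + 2} (\<lambda>x. coeff (form_poly d b x) k)" if "b \<le> d + 1" for b k
    unfolding coeff_form_poly using that by (cases "k \<le> d") (auto intro: polyfun.intros)
  fix r j assume rj: "r < d + d" "j < d + d"
  show "polyfun {..<2 * d + 2} (\<lambda>x. sylvester_mat_sub d d (form_poly d 0 x) (form_poly d (d + 1) x) $$ (r, j))"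
    unfolding sylvester_mat_sub_index[OF rj] by (intro polyfun_if polyfun_const form) auto
qed (rule sylvester_mat_sub_carrier)

lemma res_fun_cong: "(\<And>i. i < 2 * d + 2 \<Longrightarrow> x i = y i) \<Longrightarrow> res_fun d x = res_fun d y"
  by (rule polyfun_eq_on[OF polyfun_res_fun]) auto

lemma res_fun_scale: "res_fun d (\<lambda>i. h * x i) = h ^ (2 * d) * res_fun d x"
proof -
  have "form_poly d b (\<lambda>i. h * x i) = smult h (form_poly d b x)" for b
    by (rule poly_eqI) (simp add: coeff_form_poly)
  then show ?thesis
    by (simp add: res_fun_def resultant_sub_smult degree_form_poly)
qed

text \<open>Coordinates of vectors are numbered from \<open>0\<close>, the bounds in \<open>r\<close> from \<open>1\<close>.\<close>

definition radius :: "(nat \<Rightarrow> real) \<Rightarrow> nat \<Rightarrow> nat" where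
  "radius r i = nat \<lfloor>r (Suc i)\<rfloor>"

lemma radius_upd: "radius (r(Suc i := t)) = (radius r)(i := nat \<lfloor>t\<rfloor>)"
  by (auto simp: radius_def)

lemma filterlim_nat_floor: "filterlim (\<lambda>t :: real. nat \<lfloor>t\<rfloor>) at_top at_top"
  unfolding filterlim_at_top
proof
  fix Z
  show "eventually (\<lambda>t :: real. Z \<le> nat \<lfloor>t\<rfloor>) at_top"
    using eventually_ge_at_top[of "real Z"] by eventually_elim (simp add: le_nat_floor)
qed

lemma filterlim_radius:
  "i < 2 * d + 2 \<Longrightarrow> filterlim (\<lambda>r. radius r i) at_top (iterated_filter d n)"
  unfolding radius_def
  by (rule filterlim_compose[OF filterlim_nat_floor filterlim_coordinate_at_top]) auto

text \<open>The coordinate \<open>n\<close>, numbered from 1, lies in one of the two blocks. If it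
  belongs to the denominator, the forms are exchanged, which multiplies the resultant by
  (-1)^d.\<close>

lemma res_fun_tail:
  assumes d: "d \<ge> 2" and n: "n \<in> {1..2 * d + 2}"
  shows "\<exists>K. \<forall>z\<ge>2. eventually (\<lambda>r. real (card {x\<in>int_box {..<2 * d + 2} (radius r).
    \<exists>p. prime p \<and> z < p \<and> int p ^ d dvd res_fun d x})
      \<le> real K / real z * real (card (int_box {..<2 * d + 2} (radius r)))) (iterated_filter d n)"
proof -
  obtain j where j: "n = Suc j" "j < 2 * d + 2"
    using n by (cases n) auto
  obtain b b' i where b: "(b, b') = (0, d + 1) \<or> (b, b') = (d + 1, 0)" and i: "j = b + i" "i \<le> d"
  proof (cases "j \<le> d")
    case True
    then show ?thesis
      using that[of 0 "d + 1" j] by simp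
  next
    case False
    then show ?thesis
      using that[of "d + 1" 0 "j - (d + 1)"] j by simp
  qed
  define V where "V = {..<2 * d + 2} - {j}"
  have V: "insert j V = {..<2 * d + 2}"
    using j by (auto simp: V_def)
  have dvd_iff: "int p ^ d dvd poly (fiber_resultant d b b' j x) (x j) \<longleftrightarrow> int p ^ d dvd res_fun d x" for p x
  proof (cases "b = 0")
    case True
    then show ?thesis
      using b by (simp add: poly_fiber_resultant res_fun_def)
  next
    case False
    then have "b = d + 1" "b' = 0"
      using b by auto
    then have "poly (fiber_resultant d b b' j x) (x j) = (- 1) ^ d * res_fun d x"
      using resultant_sub_linear_combination[OF degree_form_poly degree_form_poly, of d 0 0 x 1 "d + 1" x 1 0]
      by (simp add: poly_fiber_resultant res_fun_def)
    then show ?thesis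
      by (cases "even d") auto
  qed
  obtain K where K: "\<And>z R. z \<ge> 2 \<Longrightarrow> (\<forall>i\<in>V. R i \<ge> z) \<Longrightarrow> eventually (\<lambda>T.
      real (card {x\<in>int_box {..<2 * d + 2} (R(j := T)). \<exists>p. prime p \<and> z < p \<and> int p ^ d dvd res_fun d x})
      \<le> real K / real z * real (card (int_box {..<2 * d + 2} (R(j := T))))) at_top"
    using resultant_tail[OF d b i] unfolding V_def[symmetric] V dvd_iff by blast
  show ?thesis
  proof (intro exI[of _ K] allI impI)
    fix z :: nat assume z: "z \<ge> 2"
    let ?P = "\<lambda>R. real (card {x\<in>int_box {..<2 * d + 2} R. \<exists>p. prime p \<and> z < p \<and> int p ^ d dvd res_fun d x})
      \<le> real K / real z * real (card (int_box {..<2 * d + 2} R))"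
    have "eventually (\<lambda>t. ?P (radius (r(n := t)))) at_top"
      if r: "\<forall>i\<in>{1..2 * d + 2} - {n}. r i \<ge> real z" for r
    proof -
      have "z \<le> radius r i" if "i \<in> V" for i
      proof -
        have "real z \<le> r (Suc i)"
          using r that j by (auto simp: V_def)
        then show ?thesis
          by (simp add: radius_def le_nat_floor)
      qed
      then have "eventually (\<lambda>T. ?P ((radius r)(j := T))) at_top"
        using K[OF z] by blast
      from eventually_compose_filterlim[OF this filterlim_nat_floor] show ?thesis
        unfolding j radius_upd .
    qed
    then show "eventually (\<lambda>r. ?P (radius r)) (iterated_filter d n)"
      unfolding eventually_iterated_filter eventually_others_at_top by (intro exI[of _ "real z"] allI impI)
  qed
qed

section \<open>Integer vectors in boxes, primitivity and sign\<close>

definition vec_box :: "nat \<Rightarrow> (nat \<Rightarrow> real) \<Rightarrow> int vec set" where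
  "vec_box N r = {C \<in> carrier_vec N. \<forall>i\<in>{1..N}. \<bar>real_of_int (C $ (i - 1))\<bar> \<le> r i}"

lemma bij_betw_vec_box:
  assumes r: "\<And>i. i \<in> {1..N} \<Longrightarrow> r i \<ge> 0"
  shows "bij_betw (vec N) (int_box {..<N} (radius r)) (vec_box N r)"
proof -
  have iff: "\<bar>real_of_int y\<bar> \<le> r (Suc i) \<longleftrightarrow> y \<in> {-int (radius r i)..int (radius r i)}" if "i < N" for y i
  proof -
    have "\<bar>real_of_int y\<bar> \<le> r (Suc i) \<longleftrightarrow> \<bar>y\<bar> \<le> \<lfloor>r (Suc i)\<rfloor>"
      by (simp add: le_floor_iff)
    also have "\<dots> \<longleftrightarrow> \<bar>y\<bar> \<le> int (radius r i)"
      using r[of "Suc i"] that by (simp add: radius_def)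
    finally show ?thesis
      by auto
  qed
  show ?thesis
    unfolding bij_betw_def
  proof
    show "inj_on (vec N) (int_box {..<N} (radius r))"
    proof (rule inj_onI)
      fix x y assume xy: "x \<in> int_box {..<N} (radius r)" "y \<in> int_box {..<N} (radius r)" "vec N x = vec N y"
      show "x = y"
      proof (rule PiE_ext)
        show "x i = y i" if "i \<in> {..<N}" for i
          using arg_cong[OF xy(3), of "\<lambda>v. v $ i"] that by simp
      qed (use xy in \<open>auto simp: int_box_def\<close>)
    qed
    show "vec N ` int_box {..<N} (radius r) = vec_box N r"
    proof (intro equalityI subsetI)
      fix C assume "C \<in> vec N ` int_box {..<N} (radius r)"
      then obtain x where x: "x \<in> int_box {..<N} (radius r)" "C = vec N x"
        by blast
      have "\<bar>real_of_int (C $ (i - 1))\<bar> \<le> r i" if i: "i \<in> {1..N}" for i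
      proof -
        obtain k where k: "i = Suc k" "k < N"
          using i by (cases i) auto
        then have "x k \<in> {-int (radius r k)..int (radius r k)}"
          using PiE_mem[OF x(1)[unfolded int_box_def], of k] by blast
        then have "\<bar>real_of_int (x k)\<bar> \<le> r (Suc k)"
          using iff[OF k(2), of "x k"] by blast
        then show ?thesis
          using k x(2) by simp
      qed
      then show "C \<in> vec_box N r"
        using x(2) by (simp add: vec_box_def)
    next
      fix C assume C: "C \<in> vec_box N r"
      have "restrict (($) C) {..<N} \<in> int_box {..<N} (radius r)"
        unfolding int_box_def restrict_PiE_iff
      proof
        fix i assume i: "i \<in> {..<N}"
        have "\<forall>i\<in>{1..N}. \<bar>real_of_int (C $ (i - 1))\<bar> \<le> r i"
          using C by (simp add: vec_box_def)
        from bspec[OF this, of "Suc i"] have "\<bar>real_of_int (C $ i)\<bar> \<le> r (Suc i)"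
          using i by simp
        then show "C $ i \<in> {-int (radius r i)..int (radius r i)}"
          using iff[of i "C $ i"] i by blast
      qed
      moreover have "C = vec N (restrict (($) C) {..<N})"
        using C by (intro eq_vecI) (auto simp: vec_box_def)
      ultimately show "C \<in> vec N ` int_box {..<N} (radius r)"
        by blast
    qed
  qed
qed

text \<open>A negative radius makes the box empty; this case is included because ratios are later
  compared for all \<open>r\<close>.\<close>

lemma finite_vec_box: "finite (vec_box N r)"
proof (cases "\<forall>i\<in>{1..N}. r i \<ge> 0")
  case True
  then have "bij_betw (vec N) (int_box {..<N} (radius r)) (vec_box N r)"
    by (intro bij_betw_vec_box) auto
  then show ?thesis
    using bij_betw_finite finite_int_box by blast
next
  case False
  then obtain i where i: "i \<in> {1..N}" "r i < 0"
    by force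
  have "vec_box N r = {}"
  proof (rule ccontr)
    assume "vec_box N r \<noteq> {}"
    then obtain C where "C \<in> vec_box N r"
      by blast
    then have "\<bar>real_of_int (C $ (i - 1))\<bar> \<le> r i"
      using i(1) by (simp add: vec_box_def)
    then show False
      using i(2) by linarith
  qed
  then show ?thesis
    by simp
qed

text \<open>\<open>Q\<close> may look only at the first \<open>N\<close> coordinates, since
  \<open>($) C\<close> has no meaningful values beyond the dimension.\<close>

lemma card_vec_box_Collect:
  assumes r: "\<And>i. i \<in> {1..N} \<Longrightarrow> r i \<ge> 0"
    and Q: "\<And>x y. (\<And>i. i < N \<Longrightarrow> x i = y i) \<Longrightarrow> Q x = Q y"
  shows "card {C\<in>vec_box N r. Q (($) C)} = card {x\<in>int_box {..<N} (radius r). Q x}"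
proof -
  have bij: "bij_betw (vec N) (int_box {..<N} (radius r)) (vec_box N r)"
    using r by (rule bij_betw_vec_box)
  have "{C\<in>vec_box N r. Q (($) C)} = vec N ` {x\<in>int_box {..<N} (radius r). Q x}"
  proof -
    have "Q (($) (vec N x)) = Q x" for x
      by (rule Q) simp
    then show ?thesis
      unfolding bij_betw_imp_surj_on[OF bij, symmetric] by auto
  qed
  moreover have "inj_on (vec N) {x\<in>int_box {..<N} (radius r). Q x}"
    using bij_betw_imp_inj_on[OF bij] by (rule inj_on_subset) auto
  ultimately show ?thesis
    by (simp add: card_image)
qed

definition first_positive :: "nat \<Rightarrow> int vec \<Rightarrow> bool" where
  "first_positive N C \<longleftrightarrow> (\<exists>i<N. C $ i > 0 \<and> (\<forall>j<i. C $ j = 0))"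

lemma first_positive_cases:
  assumes C: "C \<in> carrier_vec N" and nz: "\<exists>i<N. C $ i \<noteq> 0"
  shows "first_positive N (- C) \<longleftrightarrow> \<not> first_positive N C"
proof -
  define k where "k = (LEAST i. i < N \<and> C $ i \<noteq> 0)"
  have k: "k < N" "C $ k \<noteq> 0"
    using LeastI_ex[of "\<lambda>i. i < N \<and> C $ i \<noteq> 0"] nz unfolding k_def by blast+
  have below: "C $ j = 0" if "j < k" for j
    using not_less_Least[of j "\<lambda>i. i < N \<and> C $ i \<noteq> 0"] that k(1) unfolding k_def by auto
  have "first_positive N C \<longleftrightarrow> C $ k > 0"
  proof
    assume "first_positive N C"
    then obtain i where i: "i < N" "C $ i > 0" "\<forall>j<i. C $ j = 0"
      by (auto simp: first_positive_def)
    then have "\<not> k < i" "\<not> i < k"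
      using k below by auto
    then show "C $ k > 0"
      using i(2) by simp
  qed (use k below in \<open>auto simp: first_positive_def\<close>)
  moreover have "first_positive N (- C) \<longleftrightarrow> C $ k < 0"
  proof
    assume "first_positive N (- C)"
    then obtain i where i: "i < N" "(- C) $ i > 0" "\<forall>j<i. (- C) $ j = 0"
      by (auto simp: first_positive_def)
    then have "C $ i < 0" "\<forall>j<i. C $ j = 0"
      using C by auto
    then have "\<not> k < i" "\<not> i < k"
      using k below by auto
    then show "C $ k < 0"
      using \<open>C $ i < 0\<close> by simp
  qed (use C k below in \<open>auto simp: first_positive_def intro!: exI[of _ k]\<close>)
  ultimately show ?thesis
    using k(2) by linarith
qed

text \<open>Negation exchanges the vectors with positive and with negative first nonzero coordinate.\<close>

lemma card_first_positive:
  assumes sym: "\<And>C. C \<in> carrier_vec N \<Longrightarrow> Q (- C) = Q C"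
    and nz: "\<And>C. C \<in> carrier_vec N \<Longrightarrow> Q C \<Longrightarrow> \<exists>i<N. C $ i \<noteq> 0"
  shows "card {C\<in>vec_box N r. Q C} = 2 * card {C\<in>vec_box N r. Q C \<and> first_positive N C}"
proof -
  let ?pos = "{C\<in>vec_box N r. Q C \<and> first_positive N C}"
  let ?neg = "{C\<in>vec_box N r. Q C \<and> \<not> first_positive N C}"
  have carrier: "C \<in> carrier_vec N" if "C \<in> vec_box N r" for C
    using that by (simp add: vec_box_def)
  have box: "- C \<in> vec_box N r" if "C \<in> vec_box N r" for C
    using that by (auto simp: vec_box_def)
  have neg: "?neg = uminus ` ?pos"
  proof (intro equalityI subsetI)
    fix C assume C: "C \<in> ?neg"
    then have "C \<in> carrier_vec N" "Q C"
      using carrier by auto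
    then have "- C \<in> ?pos"
      using C box sym nz first_positive_cases[of C N] by auto
    then show "C \<in> uminus ` ?pos"
      by (metis image_eqI uminus_uminus_vec)
  next
    fix C assume "C \<in> uminus ` ?pos"
    then obtain B where B: "B \<in> ?pos" "C = - B"
      by blast
    then have "B \<in> carrier_vec N" "Q B"
      using carrier by auto
    then show "C \<in> ?neg"
      using B box sym nz first_positive_cases[of B N] by auto
  qed
  have "inj_on uminus ?pos"
    by (rule inj_onI) (metis uminus_uminus_vec)
  then have "card ?neg = card ?pos"
    unfolding neg by (rule card_image)
  moreover have "{C\<in>vec_box N r. Q C} = ?pos \<union> ?neg"
    by auto
  moreover have "card (?pos \<union> ?neg) = card ?pos + card ?neg"
    using finite_vec_box[of N r] by (intro card_Un_disjoint) auto
  ultimately show ?thesis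
    by simp
qed

text \<open>Turns primitivity into local conditions at the primes, to which the sieve
  applies.\<close>

lemma Gcd_set_vec_eq_1_iff:
  fixes C :: "int vec"
  assumes "C \<in> carrier_vec N"
  shows "Gcd (set\<^sub>v C) = 1 \<longleftrightarrow> (\<forall>p. prime p \<longrightarrow> \<not> (\<forall>i<N. int p dvd C $ i))"
proof -
  have set: "set\<^sub>v C = ($) C ` {..<N}"
    using assms by (auto simp: vec_set_def)
  have dvd: "int p dvd Gcd (set\<^sub>v C) \<longleftrightarrow> (\<forall>i<N. int p dvd C $ i)" for p
    by (auto simp: dvd_Gcd_iff set)
  show ?thesis
  proof
    assume "Gcd (set\<^sub>v C) = 1"
    then show "\<forall>p. prime p \<longrightarrow> \<not> (\<forall>i<N. int p dvd C $ i)"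
      unfolding dvd[symmetric] by auto
  next
    assume no: "\<forall>p. prime p \<longrightarrow> \<not> (\<forall>i<N. int p dvd C $ i)"
    show "Gcd (set\<^sub>v C) = 1"
    proof (rule ccontr)
      assume "Gcd (set\<^sub>v C) \<noteq> 1"
      then have "nat (Gcd (set\<^sub>v C)) \<noteq> 1"
        by linarith
      then obtain p where "prime p" "p dvd nat (Gcd (set\<^sub>v C))"
        using prime_factor_nat by blast
      then have "int p dvd int (nat (Gcd (set\<^sub>v C)))"
        by (simp only: int_dvd_int_iff)
      then have "int p dvd Gcd (set\<^sub>v C)"
        by simp
      then show False
        using no \<open>prime p\<close> dvd by blast
    qed
  qed
qed

lemma dvd_res_fun_cong:
  assumes "\<forall>i\<in>{..<2 * d + 2}. m dvd x i - y i"
  shows "m dvd res_fun d x \<longleftrightarrow> m dvd res_fun d y"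
proof -
  have "m dvd res_fun d x - res_fun d y"
    using assms by (intro polyfun_cong_mod[OF polyfun_res_fun]) auto
  from dvd_diff_right_iff[OF this] show ?thesis
    by (metis \<open>m dvd res_fun d x - res_fun d y\<close> dvd_add_right_iff diff_add_cancel)
qed

definition bad_resultant :: "nat \<Rightarrow> nat set \<Rightarrow> nat \<Rightarrow> (nat \<Rightarrow> int) \<Rightarrow> bool" where
  "bad_resultant d \<Sigma> p x \<longleftrightarrow> int p ^ d dvd res_fun d x \<or> p \<in> \<Sigma> \<and> int p dvd res_fun d x"

definition common_divisor :: "nat \<Rightarrow> nat \<Rightarrow> (nat \<Rightarrow> int) \<Rightarrow> bool" where
  "common_divisor d p x \<longleftrightarrow> (\<forall>i<2 * d + 2. int p dvd x i)"

text \<open>The resultant is homogeneous of degree \<open>2 * d\<close>. Hence power-freeness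
  implies primitivity, and the tail bound for the resultant serves for primitivity as well.\<close>

lemma common_divisor_imp_dvd_res_fun:
  assumes "common_divisor d p x"
  shows "int p ^ d dvd res_fun d x"
proof -
  define y where "y i = x i div int p" for i
  have "res_fun d x = res_fun d (\<lambda>i. int p * y i)"
    using assms by (intro res_fun_cong) (simp add: common_divisor_def y_def)
  then have "res_fun d x = int p ^ (2 * d) * res_fun d y"
    by (simp add: res_fun_scale)
  then show ?thesis
    by (simp add: mult_2 power_add)
qed

lemma periodic_on_bad_resultant:
  assumes "d > 0"
  shows "periodic_on {..<2 * d + 2} (p ^ d) (bad_resultant d \<Sigma> p)"
  unfolding periodic_on_def
proof (intro allI impI)
  fix x y assume xy: "\<forall>i\<in>{..<2 * d + 2}. int (p ^ d) dvd x i - y i"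
  have "int p dvd int p ^ d"
    using assms by (simp add: dvd_power)
  then have "\<forall>i\<in>{..<2 * d + 2}. int p dvd x i - y i"
    using xy dvd_trans[OF \<open>int p dvd int p ^ d\<close>] by simp
  then show "bad_resultant d \<Sigma> p x = bad_resultant d \<Sigma> p y"
    using dvd_res_fun_cong[of d "int p ^ d" x y] dvd_res_fun_cong[of d "int p" x y] xy
    by (simp add: bad_resultant_def)
qed

text \<open>The modulus \<open>p ^ d\<close> matches the form in which \<open>sieve_density\<close>
  takes its local conditions.\<close>

lemma periodic_on_common_divisor:
  assumes "d > 0"
  shows "periodic_on {..<2 * d + 2} (p ^ d) (common_divisor d p)"
  unfolding periodic_on_def
proof (intro allI impI)
  fix x y assume xy: "\<forall>i\<in>{..<2 * d + 2}. int (p ^ d) dvd x i - y i"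
  have "int p dvd int p ^ d"
    using assms by (simp add: dvd_power)
  then have "int p dvd x i - y i" if "i < 2 * d + 2" for i
    using xy that dvd_trans[OF \<open>int p dvd int p ^ d\<close>] by simp
  then have "int p dvd x i \<longleftrightarrow> int p dvd y i" if "i < 2 * d + 2" for i
    using that by (metis dvd_add_right_iff diff_add_cancel)
  then show "common_divisor d p x = common_divisor d p y"
    by (simp add: common_divisor_def)
qed

lemma good_vector_exists: "\<exists>x. \<forall>p. prime p \<longrightarrow> \<not> bad_resultant d \<Sigma> p x" if "d > 0"
proof -
  \<comment> \<open>The coefficient vector of z^d, with A_d = B_0 = 1; the index of B_0 is d +
    1.\<close>
  define x :: "nat \<Rightarrow> int" where "x i = of_bool (i = d \<or> i = d + 1)" for i
  have F: "form_poly d 0 x = monom 1 d" "form_poly d (d + 1) x = monom 1 0"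
    by (auto intro!: poly_eqI simp: coeff_form_poly x_def)
  obtain s :: int where "s \<in> {1, -1}" "res_fun d x = s"
    using resultant_sub_monom[of d d d "monom 1 0 :: int poly"] unfolding res_fun_def F by auto
  then have unit: "res_fun d x dvd 1"
    by auto
  have "\<not> bad_resultant d \<Sigma> p x" if p: "prime p" for p
  proof
    assume "bad_resultant d \<Sigma> p x"
    then have "int p dvd res_fun d x"
      using \<open>d > 0\<close> by (auto simp: bad_resultant_def intro: dvd_trans[OF dvd_power])
    then have "int p dvd 1"
      using unit dvd_trans by blast
    then show False
      using p by simp
  qed
  then show ?thesis
    by blast
qed

lemma bad_resultant_tail:
  assumes d: "d \<ge> 2" and n: "n \<in> {1..2 * d + 2}" and \<Sigma>: "finite \<Sigma>"
  shows "\<exists>K. \<forall>z\<ge>2. eventually (\<lambda>r. real (card {x\<in>int_box {..<2 * d + 2} (radius r).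
    \<exists>p. prime p \<and> z < p \<and> bad_resultant d \<Sigma> p x})
      \<le> real K / real z * real (card (int_box {..<2 * d + 2} (radius r)))) (iterated_filter d n)"
proof -
  obtain K where K: "\<And>z. z \<ge> 2 \<Longrightarrow> eventually (\<lambda>r. real (card {x\<in>int_box {..<2 * d + 2} (radius r).
    \<exists>p. prime p \<and> z < p \<and> int p ^ d dvd res_fun d x})
      \<le> real K / real z * real (card (int_box {..<2 * d + 2} (radius r)))) (iterated_filter d n)"
    using res_fun_tail[OF d n] by blast
  define M where "M = Max (insert 0 \<Sigma>)"
  have M: "p \<le> M" if "p \<in> \<Sigma>" for p
    using \<Sigma> that by (simp add: M_def)
  let ?X = "\<lambda>r. int_box {..<2 * d + 2} (radius r)"
  \<comment> \<open>For \<open>z \<le> M\<close> the summand \<open>M\<close> makes the bound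
    trivial; for larger \<open>z\<close> no prime in the tail belongs to \<Sigma>.\<close>
  show ?thesis
  proof (intro exI[of _ "K + M"] allI impI)
    fix z :: nat assume z: "z \<ge> 2"
    show "eventually (\<lambda>r. real (card {x\<in>?X r. \<exists>p. prime p \<and> z < p \<and> bad_resultant d \<Sigma> p x})
      \<le> real (K + M) / real z * real (card (?X r))) (iterated_filter d n)"
      using K[OF z]
    proof eventually_elim
      case (elim r)
      show ?case
      proof (cases "z \<le> M")
        case True
        have "real (card {x\<in>?X r. \<exists>p. prime p \<and> z < p \<and> bad_resultant d \<Sigma> p x}) \<le> 1 * real (card (?X r))"
          by (simp add: card_mono finite_int_box)
        also have "\<dots> \<le> real (K + M) / real z * real (card (?X r))"
          using True z by (intro mult_right_mono) (auto simp: le_divide_eq)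
        finally show ?thesis .
      next
        case False
        have "bad_resultant d \<Sigma> p x \<longleftrightarrow> int p ^ d dvd res_fun d x" if "z < p" for p x
          using False M[of p] that by (auto simp: bad_resultant_def)
        then have "{x\<in>?X r. \<exists>p. prime p \<and> z < p \<and> bad_resultant d \<Sigma> p x} =
            {x\<in>?X r. \<exists>p. prime p \<and> z < p \<and> int p ^ d dvd res_fun d x}"
          by blast
        then have "real (card {x\<in>?X r. \<exists>p. prime p \<and> z < p \<and> bad_resultant d \<Sigma> p x}) \<le>
            real K / real z * real (card (?X r))"
          using elim by simp
        also have "\<dots> \<le> real (K + M) / real z * real (card (?X r))"
          by (intro mult_right_mono divide_right_mono) auto
        finally show ?thesis .
      qed
    qed
  qed
qed

lemma common_divisor_tail:
  assumes d: "d \<ge> 2" and n: "n \<in> {1..2 * d + 2}"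
  shows "\<exists>K. \<forall>z\<ge>2. eventually (\<lambda>r. real (card {x\<in>int_box {..<2 * d + 2} (radius r).
    \<exists>p. prime p \<and> z < p \<and> common_divisor d p x})
      \<le> real K / real z * real (card (int_box {..<2 * d + 2} (radius r)))) (iterated_filter d n)"
proof -
  obtain K where K: "\<And>z. z \<ge> 2 \<Longrightarrow> eventually (\<lambda>r. real (card {x\<in>int_box {..<2 * d + 2} (radius r).
    \<exists>p. prime p \<and> z < p \<and> int p ^ d dvd res_fun d x})
      \<le> real K / real z * real (card (int_box {..<2 * d + 2} (radius r)))) (iterated_filter d n)"
    using res_fun_tail[OF d n] by blast
  let ?X = "\<lambda>r. int_box {..<2 * d + 2} (radius r)"
  show ?thesis
  proof (intro exI[of _ K] allI impI)
    fix z :: nat assume z: "z \<ge> 2"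
    have "real (card {x\<in>?X r. \<exists>p. prime p \<and> z < p \<and> common_divisor d p x}) \<le>
        real (card {x\<in>?X r. \<exists>p. prime p \<and> z < p \<and> int p ^ d dvd res_fun d x})" for r
      using common_divisor_imp_dvd_res_fun
      by (intro of_nat_mono card_mono) (auto simp: finite_int_box)
    from order_trans[OF this] K[OF z]
    show "eventually (\<lambda>r. real (card {x\<in>?X r. \<exists>p. prime p \<and> z < p \<and> common_divisor d p x})
      \<le> real K / real z * real (card (?X r))) (iterated_filter d n)"
      by (rule eventually_mono[rotated])
  qed
qed

lemma proj_points_eq:
  "proj_points (2 * d + 1) = {C \<in> carrier_vec (2 * d + 2).
    (\<forall>p. prime p \<longrightarrow> \<not> common_divisor d p (($) C)) \<and> first_positive (2 * d + 2) C}"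
proof -
  have "(\<exists>i\<le>2 * d + 1. C $ i > 0 \<and> (\<forall>j<i. C $ j = 0)) \<longleftrightarrow> first_positive (2 * d + 2) C" for C :: "int vec"
    unfolding first_positive_def by (metis Suc_eq_plus1 add_Suc_right less_Suc_eq_le one_add_one)
  then show ?thesis
    using Gcd_set_vec_eq_1_iff[of _ "2 * d + 2"] by (auto simp: proj_points_def common_divisor_def)
qed

lemma box_points_eq:
  assumes "S = {C \<in> carrier_vec (2 * d + 2). Q C \<and> first_positive (2 * d + 2) C}"
  shows "box_points d S r = {C \<in> vec_box (2 * d + 2) r. Q C \<and> first_positive (2 * d + 2) C}"
  using assms by (auto simp: box_points_def vec_box_def)

lemma coeff_vec_power_free_res_maps_eq:
  assumes "d > 0" and \<Sigma>: "\<forall>p\<in>\<Sigma>. prime p"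
  shows "coeff_vec ` power_free_res_maps d \<Sigma> = {C \<in> carrier_vec (2 * d + 2).
    (\<forall>p. prime p \<longrightarrow> \<not> bad_resultant d \<Sigma> p (($) C)) \<and> first_positive (2 * d + 2) C}"
proof -
  have "(\<forall>p. prime p \<longrightarrow> \<not> bad_resultant d \<Sigma> p x) \<longleftrightarrow>
      (\<forall>p. prime p \<longrightarrow> \<not> int p ^ d dvd res_fun d x) \<and> (\<forall>p\<in>\<Sigma>. \<not> int p dvd res_fun d x)" for x
    using \<Sigma> by (auto simp: bad_resultant_def)
  moreover have "\<not> int p ^ d dvd res_fun d x \<Longrightarrow> \<not> common_divisor d p x" for p x
    using common_divisor_imp_dvd_res_fun by blast
  ultimately show ?thesis
    unfolding coeff_vec_power_free_res_maps[OF assms(1)] proj_points_eq form_resultant_eq_res_fun by blast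
qed

text \<open>The factor 2 undoes the sign normalization. The hypothesis \<open>zero\<close> excludes
  the zero vector, the only one fixed by negation.\<close>

lemma card_box_points:
  fixes bad :: "nat \<Rightarrow> (nat \<Rightarrow> int) \<Rightarrow> bool"
  assumes S: "S = {C \<in> carrier_vec (2 * d + 2). (\<forall>p. prime p \<longrightarrow> \<not> bad p (($) C)) \<and> first_positive (2 * d + 2) C}"
    and cong: "\<And>p x y. (\<And>i. i < 2 * d + 2 \<Longrightarrow> x i = y i) \<Longrightarrow> bad p x = bad p y"
    and sym: "\<And>p x. bad p (\<lambda>i. - x i) = bad p x" and zero: "\<And>p. prime p \<Longrightarrow> bad p (\<lambda>_. 0)"
    and r: "\<And>i. i \<in> {1..2 * d + 2} \<Longrightarrow> r i \<ge> 0"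
  shows "2 * card (box_points d S r) = card {x\<in>int_box {..<2 * d + 2} (radius r). \<forall>p. prime p \<longrightarrow> \<not> bad p x}"
proof -
  let ?N = "2 * d + 2"
  let ?Q = "\<lambda>C :: int vec. \<forall>p. prime p \<longrightarrow> \<not> bad p (($) C)"
  have "card {C\<in>vec_box ?N r. ?Q C} = 2 * card {C\<in>vec_box ?N r. ?Q C \<and> first_positive ?N C}"
  proof (rule card_first_positive)
    fix C :: "int vec" assume C: "C \<in> carrier_vec ?N"
    have "bad p (($) (- C)) = bad p (\<lambda>i. - (C $ i))" for p
      using C by (intro cong) auto
    then show "?Q (- C) = ?Q C"
      by (simp add: sym)
    show "\<exists>i<?N. C $ i \<noteq> 0" if "?Q C"
    proof (rule ccontr)
      assume "\<not> (\<exists>i<?N. C $ i \<noteq> 0)"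
      then have "bad 2 (($) C) = bad 2 (\<lambda>_. 0)"
        by (intro cong) auto
      then show False
        using that zero two_is_prime_nat by blast
    qed
  qed
  moreover have "card {C\<in>vec_box ?N r. ?Q C} = card {x\<in>int_box {..<?N} (radius r). \<forall>p. prime p \<longrightarrow> \<not> bad p x}"
  proof (rule card_vec_box_Collect[OF r])
    show "(\<forall>p. prime p \<longrightarrow> \<not> bad p x) = (\<forall>p. prime p \<longrightarrow> \<not> bad p y)"
      if "\<And>i. i < ?N \<Longrightarrow> x i = y i" for x y
      using cong[OF that] by simp
  qed
  ultimately show ?thesis
    unfolding box_points_eq[OF S] by simp
qed

text \<open>Admissible and primitive vectors are both counted against the full integer box. A vector
  that is good for the resultant is also primitive, so both densities are positive and can be
  divided.\<close>

lemma power_free_box_density: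
  assumes d: "d \<ge> 2" and n: "n \<in> {1..2 * d + 2}" and \<Sigma>: "finite \<Sigma>" "\<forall>p\<in>\<Sigma>. prime p"
  shows "\<exists>\<mu>>0. has_weak_box_density d n (coeff_vec ` power_free_res_maps d \<Sigma>) \<mu>"
proof -
  let ?N = "2 * d + 2" and ?F = "iterated_filter d n"
  let ?X = "\<lambda>r. int_box {..<2 * d + 2} (radius r)"
  let ?V = "coeff_vec ` power_free_res_maps d \<Sigma>" and ?P = "proj_points (2 * d + 1)"
  let ?bad = "bad_resultant d \<Sigma>" and ?div = "common_divisor d"
  have d0: "d > 0"
    using d by simp
  define density :: "(nat \<Rightarrow> (nat \<Rightarrow> int) \<Rightarrow> bool) \<Rightarrow> (nat \<Rightarrow> real) \<Rightarrow> real" where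
    "density bad r = real (card {x\<in>?X r. \<forall>p. prime p \<longrightarrow> \<not> bad p x}) / real (card (?X r))" for bad r
  have radius: "filterlim (\<lambda>r. radius r i) at_top ?F" if "i \<in> {..<?N}" for i
    using that by (intro filterlim_radius) simp
  obtain K1 where K1: "\<And>z. z \<ge> 2 \<Longrightarrow> eventually (\<lambda>r. real (card {x\<in>?X r. \<exists>p. prime p \<and> z < p \<and> ?bad p x})
      \<le> real K1 / real z * real (card (?X r))) ?F"
    using bad_resultant_tail[OF d n \<Sigma>(1)] by blast
  obtain K2 where K2: "\<And>z. z \<ge> 2 \<Longrightarrow> eventually (\<lambda>r. real (card {x\<in>?X r. \<exists>p. prime p \<and> z < p \<and> ?div p x})
      \<le> real K2 / real z * real (card (?X r))) ?F"
    using common_divisor_tail[OF d n] by blast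
  obtain x where x: "\<forall>p. prime p \<longrightarrow> \<not> ?bad p x"
    using good_vector_exists[OF d0] by blast
  then have x': "\<forall>p. prime p \<longrightarrow> \<not> ?div p x"
    using common_divisor_imp_dvd_res_fun by (auto simp: bad_resultant_def)
  obtain \<alpha> where \<alpha>: "(density ?bad \<longlongrightarrow> \<alpha>) ?F" "\<alpha> > 0"
    using sieve_density[OF _ iterated_filter_neq_bot radius periodic_on_bad_resultant[OF d0] K1] x
    unfolding density_def by blast
  obtain \<beta> where \<beta>: "(density ?div \<longlongrightarrow> \<beta>) ?F" "\<beta> > 0"
    using sieve_density[OF _ iterated_filter_neq_bot radius periodic_on_common_divisor[OF d0] K2] x'
    unfolding density_def by blast
  have "((\<lambda>r. density ?bad r / density ?div r) \<longlongrightarrow> \<alpha> / \<beta>) ?F"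
    using \<alpha> \<beta> by (intro tendsto_divide) auto
  moreover have "eventually (\<lambda>r. density ?bad r / density ?div r = box_ratio d ?V r) ?F"
  proof -
    \<comment> \<open>\<open>radius\<close> truncates negative bounds to 0, where
      \<open>int_box\<close> no longer matches the real box; such radii are discarded first.\<close>
    have "eventually (\<lambda>r. \<forall>i\<in>{1..?N}. r i \<ge> 0) ?F"
      using filterlim_coordinate_at_top[of _ d n] by (intro eventually_ball_finite) (auto simp: filterlim_at_top)
    then show ?thesis
    proof eventually_elim
      case (elim r)
      have V: "2 * card (box_points d ?V r) = card {x\<in>?X r. \<forall>p. prime p \<longrightarrow> \<not> ?bad p x}"
      proof (rule card_box_points[OF coeff_vec_power_free_res_maps_eq[OF d0 \<Sigma>(2)]])
        show "?bad p x = ?bad p y" if "\<And>i. i < ?N \<Longrightarrow> x i = y i" for p x y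
          using res_fun_cong[OF that] by (simp add: bad_resultant_def)
        have "res_fun d (\<lambda>i. - x i) = res_fun d x" for x
          using res_fun_scale[of d "- 1" x] by simp
        then show "?bad p (\<lambda>i. - x i) = ?bad p x" for p x
          by (simp add: bad_resultant_def)
        have "res_fun d (\<lambda>_. 0) = 0"
          using res_fun_scale[of d 0 "\<lambda>_. 0"] d0 by (simp add: power_0_left)
        then show "?bad p (\<lambda>_. 0)" for p
          by (simp add: bad_resultant_def)
      qed (use elim in auto)
      have P: "2 * card (box_points d ?P r) = card {x\<in>?X r. \<forall>p. prime p \<longrightarrow> \<not> ?div p x}"
        by (rule card_box_points[OF proj_points_eq]) (use elim in \<open>auto simp: common_divisor_def\<close>)
      have "card (?X r) > 0"
        unfolding card_int_box[OF finite_lessThan] by (rule prod_pos) simp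
      then show ?case
        unfolding density_def V[symmetric] P[symmetric] box_ratio_def by simp
    qed
  qed
  ultimately have "(box_ratio d ?V \<longlongrightarrow> \<alpha> / \<beta>) ?F"
    by (rule Lim_transform_eventually)
  then show ?thesis
    using has_weak_box_densityI \<alpha>(2) \<beta>(2) by (intro exI[of _ "\<alpha> / \<beta>"]) simp
qed


theorem theoremB:
  fixes d n :: nat and \<Sigma> :: "nat set"
  assumes "d \<ge> 2" and "n \<in> {1..2 * d + 2}"
    and "finite \<Sigma>" and "\<forall>p\<in>\<Sigma>. prime p"
  shows "(\<forall>\<phi>\<in>power_free_res_maps d \<Sigma>. globally_minimal \<phi>) \<and>
         (\<exists>\<mu>>0. has_weak_box_density d n (coeff_vec ` power_free_res_maps d \<Sigma>) \<mu>) \<and>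
         lower_weak_box_density d n (coeff_vec ` good_minimal_maps d \<Sigma>) > 0"
proof -
  let ?V = "coeff_vec ` power_free_res_maps d \<Sigma>" and ?M = "coeff_vec ` good_minimal_maps d \<Sigma>"
  have minimal: "\<forall>\<phi>\<in>power_free_res_maps d \<Sigma>. globally_minimal \<phi>"
    using power_free_imp_globally_minimal[of d _ \<Sigma>] assms(1) by auto
  obtain \<mu> where \<mu>: "\<mu> > 0" "has_weak_box_density d n ?V \<mu>"
    using power_free_box_density[OF assms] by blast
  have "?V \<subseteq> ?M"
    using minimal by (auto simp: power_free_res_maps_def good_minimal_maps_def)
  \<comment> \<open>Monotonicity of \<open>card\<close> needs the larger set to be finite, as an
    infinite set would have cardinality 0.\<close>
  have "box_points d ?M r \<subseteq> vec_box (2 * d + 2) r" for r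
  proof -
    have "C \<in> carrier_vec (2 * d + 2)" if C: "C \<in> ?M" for C
    proof -
      obtain \<phi> where "\<phi> \<in> good_minimal_maps d \<Sigma>" "C = coeff_vec \<phi>"
        using C by blast
      then have "C \<in> proj_points (2 * d + 1)"
        using is_coeff_vec_coeff_vec[of \<phi>] by (simp add: good_minimal_maps_def is_coeff_vec_def)
      then show ?thesis
        by (simp add: proj_points_def)
    qed
    then show ?thesis
      by (auto simp: box_points_def vec_box_def)
  qed
  then have "finite (box_points d ?M r)" for r
    using finite_vec_box by (rule finite_subset)
  moreover have "box_points d ?V r \<subseteq> box_points d ?M r" for r
    using \<open>?V \<subseteq> ?M\<close> by (auto simp: box_points_def)
  ultimately have "box_ratio d ?V r \<le> box_ratio d ?M r" for r
    unfolding box_ratio_def by (intro divide_right_mono of_nat_mono card_mono) auto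
  \<comment> \<open>Only lower densities are compared; the existence of a density for the larger set
    is not claimed.\<close>
  then have "lower_weak_box_density d n ?V \<le> lower_weak_box_density d n ?M"
    unfolding lower_weak_box_density_def by (intro Liminf_mono always_eventually allI) simp
  moreover have "lower_weak_box_density d n ?V = ereal \<mu>"
    using \<mu>(2) by (simp add: has_weak_box_density_def)
  moreover have "0 < ereal \<mu>"
    using \<mu>(1) by simp
  ultimately have "lower_weak_box_density d n ?M > 0"
    by (metis less_le_trans)
  then show ?thesis
    using minimal \<mu> by blast
qed

end
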